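(* Assume $\mathrm{GRH}^+$. Suppose there exist infinitely many fundamental discriminants $-D<0$ satisfying $$5\,\gamma_1(-D)^2\, g(0,-D)<1 .$$ Then $0\le\Lambda_{\mathrm{Kr}}$.
   Context: For a fundamental discriminant $-D<0$ (so $D>0$) let $\chi=\chi_{-D}$ be the Kronecker symbol and $L(s,\chi)$ its Dirichlet $L$-function. $\mathrm{GRH}^+$ (standing assumption): for every fundamental discriminant $-D<0$, all nontrivial zeros of $L(s,\chi_{-D})$ lie on the line $\mathrm{Re}(s)=1/2$, and $L(1/2,\chi_{-D})\neq 0$. Zeros: under $\mathrm{GRH}^+$ the nontrivial zeros of $L(s,\chi)$ are $1/2+i\gamma$ with $\gamma$ real and nonzero, symmetric under $\gamma\mapsto-\gamma$. Let $0<\gamma_1\le\gamma_2\le\cdots$ be the positive $\gamma$'s, listed with multiplicity, write $\gamma_1(-D)=\gamma_1$, and put $\gamma_{-k}=-\gamma_k$ for $k\geq 1$. Define $$g(0,-D)=\sum_{j\in\mathbb Z\setminus\{-1,0,1\}}\left(\frac{1}{(\gamma_{-1}-\gamma_j)^2}+\frac{1}{(\gamma_{1}-\gamma_j)^2}\right),$$ interpreted as $+\infty$ if $\gamma_2=\gamma_1$ (in which case the inequality in the claim fails). Deformation: let $$\Phi(u,\chi)=4\sum_{n=1}^\infty\chi(n)\,n\exp\left(\frac{3u}{2}-\frac{n^2\pi e^{2u}}{D}\right),\qquad \Xi_t(x,\chi)=\int_0^\infty e^{tu^2}\Phi(u,\chi)\cos(ux)\,du$$ for real $t$ and complex $x$.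 With $s=1/2+ix$ one has $\Xi_0(x,\chi)=(D/\pi)^{(s+1)/2}\Gamma((s+1)/2)L(s,\chi)$. Constants: by (analogs of) theorems of de Bruijn and Newman there is a real constant $\Lambda_{-D}$, $-\infty<\Lambda_{-D}\le 1/2$, such that, as a function of the complex variable $x$, $\Xi_t(x,\chi)$ has only real zeros if and only if $t\ge\Lambda_{-D}$. Define $\Lambda_{\mathrm{Kr}}=\sup\{\Lambda_{-D} : -D<0 \text{ a fundamental discriminant}\}$. *)

theory Defs
  imports "HOL-Complex_Analysis.Complex_Analysis" "HOL-Number_Theory.Number_Theory"
    "HOL-Computational_Algebra.Squarefree"
begin

definition fundamental_discriminant :: "int \<Rightarrow> bool" where
  "fundamental_discriminant d \<longleftrightarrow>
     d mod 4 = 1 \<and> squarefree d \<or>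
     (\<exists>m. d = 4 * m \<and> (m mod 4 = 2 \<or> m mod 4 = 3) \<and> squarefree m)"

text \<open>A discriminant \<open>-D < 0\<close> is represented by the natural number \<open>D\<close> throughout.\<close>

definition neg_fund_disc :: "nat \<Rightarrow> bool" where
  "neg_fund_disc D \<longleftrightarrow> D > 0 \<and> fundamental_discriminant (- int D)"

definition kronecker_prime :: "int \<Rightarrow> nat \<Rightarrow> int" where
  "kronecker_prime a p =
     (if p = 2 then (if even a then 0 else if a mod 8 = 1 \<or> a mod 8 = 7 then 1 else -1)
      else Legendre a (int p))"

definition kronecker :: "int \<Rightarrow> nat \<Rightarrow> int" where
  "kronecker a n =
     (if n = 0 then (if \<bar>a\<bar> = 1 then 1 else 0)
      else (\<Prod>p\<in>prime_factors n. kronecker_prime a p ^ multiplicity p n))"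

definition chi :: "nat \<Rightarrow> nat \<Rightarrow> int" where
  "chi D n = kronecker (- int D) n"

text \<open>The Dirichlet L-function here is the entire continuation of its Dirichlet series; it is
  unique by the identity theorem and exists because the character is not principal.\<close>

definition L_chi :: "nat \<Rightarrow> complex \<Rightarrow> complex" where
  "L_chi D = (THE f. f holomorphic_on UNIV \<and>
     (\<forall>s. Re s > 1 \<longrightarrow>
        (\<lambda>n. of_int (chi D (Suc n)) / of_nat (Suc n) powr s) sums f s))"

text \<open>These characters are odd, so the trivial zeros are the poles \<open>-1, -3, -5, \<dots>\<close> of
  \<open>\<Gamma>((s+1)/2)\<close>.\<close>

definition nontrivial_zero :: "nat \<Rightarrow> complex \<Rightarrow> bool" where
  "nontrivial_zero D s \<longleftrightarrow> L_chi D s = 0 \<and> (\<nexists>k::nat. s = - of_nat (2 * k + 1))"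

definition GRH_plus :: bool where
  "GRH_plus \<longleftrightarrow> (\<forall>D. neg_fund_disc D \<longrightarrow>
     (\<forall>s. nontrivial_zero D s \<longrightarrow> Re s = 1 / 2) \<and> L_chi D (1 / 2) \<noteq> 0)"

definition critical_multiplicity :: "nat \<Rightarrow> real \<Rightarrow> nat" where
  "critical_multiplicity D t =
     (let s = Complex (1 / 2) t in if L_chi D s = 0 then nat (zorder (L_chi D) s) else 0)"

text \<open>\<open>\<gamma> 1 \<le> \<gamma> 2 \<le> \<dots>\<close> lists the positive ordinates with multiplicity, and
  \<open>\<gamma> (- k) = - \<gamma> k\<close>. Oddness also forces \<open>\<gamma> 0 = 0\<close>, which makes the function unique; that
  value is never used.\<close>

definition ordinate_enumeration :: "nat \<Rightarrow> (int \<Rightarrow> real) \<Rightarrow> bool" where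
  "ordinate_enumeration D \<gamma> \<longleftrightarrow>
     (\<forall>k. \<gamma> (- k) = - \<gamma> k) \<and>
     (\<forall>k\<ge>1. \<gamma> k > 0) \<and>
     mono_on {1..} \<gamma> \<and>
     (\<forall>t>0. finite {k\<in>{1..}. \<gamma> k = t} \<and>
            card {k\<in>{1..}. \<gamma> k = t} = critical_multiplicity D t)"

definition ordinate :: "nat \<Rightarrow> int \<Rightarrow> real" where
  "ordinate D = (THE \<gamma>. ordinate_enumeration D \<gamma>)"

text \<open>In \<^typ>\<open>ennreal\<close> one has \<open>1 / 0 = \<infinity>\<close>, so the value is \<open>\<infinity>\<close> when the first two
  ordinates coincide.\<close>

definition g0 :: "nat \<Rightarrow> ennreal" where
  "g0 D = (\<Sum>\<^sub>\<infinity>j\<in>UNIV - {-1, 0, 1}.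
     1 / ennreal ((ordinate D (-1) - ordinate D j)\<^sup>2) +
     1 / ennreal ((ordinate D 1 - ordinate D j)\<^sup>2))"

definition Phi :: "nat \<Rightarrow> real \<Rightarrow> real" where
  "Phi D u = 4 * (\<Sum>n. of_int (chi D (Suc n)) * real (Suc n) *
     exp (3 * u / 2 - (real (Suc n))\<^sup>2 * pi * exp (2 * u) / real D))"

definition Xi :: "nat \<Rightarrow> real \<Rightarrow> complex \<Rightarrow> complex" where
  "Xi D t x = (LINT u:{0..}|lborel.
     complex_of_real (exp (t * u\<^sup>2) * Phi D u) * cos (complex_of_real u * x))"

definition Lambda :: "nat \<Rightarrow> real" where
  "Lambda D = (THE l. \<forall>t. (\<forall>x. Xi D t x = 0 \<longrightarrow> x \<in> \<real>) \<longleftrightarrow> t \<ge> l)"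

definition Lambda_Kr :: ereal where
  "Lambda_Kr = (SUP D\<in>{D. neg_fund_disc D}. ereal (Lambda D))"

end

theory Submission
  imports Defs "HOL-Probability.Probability" "HOL-Real_Asymp.Real_Asymp"
begin

text \<open>
  Write \<open>a\<^sub>k(t)\<close> for the integral of \<open>u\<^bsup>2k\<^esup> e\<^bsup>tu\<^sup>2\<^esup> \<Phi>(u)\<close> over the positive half line and put
  \<open>H\<^sub>t(w) = \<Sum>k. a\<^sub>k(t) w\<^sup>k / (2k)!\<close>, so that \<open>\<Xi>\<^sub>t(x) = H\<^sub>t(-x\<^sup>2)\<close> and the derivative of \<open>a\<^sub>k\<close> is
  \<open>a\<^bsub>k+1\<^esub>\<close>. The theorem follows from a bound for a single discriminant
  (\<open>Lambda_lower_bound\<close>): if \<open>5 \<gamma>\<^sub>1\<^sup>2 g(0) < 1\<close> and \<open>c = ln (3D / (10\<pi>))\<close> is positive, then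
  \<open>\<Lambda> \<ge> -10/c\<close>. An infinite set of discriminants contains arbitrarily large \<open>D\<close>, so the supremum
  exceeds every negative number.

  The bound for one discriminant combines three facts.

  First, the zeros of \<open>H\<^sub>0\<close> are the numbers \<open>-\<gamma>\<^sub>k\<^sup>2\<close>, and \<open>H\<^sub>0\<close> has order less than one, hence is the
  product over its zeros (\<open>hadamard_product\<close>). With \<open>s\<^sub>j = \<Sum>k. \<gamma>\<^sub>k\<^bsup>-2j\<^esup>\<close> this gives
  \<open>s\<^sub>1 = a\<^sub>1 / (2 a\<^sub>0)\<close> and \<open>s\<^sub>1\<^sup>2 - s\<^sub>2 = a\<^sub>2 / (12 a\<^sub>0)\<close> at \<open>t = 0\<close>. For \<open>k \<ge> 2\<close> the ordinates \<open>\<plusminus>\<gamma>\<^sub>k\<close> contribute at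
  least \<open>4 / \<gamma>\<^sub>k\<^sup>2\<close> to \<open>g(0)\<close>, so the hypothesis says that \<open>1/\<gamma>\<^sub>1\<^sup>2\<close> carries almost all of \<open>s\<^sub>1\<close>. This yields
  \<open>5 s\<^sub>1\<^sup>2 \<le> 6 s\<^sub>2\<close>, that is \<open>2 a\<^sub>0 a\<^sub>2 \<le> a\<^sub>1\<^sup>2\<close> (\<open>turan_inequality\<close>).

  Secondly, this inequality limits how far back in time real zeros can persist
  (\<open>no_real_zeros_far_back\<close>). If \<open>\<Xi>\<^bsub>-T\<^esub>\<close> had only real zeros, then by de Bruijn's argument
  (\<open>real_zeros_gauss_weight\<close>) so would \<open>\<Xi>\<^sub>t\<close> for all \<open>t\<close> between \<open>-T\<close> and \<open>0\<close>, and the product formula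
  would make all \<open>a\<^sub>k(t)\<close> nonnegative there. The function \<open>2 a\<^sub>0 a\<^sub>2 - a\<^sub>1\<^sup>2\<close> has derivative
  \<open>2 a\<^sub>0 a\<^sub>3 \<ge> 0\<close>, so it is nonpositive on the whole interval. Therefore \<open>a\<^sub>1\<^sup>2 / a\<^sub>0\<close> does not increase with
  \<open>t\<close>, and \<open>\<surd>a\<^sub>0\<close> has slope at least \<open>a\<^sub>1(0) / (2\<surd>a\<^sub>0(0))\<close> throughout. Running backwards it would become
  negative before \<open>-T\<close> unless \<open>T \<le> 2 a\<^sub>0(0) / a\<^sub>1(0)\<close>. Hence \<open>\<Lambda> \<ge> -2 a\<^sub>0(0) / a\<^sub>1(0)\<close>.

  Thirdly, \<open>a\<^sub>0(0) / a\<^sub>1(0)\<close> tends to zero as \<open>D\<close> grows (\<open>moment_ratio_bound\<close>). The product formula bounds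
  \<open>H\<^sub>0(49/4) / H\<^sub>0(9/4)\<close> by \<open>exp (5 a\<^sub>1 / a\<^sub>0)\<close>, while these are the values of the completed \<open>L\<close>-function
  at \<open>s = 4\<close> and \<open>s = 2\<close>, whose quotient is at least \<open>3D / (10\<pi>)\<close>.

  All of this needs \<open>\<Xi>\<^sub>0\<close> to be the completed \<open>L\<close>-function, which is entire and has the symmetry
  \<open>s \<mapsto> 1 - s\<close>. The Kronecker symbol is identified by quadratic reciprocity as an odd primitive
  character (\<open>chi_odd_primitive_char\<close>); Poisson summation and the separability of Gauss sums give the
  functional equation of its theta series up to a constant; and the constant is \<open>1\<close> because
  \<open>L(1/2) \<noteq> 0\<close> (\<open>Phi_even\<close>). The Mellin transform of \<open>\<Phi>\<close> then provides the continuation of \<open>L\<close>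
  (\<open>L_chi_formula\<close>).
\<close>

section \<open>Hadamard products of order less than one\<close>

text \<open>The map \<open>w \<mapsto> w / (2A - w)\<close> sends the half plane \<open>Re w < A\<close> into the unit disc and fixes
  \<open>0\<close>, so Schwarz's lemma applies to its composition with \<open>f\<close>.\<close>
lemma borel_caratheodory:
  fixes f :: "complex \<Rightarrow> complex"
  assumes holf: "f holomorphic_on ball 0 R" and f0: "f 0 = 0" and A: "A > 0"
    and le: "\<And>z. norm z < R \<Longrightarrow> Re (f z) < A" and z: "norm z < R"
  shows "norm (f z) \<le> 2 * A * norm z / (R - norm z)"
proof -
  have R: "R > 0" using z by (meson norm_ge_zero le_less_trans)
  define \<phi> where "\<phi> \<zeta> = f (of_real R * \<zeta>) / (2 * of_real A - f (of_real R * \<zeta>))" for \<zeta>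
  have inR: "norm (of_real R * \<zeta>) < R" if "norm \<zeta> < 1" for \<zeta> :: complex
    using that R by (simp add: norm_mult)
  have ne: "2 * of_real A - f (of_real R * \<zeta>) \<noteq> 0" if "norm \<zeta> < 1" for \<zeta>
  proof
    assume "2 * of_real A - f (of_real R * \<zeta>) = 0"
    hence "Re (f (of_real R * \<zeta>)) = 2 * A" by (auto simp: complex_eq_iff)
    thus False using le[OF inR[OF that]] A by simp
  qed
  have holf': "(\<lambda>\<zeta>. f (of_real R * \<zeta>)) holomorphic_on ball 0 1"
  proof -
    have "(f \<circ> (\<lambda>\<zeta>. of_real R * \<zeta>)) holomorphic_on ball 0 1"
    proof (rule holomorphic_on_compose_gen[OF _ holf])
      show "(\<lambda>\<zeta>. of_real R * \<zeta>) holomorphic_on ball 0 1" by (intro holomorphic_intros)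
      show "(\<lambda>\<zeta>. of_real R * \<zeta>) ` ball 0 1 \<subseteq> ball (0::complex) R" using inR by auto
    qed
    thus ?thesis by (simp only: o_def)
  qed
  have hol: "\<phi> holomorphic_on ball 0 1"
    unfolding \<phi>_def by (intro holomorphic_intros holf') (use ne in auto)
  have lt1: "norm (\<phi> \<zeta>) < 1" if "norm \<zeta> < 1" for \<zeta>
  proof -
    let ?w = "f (of_real R * \<zeta>)"
    have "(norm ?w)\<^sup>2 < (norm (2 * of_real A - ?w))\<^sup>2"
      using le[OF inR[OF that]] A unfolding cmod_power2
      by (simp add: power2_eq_square algebra_simps)
    hence "norm ?w < norm (2 * of_real A - ?w)" using power2_less_imp_less norm_ge_zero by blast
    thus ?thesis unfolding \<phi>_def by (simp add: norm_divide divide_simps)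
  qed
  define \<zeta> where "\<zeta> = z / of_real R"
  have nz: "norm \<zeta> = norm z / R" using R by (simp add: \<zeta>_def norm_divide)
  have n1: "norm \<zeta> < 1" using nz z R by simp
  have \<phi>le: "norm (\<phi> \<zeta>) \<le> norm \<zeta>"
    using Schwarz_Lemma(1)[OF hol _ lt1 n1] f0 by (simp add: \<phi>_def)
  have Rz: "of_real R * \<zeta> = z" using R by (simp add: \<zeta>_def)
  have eq: "f z * (1 + \<phi> \<zeta>) = 2 * of_real A * \<phi> \<zeta>"
    using ne[OF n1] unfolding \<phi>_def Rz by (simp add: field_simps)
  have "norm (f z) * (1 - norm \<zeta>) \<le> norm (f z) * norm (1 + \<phi> \<zeta>)"
    using norm_triangle_ineq2[of 1 "- \<phi> \<zeta>"] \<phi>le by (intro mult_left_mono) auto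
  also have "\<dots> = 2 * A * norm (\<phi> \<zeta>)" using eq A by (metis norm_mult norm_of_real abs_of_pos norm_numeral)
  also have "\<dots> \<le> 2 * A * norm \<zeta>" using \<phi>le A by simp
  finally have "norm (f z) * (1 - norm z / R) \<le> 2 * A * (norm z / R)" by (simp add: nz)
  hence "R * (norm (f z) * (1 - norm z / R)) \<le> R * (2 * A * (norm z / R))"
    using R by (intro mult_left_mono) auto
  hence "norm (f z) * (R - norm z) \<le> 2 * A * norm z" using R by (simp add: algebra_simps)
  thus ?thesis using z by (simp add: pos_le_divide_eq)
qed

text \<open>The local factorisation at a zero is global, because away from the zero the cofactor is the
  plain quotient.\<close>
lemma divide_out_zero:
  assumes hol: "h holomorphic_on UNIV" and ha: "h a = 0" and nz: "h b \<noteq> 0"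
  shows "\<exists>n k. n > 0 \<and> k holomorphic_on UNIV \<and> k a \<noteq> 0 \<and> (\<forall>z. h z = (z - a) ^ n * k z)"
proof -
  have "\<not> h constant_on UNIV" using ha nz unfolding constant_on_def by (metis UNIV_I)
  from holomorphic_factor_zero_nonconstant[OF hol open_UNIV connected_UNIV UNIV_I ha this]
  obtain g r n where g: "0 < n" "0 < (r::real)" "g holomorphic_on ball a r"
      "\<And>w. w \<in> ball a r \<Longrightarrow> h w = (w - a)^n * g w" "\<And>w. w \<in> ball a r \<Longrightarrow> g w \<noteq> 0"
    by metis
  define k where "k z = (if z = a then g a else h z / (z - a) ^ n)" for z
  have kg: "k w = g w" if "w \<in> ball a r" for w using g(4)[OF that] by (auto simp: k_def)
  have "k holomorphic_on ball a r" using g(3) by (rule holomorphic_transform) (simp add: kg)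
  moreover have "(\<lambda>z. h z / (z - a) ^ n) holomorphic_on (- {a})"
    by (intro holomorphic_intros holomorphic_on_subset[OF hol]) auto
  hence "k holomorphic_on (- {a})" by (rule holomorphic_transform) (auto simp: k_def)
  ultimately have "k holomorphic_on (ball a r \<union> - {a})" by (rule holomorphic_on_Un) auto
  moreover have "ball a r \<union> - {a} = UNIV" using g(2) by auto
  ultimately have "k holomorphic_on UNIV" by simp
  moreover have "h z = (z - a) ^ n * k z" for z using g(1) ha by (auto simp: k_def)
  moreover have "k a \<noteq> 0" using g(2,5) by (simp add: k_def)
  ultimately show ?thesis using g(1) by blast
qed

text \<open>The factors are normalised as \<open>1 - z / a\<close> so that they are \<open>1\<close> at the origin and the cofactor
  keeps the value \<open>G 0\<close>. Zeros are removed one at a time with unspecified exponents; that the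
  exponents are the orders of the zeros follows afterwards from the nonvanishing of the cofactor.\<close>
lemma factor_out_zeros:
  assumes hol: "G holomorphic_on UNIV" and G0: "G 0 \<noteq> 0" and fin: "finite Z"
    and zero: "\<And>a. a \<in> Z \<Longrightarrow> G a = 0"
  shows "\<exists>h. h holomorphic_on UNIV \<and> (\<forall>a\<in>Z. h a \<noteq> 0) \<and>
           (\<forall>z. G z = (\<Prod>a\<in>Z. (1 - z / a) ^ nat (zorder G a)) * h z)"
proof -
  have "\<exists>h m. h holomorphic_on UNIV \<and> (\<forall>a\<in>Z. h a \<noteq> 0) \<and>
           (\<forall>z. G z = (\<Prod>a\<in>Z. (1 - z / a) ^ m a) * h z)"
    using fin zero
  proof (induction Z)
    case empty thus ?case using hol by auto
  next
    case (insert a Z)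
    have "\<exists>h m. h holomorphic_on UNIV \<and> (\<forall>a\<in>Z. h a \<noteq> 0) \<and>
           (\<forall>z. G z = (\<Prod>a\<in>Z. (1 - z / a) ^ m a) * h z)"
      by (rule insert.IH) (use insert.prems in auto)
    then obtain h m where h: "h holomorphic_on UNIV" "\<forall>a\<in>Z. h a \<noteq> 0"
       "\<And>z. G z = (\<Prod>a\<in>Z. (1 - z / a) ^ m a) * h z" by blast
    have a0: "a \<noteq> 0" using insert.prems[of a] G0 by auto
    have Z0: "b \<noteq> 0" if "b \<in> Z" for b using insert.prems[of b] G0 that by auto
    have "(\<Prod>b\<in>Z. (1 - a / b) ^ m b) \<noteq> 0"
      using insert.hyps Z0 by (auto simp: prod_zero_iff)
    hence "h a = 0" using h(3)[of a] insert.prems[of a] by simp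
    moreover have "h 0 \<noteq> 0" using h(3)[of 0] G0 by auto
    ultimately obtain n k where k: "k holomorphic_on UNIV" "k a \<noteq> 0" "\<And>z. h z = (z - a) ^ n * k z"
      using divide_out_zero[OF h(1)] by metis
    define m' where "m' = m(a := n)"
    define k' where "k' z = (- a) ^ n * k z" for z
    have "k' holomorphic_on UNIV" unfolding k'_def by (intro holomorphic_intros k)
    moreover have "\<forall>b\<in>insert a Z. k' b \<noteq> 0" using h(2) k a0 by (auto simp: k'_def)
    moreover have "G z = (\<Prod>b\<in>insert a Z. (1 - z / b) ^ m' b) * k' z" for z
    proof -
      have "(z - a) ^ n = (1 - z / a) ^ n * (- a) ^ n"
        using a0 by (simp add: power_mult_distrib[symmetric] algebra_simps)
      moreover have "(\<Prod>b\<in>Z. (1 - z / b) ^ m' b) = (\<Prod>b\<in>Z. (1 - z / b) ^ m b)"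
        using insert.hyps by (intro prod.cong) (auto simp: m'_def)
      ultimately show ?thesis using insert.hyps by (simp add: h(3) k k'_def m'_def)
    qed
    ultimately show ?case by blast
  qed
  then obtain h m where h: "h holomorphic_on UNIV" "\<And>a. a\<in>Z \<Longrightarrow> h a \<noteq> 0"
      "\<And>z. G z = (\<Prod>a\<in>Z. (1 - z / a) ^ m a) * h z" by blast
  have "zorder G a = int (m a)" if a: "a \<in> Z" for a
  proof (rule zorder_eqI[OF open_UNIV UNIV_I])
    have Z0: "b \<noteq> 0" if "b \<in> Z" for b using zero[of b] G0 that by auto
    define g where "g z = (\<Prod>b\<in>Z-{a}. (1 - z / b) ^ m b) * h z / (- a) ^ m a" for z
    show "g holomorphic_on UNIV" unfolding g_def using Z0
      by (intro holomorphic_intros h) auto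
    show "g a \<noteq> 0" using h(2)[OF a] Z0 fin by (auto simp: g_def prod_zero_iff a)
    show "G w = g w * (w - a) powi int (m a)" for w
    proof -
      have "(w - a) ^ m a = (1 - w / a) ^ m a * (- a) ^ m a"
        using Z0[OF a] by (simp add: power_mult_distrib[symmetric] algebra_simps)
      thus ?thesis using Z0[OF a] prod.remove[OF fin a, of "\<lambda>a. (1 - w / a) ^ m a"]
        by (simp add: g_def h(3))
    qed
  qed
  hence "(\<Prod>a\<in>Z. (1 - z / a) ^ m a) = (\<Prod>a\<in>Z. (1 - z / a) ^ nat (zorder G a))" for z
    by (intro prod.cong) auto
  thus ?thesis using h by metis
qed

definition zero_product :: "(complex \<Rightarrow> complex) \<Rightarrow> real \<Rightarrow> complex \<Rightarrow> complex" where
  "zero_product G R z = (\<Prod>a\<in>{a. G a = 0 \<and> norm a \<le> R}. (1 - z / a) ^ nat (zorder G a))"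

lemma finite_zeros_cball:
  assumes hol: "G holomorphic_on UNIV" and G0: "G b \<noteq> 0"
  shows "finite {a. G a = 0 \<and> norm a \<le> R}"
proof (cases "\<exists>a. G a = 0")
  case True
  hence "\<not> G constant_on UNIV" using G0 True unfolding constant_on_def by (metis UNIV_I)
  from holomorphic_compact_finite_zeros[OF hol open_UNIV connected_UNIV compact_cball _ this, of 0 R]
  show ?thesis by (rule finite_subset[rotated]) auto
qed auto

text \<open>Dividing \<open>G\<close> by its zeros in the disc of radius \<open>R\<close> leaves a function \<open>h\<close> without zeros there, so
  \<open>h = G 0 * exp l\<close> with \<open>l 0 = 0\<close>. On the circle of radius \<open>3R\<close> every factor \<open>1 - z / a\<close> has modulus
  at least \<open>2\<close>, so \<open>h\<close> inherits the growth bound of \<open>G\<close> and \<open>Re l\<close> is of size \<open>R\<^bsup>3/4\<^esup>\<close> in the disc.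
  The Borel-Caratheodory inequality turns this into \<open>l z = O(R\<^bsup>-1/4\<^esup>)\<close> on compact sets; here it
  matters that the exponent \<open>3/4\<close> is less than \<open>1\<close>.\<close>
lemma hadamard_product:
  assumes hol: "G holomorphic_on UNIV" and G0: "G 0 \<noteq> 0"
    and growth: "\<And>z. norm (G z) \<le> C * exp (norm z powr (3/4))"
  shows "uniform_limit (cball 0 r) (\<lambda>n z. G 0 * zero_product G (real n) z) G sequentially"
proof (rule uniform_limitI)
  fix e :: real assume e: "e > 0"
  define q where "q = max r 1"
  have q: "q \<ge> 1" "q \<ge> r" by (auto simp: q_def)
  have C: "C > 0" 
  proof -
    have "0 < norm (G 0)" using G0 by simp
    also have "\<dots> \<le> C" using growth[of 0] by simp
    finally show ?thesis .
  qed
  have "bounded (G ` cball 0 q)"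
    by (intro compact_imp_bounded compact_continuous_image
         holomorphic_on_imp_continuous_on holomorphic_on_subset[OF hol]) auto
  then obtain M where M: "M > 0" "\<And>z. norm z \<le> q \<Longrightarrow> norm (G z) \<le> M"
    unfolding bounded_pos by auto
  \<comment> \<open>The quotient of the partial product by \<open>G\<close> is \<open>exp (- l)\<close>, so it suffices that \<open>l\<close> is small.\<close>
  have "isCont (\<lambda>l::complex. exp (- l)) 0" by (intro continuous_intros)
  then obtain d where d: "d > 0" "\<And>l::complex. norm l < d \<Longrightarrow> norm (exp (- l) - 1) < e / M"
    using e M(1) unfolding isCont_def LIM_eq
    by (metis (no_types, lifting) divide_pos_pos diff_zero exp_zero minus_zero norm_zero diff_self)
  define A where "A n = \<bar>ln (C / norm (G 0))\<bar> + (3 * n) powr (3/4) + 1" for n :: real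
  have "((\<lambda>n. 2 * A n * q / (n - q)) \<longlongrightarrow> 0) at_top"
    unfolding A_def by real_asymp
  hence "((\<lambda>n. 2 * A (real n) * q / (real n - q)) \<longlongrightarrow> 0) sequentially"
    by (rule filterlim_compose) (rule filterlim_real_sequentially)
  hence "\<forall>\<^sub>F n in sequentially. 2 * A (real n) * q / (real n - q) < d"
    using d(1) by (rule order_tendstoD)
  moreover have "\<forall>\<^sub>F n in sequentially. real n > 2 * q"
    using eventually_gt_at_top[of "nat \<lceil>2 * q\<rceil>"] by eventually_elim linarith
  ultimately show "\<forall>\<^sub>F n in sequentially. \<forall>z\<in>cball 0 r.
            dist (G 0 * zero_product G (real n) z) (G z) < e"
  proof eventually_elim
    case (elim n)
    let ?R = "real n"
    define Z where "Z = {a. G a = 0 \<and> norm a \<le> ?R}"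
    have fin: "finite Z" unfolding Z_def by (rule finite_zeros_cball[OF hol G0])
    obtain h where h: "h holomorphic_on UNIV" "\<forall>a\<in>Z. h a \<noteq> 0"
        "\<And>z. G z = zero_product G ?R z * h z"
    proof -
      have "\<And>a. a \<in> Z \<Longrightarrow> G a = 0" by (simp add: Z_def)
      from factor_out_zeros[OF hol G0 fin this] show ?thesis
        using that unfolding zero_product_def Z_def[symmetric] by blast
    qed
    have h0: "h 0 = G 0" using h(3)[of 0] by (simp add: zero_product_def)
    have hnz: "h z \<noteq> 0" if "norm z \<le> ?R" for z
      using that h(2) h(3)[of z] by (auto simp: Z_def)
    have Rpos: "?R > 1" using elim q by linarith
    \<comment> \<open>maximum principle on the disc of radius \<open>3R\<close>\<close>
    have bnd: "norm (h z) \<le> C * exp ((3 * ?R) powr (3/4))" if "norm z < ?R" for z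
    proof (rule maximum_modulus_frontier[where S = "cball 0 (3 * ?R)" and f = h and \<xi> = z])
      show "z \<in> cball 0 (3 * ?R)" using that Rpos by auto
      fix w :: complex assume "w \<in> frontier (cball 0 (3 * ?R))"
      hence w: "norm w = 3 * ?R" using Rpos by (simp add: frontier_cball)
      have "1 \<le> norm (zero_product G ?R w)"
        unfolding zero_product_def prod_norm[symmetric] norm_power
      proof (intro prod_ge_1 one_le_power)
        fix a assume a: "a \<in> {a. G a = 0 \<and> norm a \<le> ?R}"
        hence a': "a \<noteq> 0" "norm a \<le> ?R" using G0 by auto
        have "norm (w / a) \<ge> 3" using a' w Rpos by (simp add: norm_divide divide_simps)
        thus "1 \<le> norm (1 - w / a)" using norm_triangle_ineq2[of "w / a" 1] by (simp add: norm_minus_commute)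
      qed
      hence "norm (h w) \<le> norm (G w)" unfolding h(3)[of w] norm_mult
        by (simp add: mult_le_cancel_right1)
      also have "\<dots> \<le> C * exp (norm w powr (3/4))" by (rule growth)
      finally show "norm (h w) \<le> C * exp ((3 * ?R) powr (3/4))" by (simp add: w)
    qed (auto intro!: holomorphic_on_imp_continuous_on holomorphic_on_subset[OF h(1)])
    have hol1: "(\<lambda>z. h z / G 0) holomorphic_on ball 0 ?R"
      by (intro holomorphic_intros holomorphic_on_subset[OF h(1)]) (use G0 in auto)
    have nz1: "h z / G 0 \<noteq> 0" if "z \<in> ball 0 ?R" for z using hnz G0 that by auto
    have "(0::complex) \<in> ball 0 ?R" using Rpos by simp
    from holomorphic_logarithm_exists[OF convex_ball open_ball hol1 nz1 this]
    obtain l where l: "l holomorphic_on ball 0 ?R"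
        and l2: "\<And>z. z \<in> ball 0 ?R \<Longrightarrow> exp (l z) = h z / G 0"
      by blast
    define l' where "l' z = l z - l 0" for z
    have l': "l' holomorphic_on ball 0 ?R" unfolding l'_def by (intro holomorphic_intros l)
    have el': "exp (l' z) = h z / G 0" if "norm z < ?R" for z
      using l2[of z] l2[of 0] that Rpos h0 G0 by (simp add: l'_def exp_diff)
    have Apos: "A ?R > 0" unfolding A_def by (simp add: add_nonneg_pos)
    have Rele: "Re (l' z) < A ?R" if "norm z < ?R" for z
    proof -
      have "exp (Re (l' z)) = norm (h z) / norm (G 0)"
        using el'[OF that] by (metis norm_divide norm_exp_eq_Re)
      also have "\<dots> \<le> C * exp ((3 * ?R) powr (3/4)) / norm (G 0)"
        using bnd[OF that] by (intro divide_right_mono) auto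
      also have "\<dots> = exp (ln (C / norm (G 0)) + (3 * ?R) powr (3/4))"
        using C G0 by (simp add: exp_add)
      finally have "Re (l' z) \<le> ln (C / norm (G 0)) + (3 * ?R) powr (3/4)" by simp
      thus ?thesis unfolding A_def by linarith
    qed
    show ?case
    proof
      fix z :: complex assume "z \<in> cball 0 r"
      hence z: "norm z \<le> q" using q by auto
      have zR: "norm z < ?R" using z elim q by linarith
      have "norm (l' z) \<le> 2 * A ?R * norm z / (?R - norm z)"
        by (rule borel_caratheodory[OF l' _ Apos Rele zR]) (auto simp: l'_def)
      also have "\<dots> \<le> 2 * A ?R * q / (?R - q)"
        using z elim q Apos by (intro frac_le mult_left_mono) auto
      also have "\<dots> < d" using elim by simp
      finally have lt: "norm (exp (- l' z) - 1) < e / M" by (rule d(2))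
      have "G 0 * zero_product G ?R z - G z = G z * (exp (- l' z) - 1)"
        using h(3)[of z] hnz[of z] zR G0 el'[OF zR] by (simp add: exp_minus field_simps)
      hence "dist (G 0 * zero_product G ?R z) (G z) = norm (G z) * norm (exp (- l' z) - 1)"
        by (simp add: dist_norm norm_mult)
      also have "\<dots> \<le> M * norm (exp (- l' z) - 1)"
        using M(2)[OF z] by (intro mult_right_mono) auto
      also have "\<dots> < e" using lt M(1) by (simp add: field_simps)
      finally show "dist (G 0 * zero_product G ?R z) (G z) < e" .
    qed
  qed
qed

section \<open>Entire functions with nonpositive real zeros\<close>

text \<open>These are the functions of Laguerre-Polya type that occur as \<open>H\<^sub>t\<close>. The exponent \<open>3/4\<close> is the one
  produced by the kernels below; any exponent less than \<open>1\<close> would serve the product formula.\<close>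
definition LP_class :: "(complex \<Rightarrow> complex) \<Rightarrow> bool" where
  "LP_class E \<longleftrightarrow> E holomorphic_on UNIV \<and> (\<exists>w. E w \<noteq> 0) \<and>
     (\<exists>C. \<forall>w. norm (E w) \<le> C * exp (norm w powr (3/4))) \<and> (\<forall>w. E w = 0 \<longrightarrow> w \<in> \<real>\<^sub>\<le>\<^sub>0)"

lemma LP_class_holo: "LP_class E \<Longrightarrow> E holomorphic_on UNIV"
  and LP_class_zero: "LP_class E \<Longrightarrow> E w = 0 \<Longrightarrow> w \<in> \<real>\<^sub>\<le>\<^sub>0"
  by (auto simp: LP_class_def)

text \<open>Outside the unit disc around \<open>a\<close> the division does not increase the modulus, and inside it the
  quotient is bounded by compactness, so the growth condition survives.\<close>
lemma LP_class_divide_zero: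
  assumes E: "LP_class E" and a: "E a = 0"
  shows "\<exists>n k. n > 0 \<and> LP_class k \<and> k a \<noteq> 0 \<and> (\<forall>z. E z = (z - a) ^ n * k z)"
proof -
  obtain b where b: "E b \<noteq> 0" using E by (auto simp: LP_class_def)
  obtain n k where nk: "n > 0" "k holomorphic_on UNIV" "k a \<noteq> 0" "\<And>z. E z = (z - a) ^ n * k z"
    using divide_out_zero[OF LP_class_holo[OF E] a b] by blast
  obtain C where C: "\<And>w. norm (E w) \<le> C * exp (norm w powr (3/4))"
    using E by (auto simp: LP_class_def)
  have C0: "C \<ge> 0" using order_trans[OF norm_ge_zero C[of 0]] by simp
  have "bounded (k ` cball a 1)"
    by (intro compact_imp_bounded compact_continuous_image
         holomorphic_on_imp_continuous_on holomorphic_on_subset[OF nk(2)]) auto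
  then obtain M where M: "M > 0" "\<And>z. dist a z \<le> 1 \<Longrightarrow> norm (k z) \<le> M"
    unfolding bounded_pos by auto
  have "norm (k w) \<le> (C + M) * exp (norm w powr (3/4))" for w
  proof (cases "dist a w \<le> 1")
    case True
    hence "norm (k w) \<le> M * 1" using M by simp
    also have "\<dots> \<le> M * exp (norm w powr (3/4))" using M(1) by (intro mult_left_mono) auto
    also have "\<dots> \<le> (C + M) * exp (norm w powr (3/4))" using C0 by (intro mult_right_mono) auto
    finally show ?thesis .
  next
    case False
    hence "1 \<le> norm (w - a) ^ n" by (intro one_le_power) (auto simp: dist_norm norm_minus_commute)
    hence "norm (k w) \<le> norm (E w)" unfolding nk(4)[of w] norm_mult norm_power
      by (simp add: mult_le_cancel_right1)
    also have "\<dots> \<le> C * exp (norm w powr (3/4))" by (rule C)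
    also have "\<dots> \<le> (C + M) * exp (norm w powr (3/4))" using M(1) by (intro mult_right_mono) auto
    finally show ?thesis .
  qed
  moreover have "w \<in> \<real>\<^sub>\<le>\<^sub>0" if "k w = 0" for w
    using LP_class_zero[OF E, of w] nk(4)[of w] that by simp
  ultimately have "LP_class k" using nk unfolding LP_class_def by blast
  thus ?thesis using nk by blast
qed

text \<open>Indexing the zeros by pairs repeats each according to its order, which gives the symmetric
  functions of the reciprocal zeros a direct meaning.\<close>
lemma zero_product_as_linear_factors:
  assumes hol: "E holomorphic_on UNIV" and E0: "E 0 \<noteq> 0"
  defines "I \<equiv> (\<lambda>R. SIGMA a:{a. E a = 0 \<and> norm a \<le> R}. {..<nat (zorder E a)})"
  shows "finite (I R)" and "zero_product E R z = (\<Prod>i\<in>I R. 1 + z * (- 1 / fst i))"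
proof -
  have fin: "finite {a. E a = 0 \<and> norm a \<le> R}" by (rule finite_zeros_cball[OF hol E0])
  thus "finite (I R)" unfolding I_def by auto
  have "(\<Prod>i\<in>I R. 1 + z * (- 1 / fst i)) = (\<Prod>(a,j)\<in>I R. 1 - z / a)"
    by (intro prod.cong) auto
  also have "\<dots> = zero_product E R z"
    unfolding zero_product_def I_def using fin by (subst prod.Sigma[symmetric]) auto
  finally show "zero_product E R z = (\<Prod>i\<in>I R. 1 + z * (- 1 / fst i))" by simp
qed

text \<open>Complex coefficients are kept because the products below are complex; membership in
  \<open>\<real>\<^sub>\<ge>\<^sub>0\<close> expresses that they are real and nonnegative.\<close>
definition nonneg_poly :: "complex poly \<Rightarrow> bool" where
  "nonneg_poly p \<longleftrightarrow> (\<forall>k. poly.coeff p k \<in> \<real>\<^sub>\<ge>\<^sub>0)"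

lemma nonneg_Reals_sum: "(\<And>i. i \<in> A \<Longrightarrow> f i \<in> \<real>\<^sub>\<ge>\<^sub>0) \<Longrightarrow> sum f A \<in> (\<real>\<^sub>\<ge>\<^sub>0 :: complex set)"
  by (induction A rule: infinite_finite_induct) auto

lemma nonneg_poly_mult: "nonneg_poly p \<Longrightarrow> nonneg_poly q \<Longrightarrow> nonneg_poly (p * q)"
  unfolding nonneg_poly_def coeff_mult by (auto intro!: nonneg_Reals_sum)

lemma nonneg_poly_prod: "(\<And>i. i \<in> A \<Longrightarrow> nonneg_poly (f i)) \<Longrightarrow> nonneg_poly (prod f A)"
proof (induction A rule: infinite_finite_induct)
  case (insert x F)
  thus ?case by (simp add: nonneg_poly_mult)
qed (auto simp: nonneg_poly_def coeff_pCons split: nat.splits)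

lemma nonneg_poly_pderiv: "nonneg_poly p \<Longrightarrow> nonneg_poly ((pderiv ^^ k) p)"
  by (induction k) (auto simp: nonneg_poly_def coeff_pderiv simp del: of_nat_Suc)

lemma nonneg_poly_eval: "nonneg_poly p \<Longrightarrow> x \<in> \<real>\<^sub>\<ge>\<^sub>0 \<Longrightarrow> poly p x \<in> \<real>\<^sub>\<ge>\<^sub>0"
  unfolding poly_altdef nonneg_poly_def by (auto intro!: nonneg_Reals_sum)

lemma higher_deriv_poly: "(deriv ^^ k) (poly p) = poly ((pderiv ^^ k) p)" for p :: "complex poly"
proof (induction k)
  case (Suc k)
  have "deriv (poly q) = poly (pderiv q)" for q :: "complex poly"
    by (rule ext) (rule DERIV_imp_deriv[OF poly_DERIV])
  thus ?case using Suc by simp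
qed auto

text \<open>The third equation is Newton's identity for the second elementary symmetric function.\<close>
lemma coeffs_linear_factors:
  fixes v :: "'i \<Rightarrow> 'a :: comm_ring_1"
  assumes "finite I"
  defines "p \<equiv> (\<Prod>i\<in>I. [:1, v i:])"
  shows "poly.coeff p 0 = 1" "poly.coeff p (Suc 0) = (\<Sum>i\<in>I. v i)"
    "2 * poly.coeff p 2 = (\<Sum>i\<in>I. v i)\<^sup>2 - (\<Sum>i\<in>I. (v i)\<^sup>2)"
proof -
  have "poly.coeff p 0 = 1 \<and> poly.coeff p (Suc 0) = (\<Sum>i\<in>I. v i) \<and>
    2 * poly.coeff p (Suc (Suc 0)) = (\<Sum>i\<in>I. v i)\<^sup>2 - (\<Sum>i\<in>I. (v i)\<^sup>2)"
    using assms(1) unfolding p_def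
    by (induction I) (auto simp: algebra_simps power2_eq_square)
  thus "poly.coeff p 0 = 1" "poly.coeff p (Suc 0) = (\<Sum>i\<in>I. v i)"
    "2 * poly.coeff p 2 = (\<Sum>i\<in>I. v i)\<^sup>2 - (\<Sum>i\<in>I. (v i)\<^sup>2)" by (auto simp: numeral_2_eq_2)
qed

lemma LP_class_hadamard:
  assumes E: "LP_class E" and E0: "E 0 \<noteq> 0"
  shows "uniform_limit (cball 0 r) (\<lambda>n z. E 0 * zero_product E (real n) z) E sequentially"
proof -
  obtain C where C: "\<And>w. norm (E w) \<le> C * exp (norm w powr (3/4))"
    using E by (auto simp: LP_class_def)
  show ?thesis by (rule hadamard_product[OF LP_class_holo[OF E] E0 C])
qed

lemma LP_class_hadamard_pointwise:
  assumes E: "LP_class E" and E0: "E 0 \<noteq> 0"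
  shows "(\<lambda>n. E 0 * zero_product E (real n) z) \<longlonglongrightarrow> E z"
  using tendsto_uniform_limitI[OF LP_class_hadamard[OF E E0, of "norm z"], of z] by simp

lemma higher_deriv_LP_limit:
  assumes E: "LP_class E" and E0: "E 0 \<noteq> 0"
  shows "(\<lambda>n. (deriv ^^ k) (\<lambda>z. E 0 * zero_product E (real n) z) 0) \<longlonglongrightarrow> (deriv ^^ k) E 0"
proof (rule higher_deriv_complex_uniform_limit[where A = "ball 0 1"])
  show "uniform_limit (ball 0 1) (\<lambda>n z. E 0 * zero_product E (real n) z) E sequentially"
    by (rule uniform_limit_on_subset[OF LP_class_hadamard[OF E E0, of 1]]) auto
  have "\<And>R. zero_product E R holomorphic_on ball 0 1" unfolding zero_product_def
    using E0 by (intro holomorphic_intros) auto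
  thus "\<forall>\<^sub>F n in sequentially. (\<lambda>z. E 0 * zero_product E (real n) z) holomorphic_on ball 0 1"
    by (intro always_eventually allI holomorphic_intros)
qed auto

definition zero_index :: "(complex \<Rightarrow> complex) \<Rightarrow> real \<Rightarrow> (complex \<times> nat) set" where
  "zero_index E R = (SIGMA a:{a. E a = 0 \<and> norm a \<le> R}. {..<nat (zorder E a)})"

definition zero_poly :: "(complex \<Rightarrow> complex) \<Rightarrow> real \<Rightarrow> complex poly" where
  "zero_poly E R = (\<Prod>i\<in>zero_index E R. [:1, - 1 / fst i:])"

lemma finite_zero_index: "LP_class E \<Longrightarrow> E 0 \<noteq> 0 \<Longrightarrow> finite (zero_index E R)"
  unfolding zero_index_def using zero_product_as_linear_factors(1)[OF LP_class_holo] by blast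

lemma zero_index_nonneg:
  assumes "LP_class E" "i \<in> zero_index E R" shows "- 1 / fst i \<in> \<real>\<^sub>\<ge>\<^sub>0"
proof -
  have "fst i \<in> \<real>\<^sub>\<le>\<^sub>0" using assms LP_class_zero by (auto simp: zero_index_def)
  then obtain x where "fst i = of_real x" "x \<le> 0" by (auto elim: nonpos_Reals_cases)
  moreover have "- 1 / complex_of_real x = of_real (- 1 / x)" by simp
  ultimately show ?thesis
    by (metis nonneg_Reals_of_real_iff divide_nonpos_nonpos neg_le_0_iff_le zero_le_one)
qed

lemma poly_zero_poly:
  assumes E: "LP_class E" and E0: "E 0 \<noteq> 0"
  shows "poly (zero_poly E R) z = zero_product E R z"
  unfolding zero_product_as_linear_factors(2)[OF LP_class_holo[OF E] E0] zero_poly_def poly_prod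
  by (simp add: zero_index_def)

lemma nonneg_zero_poly: "LP_class E \<Longrightarrow> nonneg_poly (zero_poly E R)"
  unfolding zero_poly_def
  using zero_index_nonneg[of E _ R]
  by (intro nonneg_poly_prod) (auto simp: nonneg_poly_def coeff_pCons simp del: divide_minus1 minus_divide_left[symmetric] split: nat.splits)

text \<open>Locally uniform convergence of holomorphic functions carries over to Taylor coefficients, so the
  coefficients of \<open>E / E 0\<close> are limits of the coefficients of the partial products.\<close>
lemma coeff_limit:
  assumes E: "LP_class E" and E0: "E 0 \<noteq> 0"
  shows "(\<lambda>n. poly ((pderiv ^^ k) (zero_poly E (real n))) 0) \<longlonglongrightarrow> (deriv ^^ k) E 0 / E 0"
proof -
  have eq: "(deriv ^^ k) (\<lambda>z. E 0 * zero_product E (real n) z) 0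
     = E 0 * poly ((pderiv ^^ k) (zero_poly E (real n))) 0" for n
  proof -
    have "(\<lambda>z. E 0 * zero_product E (real n) z) = poly (Polynomial.smult (E 0) (zero_poly E (real n)))"
      by (auto simp: poly_zero_poly[OF E E0])
    moreover have "(pderiv ^^ k) (Polynomial.smult c p) = Polynomial.smult c ((pderiv ^^ k) p)" for c and p :: "complex poly"
      by (induction k) (auto simp: pderiv_smult)
    ultimately show ?thesis by (simp add: higher_deriv_poly)
  qed
  have "(\<lambda>n. (deriv ^^ k) (\<lambda>z. E 0 * zero_product E (real n) z) 0 / E 0) \<longlonglongrightarrow> (deriv ^^ k) E 0 / E 0"
    by (intro tendsto_divide higher_deriv_LP_limit E E0 tendsto_const)
  thus ?thesis unfolding eq using E0 by simp
qed

text \<open>The partial products have factors \<open>1 + v z\<close> with \<open>v \<ge> 0\<close>, hence nonnegative coefficients.\<close>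
lemma LP_class_coeff_nonneg:
  assumes E: "LP_class E" and E0: "E 0 \<noteq> 0"
  shows "(deriv ^^ k) E 0 / E 0 \<in> \<real>\<^sub>\<ge>\<^sub>0"
  by (rule closed_sequentially[OF closed_nonneg_Reals_complex _ coeff_limit[OF E E0]])
     (intro nonneg_poly_eval nonneg_poly_pderiv nonneg_zero_poly E nonneg_Reals_zero_I)

definition zero_sum :: "(complex \<Rightarrow> complex) \<Rightarrow> nat \<Rightarrow> real \<Rightarrow> complex" where
  "zero_sum E j R = (\<Sum>i\<in>zero_index E R. (- 1 / fst i) ^ j)"

text \<open>This limit and the next one express the first two Taylor coefficients through the power sums of
  the negative reciprocals of the zeros.\<close>
lemma coeff1_limit:
  assumes E: "LP_class E" and E0: "E 0 \<noteq> 0"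
  shows "(\<lambda>n. zero_sum E 1 (real n)) \<longlonglongrightarrow> deriv E 0 / E 0"
  using coeff_limit[OF E E0, of 1]
  by (simp add: poly_0_coeff_0 coeff_pderiv zero_poly_def coeffs_linear_factors(2)[OF finite_zero_index[OF E E0]] zero_sum_def)

lemma coeff2_limit:
  assumes E: "LP_class E" and E0: "E 0 \<noteq> 0"
  shows "(\<lambda>n. (zero_sum E 1 (real n))\<^sup>2 - zero_sum E 2 (real n)) \<longlonglongrightarrow> (deriv ^^ 2) E 0 / E 0"
  using coeff_limit[OF E E0, of 2] coeffs_linear_factors(3)[OF finite_zero_index[OF E E0], of "\<lambda>i. -1 / fst i"]
  by (simp add: numeral_2_eq_2 poly_0_coeff_0 coeff_pderiv zero_poly_def zero_sum_def)

text \<open>Each factor satisfies \<open>1 + x2 v \<le> (1 + x1 v) exp ((x2 - x1) v)\<close> for \<open>v \<ge> 0\<close>, and the sum of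
  all \<open>v\<close> is the logarithmic derivative at the origin.\<close>
lemma LP_class_growth_on_pos_axis:
  assumes E: "LP_class E" and E0: "E 0 \<noteq> 0" and x: "0 \<le> x1" "x1 \<le> x2"
  shows "norm (E (of_real x2)) \<le> norm (E (of_real x1)) * exp ((x2 - x1) * Re (deriv E 0 / E 0))"
proof (rule LIMSEQ_le)
  show "(\<lambda>n. norm (E 0 * zero_product E (real n) (of_real x2))) \<longlonglongrightarrow> norm (E (of_real x2))"
    by (intro tendsto_norm LP_class_hadamard_pointwise E E0)
  show "(\<lambda>n. norm (E 0 * zero_product E (real n) (of_real x1)) * exp ((x2 - x1) * Re (zero_sum E 1 (real n))))
    \<longlonglongrightarrow> norm (E (of_real x1)) * exp ((x2 - x1) * Re (deriv E 0 / E 0))"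
    by (intro tendsto_intros LP_class_hadamard_pointwise coeff1_limit E E0)
  have "norm (zero_product E R (of_real x2)) \<le> norm (zero_product E R (of_real x1)) * exp ((x2 - x1) * Re (zero_sum E 1 R))" for R
  proof -
    have fin: "finite (zero_index E R)" by (rule finite_zero_index[OF E E0])
    have zp: "zero_product E R z = (\<Prod>i\<in>zero_index E R. 1 + z * (- 1 / fst i))" for z
      using zero_product_as_linear_factors(2)[OF LP_class_holo[OF E] E0] by (simp add: zero_index_def)
    have "norm (zero_product E R (of_real x2)) = (\<Prod>i\<in>zero_index E R. norm (1 + of_real x2 * (- 1 / fst i)))"
      unfolding zp by (rule prod_norm[symmetric])
    also have "\<dots> \<le> (\<Prod>i\<in>zero_index E R. norm (1 + of_real x1 * (- 1 / fst i)) * exp ((x2 - x1) * Re (- 1 / fst i)))"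
    proof (intro prod_mono conjI norm_ge_zero)
      fix i assume i: "i \<in> zero_index E R"
      obtain v where v: "- 1 / fst i = of_real v" "v \<ge> 0"
        using zero_index_nonneg[OF E i] by (rule nonneg_Reals_cases)
      have n: "norm (1 + complex_of_real x * of_real v) = 1 + x * v" if "x \<ge> 0" for x
      proof -
        have "1 + complex_of_real x * of_real v = of_real (1 + x * v)" by simp
        thus ?thesis using that v(2) by (metis abs_of_nonneg add_nonneg_nonneg mult_nonneg_nonneg norm_of_real zero_le_one)
      qed
      have "1 + x2 * v \<le> (1 + x1 * v) * (1 + (x2 - x1) * v)"
        using x v(2) by (simp add: algebra_simps mult_nonneg_nonneg mult_left_mono mult_mono)
      also have "\<dots> \<le> (1 + x1 * v) * exp ((x2 - x1) * v)"
        using x v(2) exp_ge_add_one_self[of "(x2 - x1) * v"] by (intro mult_left_mono) auto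
      finally show "norm (1 + of_real x2 * (- 1 / fst i)) \<le> norm (1 + of_real x1 * (- 1 / fst i)) * exp ((x2 - x1) * Re (- 1 / fst i))"
        unfolding v(1) using n[of x1] n[of x2] x by simp
    qed
    also have "\<dots> = norm (zero_product E R (of_real x1)) * exp ((x2 - x1) * Re (zero_sum E 1 R))"
      unfolding zp prod.distrib prod_norm zero_sum_def exp_sum[OF fin, symmetric]
      by (simp add: sum_distrib_left Re_sum)
    finally show ?thesis .
  qed
  thus "\<exists>N. \<forall>n\<ge>N. norm (E 0 * zero_product E (real n) (of_real x2)) \<le>
     norm (E 0 * zero_product E (real n) (of_real x1)) * exp ((x2 - x1) * Re (zero_sum E 1 (real n)))"
    by (auto simp: norm_mult mult.assoc intro!: mult_left_mono)
qed

text \<open>All Taylor coefficients have the same sign, which can be read off at any positive point. A zero at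
  the origin is divided out first, since the product formula needs \<open>E 0 \<noteq> 0\<close>.\<close>
lemma LP_class_derivs_nonneg:
  assumes E: "LP_class E" and x: "x > 0" and Ex: "E (of_real x) \<in> \<real>\<^sub>\<ge>\<^sub>0"
  shows "(deriv ^^ k) E 0 \<in> \<real>\<^sub>\<ge>\<^sub>0"
proof -
  have *: "E' 0 \<in> \<real>\<^sub>\<ge>\<^sub>0" if E': "LP_class E'" "E' 0 \<noteq> 0" "E' (of_real x) \<in> \<real>\<^sub>\<ge>\<^sub>0" for E'
  proof -
    have "(\<lambda>n. E' 0 * zero_product E' (real n) (of_real x) / E' 0) \<longlonglongrightarrow> E' (of_real x) / E' 0"
      by (intro tendsto_intros LP_class_hadamard_pointwise E')
    hence "(\<lambda>n. poly (zero_poly E' (real n)) (of_real x)) \<longlonglongrightarrow> E' (of_real x) / E' 0"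
      using E' by (simp add: poly_zero_poly)
    hence "E' (of_real x) / E' 0 \<in> \<real>\<^sub>\<ge>\<^sub>0"
      by (rule closed_sequentially[OF closed_nonneg_Reals_complex, rotated])
         (intro nonneg_poly_eval nonneg_zero_poly E', use x in auto)
    moreover have "E' (of_real x) \<noteq> 0" using LP_class_zero[OF E'(1), of "of_real x"] x by auto
    moreover have "E' (of_real x) / (E' (of_real x) / E' 0) \<in> \<real>\<^sub>\<ge>\<^sub>0"
      by (rule nonneg_Reals_divide_I[OF E'(3) calculation(1)])
    moreover have "E' (of_real x) / (E' (of_real x) / E' 0) = E' 0" using \<open>E' (of_real x) \<noteq> 0\<close> by simp
    ultimately show ?thesis by metis
  qed
  have main: "(deriv ^^ k) E' 0 \<in> \<real>\<^sub>\<ge>\<^sub>0" if E': "LP_class E'" "E' 0 \<noteq> 0" "E' (of_real x) \<in> \<real>\<^sub>\<ge>\<^sub>0" for E' k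
    using nonneg_Reals_mult_I[OF *[OF E'] LP_class_coeff_nonneg[OF E'(1,2), of k]] E'(2) by simp
  show ?thesis
  proof (cases "E 0 = 0")
    case False thus ?thesis using main E Ex by blast
  next
    case True
    obtain m E' where E': "LP_class E'" "E' 0 \<noteq> 0" "\<And>z. E z = z ^ m * E' z"
      using LP_class_divide_zero[OF E True] by auto
    have "E' (of_real x) = E (of_real x) / of_real x ^ m" using E'(3) x by simp
    also have "\<dots> \<in> \<real>\<^sub>\<ge>\<^sub>0" using Ex x by (intro nonneg_Reals_divide_I nonneg_Reals_pow_I) auto
    finally have d: "(deriv ^^ j) E' 0 \<in> \<real>\<^sub>\<ge>\<^sub>0" for j using main E' by blast
    have "(deriv ^^ k) E 0 = (deriv ^^ k) (\<lambda>z. z ^ m * E' z) 0" using E'(3) by presburger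
    also have "\<dots> = (\<Sum>j = 0..k. of_nat (k choose j) * (deriv ^^ j) (\<lambda>z. z ^ m) 0 * (deriv ^^ (k - j)) E' 0)"
      by (rule higher_deriv_mult[OF _ LP_class_holo[OF E'(1)]]) (auto intro!: holomorphic_intros)
    also have "\<dots> \<in> \<real>\<^sub>\<ge>\<^sub>0"
    proof (intro nonneg_Reals_sum nonneg_Reals_mult_I d)
      fix j
      have "(\<lambda>z. z ^ m) = poly (Polynomial.monom (1::complex) m)" by (auto simp: poly_monom)
      moreover have "nonneg_poly (Polynomial.monom 1 m)" by (auto simp: nonneg_poly_def)
      ultimately show "(deriv ^^ j) (\<lambda>z. z ^ m) 0 \<in> (\<real>\<^sub>\<ge>\<^sub>0 :: complex set)"
        by (simp add: higher_deriv_poly) (intro nonneg_poly_eval nonneg_poly_pderiv nonneg_Reals_zero_I)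
    qed auto
    finally show ?thesis .
  qed
qed

text \<open>The product over the empty set of zeros is constant.\<close>
lemma LP_class_no_zeros_constant:
  assumes E: "LP_class E" and nz: "\<And>z. E z \<noteq> 0"
  shows "E z = E 0"
proof -
  have "(\<lambda>n. E 0 * zero_product E (real n) z) = (\<lambda>n. E 0)" by (auto simp: zero_product_def nz)
  with LP_class_hadamard_pointwise[OF E nz, of z] show ?thesis by (simp add: LIMSEQ_const_iff)
qed

text \<open>With \<open>a = - r\<^sup>2\<close> one has \<open>- w\<^sup>2 - a = (r - w) (r + w)\<close>. For \<open>z\<close> in the upper half plane the point
  \<open>z + \<i> l\<close> is farther from the real numbers \<open>r\<close> and \<open>- r\<close> than \<open>z - \<i> l\<close> is.\<close>
lemma square_shift_gap:
  fixes z a :: complex and l :: real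
  assumes a: "a \<in> \<real>\<^sub>\<le>\<^sub>0" and z: "Im z > 0" and l: "l > 0"
  shows "norm (- (z - \<i> * of_real l)\<^sup>2 - a) < norm (- (z + \<i> * of_real l)\<^sup>2 - a)"
proof -
  obtain r where r: "a = - of_real (r\<^sup>2)" "r \<ge> 0"
  proof -
    obtain x where "a = of_real x" "x \<le> 0" using a by (auto elim: nonpos_Reals_cases)
    thus ?thesis using that[of "sqrt (- x)"] by simp
  qed
  have fac: "- w\<^sup>2 - a = (of_real r - w) * (of_real r + w)" for w :: complex
    unfolding r by (simp add: power2_eq_square algebra_simps)
  have lt: "norm (z + of_real s - \<i> * of_real l) < norm (z + of_real s + \<i> * of_real l)" for s :: real
  proof -
    have "(norm (z + of_real s - \<i> * of_real l))\<^sup>2 < (norm (z + of_real s + \<i> * of_real l))\<^sup>2"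
      unfolding cmod_power2 using z l by (simp add: power2_eq_square algebra_simps mult_pos_pos)
    thus ?thesis using power2_less_imp_less norm_ge_zero by blast
  qed
  have "norm (of_real r - (z - \<i> * of_real l)) * norm (of_real r + (z - \<i> * of_real l))
      < norm (of_real r - (z + \<i> * of_real l)) * norm (of_real r + (z + \<i> * of_real l))"
  proof (rule mult_strict_mono)
    show "norm (of_real r - (z - \<i> * of_real l)) < norm (of_real r - (z + \<i> * of_real l))"
      using lt[of "-r"] by (metis (no_types, lifting) add_diff_eq diff_add_eq diff_conv_add_uminus norm_minus_commute of_real_minus add.commute)
    show "norm (of_real r + (z - \<i> * of_real l)) < norm (of_real r + (z + \<i> * of_real l))"
      using lt[of r] by (simp add: algebra_simps)
    show "0 < norm (of_real r - (z + \<i> * of_real l))" using z l by (auto simp: complex_eq_iff)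
  qed auto
  thus ?thesis unfolding fac norm_mult .
qed

text \<open>The comparison of single factors multiplies up over all zeros.\<close>
lemma LP_class_shift_mono:
  assumes E: "LP_class E" and z: "Im z > 0" and l: "l > 0"
  shows "norm (E (- (z - \<i> * of_real l)\<^sup>2)) \<le> norm (E (- (z + \<i> * of_real l)\<^sup>2))"
proof -
  let ?A = "- (z + \<i> * of_real l)\<^sup>2" let ?B = "- (z - \<i> * of_real l)\<^sup>2"
  have gap: "norm (?B - a) \<le> norm (?A - a)" if "a \<in> \<real>\<^sub>\<le>\<^sub>0" for a
    using square_shift_gap[OF that z l] by simp
  have *: "norm (E' ?B) \<le> norm (E' ?A)" if E': "LP_class E'" "E' 0 \<noteq> 0" for E'
  proof (rule LIMSEQ_le)
    show "(\<lambda>n. norm (E' 0 * zero_product E' (real n) ?B)) \<longlonglongrightarrow> norm (E' ?B)"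
      by (intro tendsto_norm LP_class_hadamard_pointwise E')
    show "(\<lambda>n. norm (E' 0 * zero_product E' (real n) ?A)) \<longlonglongrightarrow> norm (E' ?A)"
      by (intro tendsto_norm LP_class_hadamard_pointwise E')
    have "norm (zero_product E' R ?B) \<le> norm (zero_product E' R ?A)" for R
      unfolding zero_product_def prod_norm[symmetric] norm_power
    proof (intro prod_mono conjI zero_le_power norm_ge_zero power_mono)
      fix a assume "a \<in> {a. E' a = 0 \<and> norm a \<le> R}"
      hence a: "a \<in> \<real>\<^sub>\<le>\<^sub>0" "a \<noteq> 0" using LP_class_zero[OF E'(1)] E'(2) by auto
      have "norm (1 - w / a) = norm (w - a) / norm a" for w
        using a(2) by (simp add: norm_divide[symmetric] diff_divide_distrib norm_minus_commute)
      thus "norm (1 - ?B / a) \<le> norm (1 - ?A / a)" using gap[OF a(1)] by (simp only: divide_right_mono[OF _ norm_ge_zero])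
    qed
    thus "\<exists>N. \<forall>n\<ge>N. norm (E' 0 * zero_product E' (real n) ?B) \<le> norm (E' 0 * zero_product E' (real n) ?A)"
      by (auto simp: norm_mult intro!: mult_left_mono)
  qed
  show ?thesis
  proof (cases "E 0 = 0")
    case False thus ?thesis using * E by blast
  next
    case True
    obtain m E' where E': "LP_class E'" "E' 0 \<noteq> 0" "\<And>z. E z = (z - 0) ^ m * E' z"
      using LP_class_divide_zero[OF E True] by blast
    show ?thesis unfolding E'(3) norm_mult norm_power
      by (intro mult_mono power_mono gap * E') auto
  qed
qed

text \<open>In the upper half plane the second term has strictly smaller modulus than the first, as one zero
  already gives a strict inequality; so the two terms cannot cancel. The lower half plane reduces to
  the upper one by \<open>z \<mapsto> - z\<close>, which exchanges the two terms.\<close>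
lemma LP_class_shift_sum_nonzero:
  assumes E: "LP_class E" and z: "z \<notin> \<real>" and l: "l > 0"
  shows "E (- (z + \<i> * of_real l)\<^sup>2) + E (- (z - \<i> * of_real l)\<^sup>2) \<noteq> 0"
proof -
  have pos: "E (- (z + \<i> * of_real l)\<^sup>2) + E (- (z - \<i> * of_real l)\<^sup>2) \<noteq> 0" if z: "Im z > 0" for z
  proof (cases "\<exists>a. E a = 0")
    case False
    thus ?thesis using LP_class_no_zeros_constant[OF E] using False by (metis mult_2 mult_eq_0_iff zero_neq_numeral)
  next
    case True
    then obtain a where a: "E a = 0" by blast
    then obtain m E' where E': "m > 0" "LP_class E'" "\<And>z. E z = (z - a) ^ m * E' z"
      using LP_class_divide_zero[OF E] by blast
    let ?A = "- (z + \<i> * of_real l)\<^sup>2" let ?B = "- (z - \<i> * of_real l)\<^sup>2"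
    have ar: "a \<in> \<real>\<^sub>\<le>\<^sub>0" by (rule LP_class_zero[OF E a])
    have "?A \<notin> \<real>\<^sub>\<le>\<^sub>0"
    proof
      assume "?A \<in> \<real>\<^sub>\<le>\<^sub>0"
      then obtain x where x: "?A = of_real x" "x \<le> 0" by (rule nonpos_Reals_cases)
      hence "(z + \<i> * of_real l)\<^sup>2 = (of_real (sqrt (- x)))\<^sup>2"
        by (metis minus_equation_iff of_real_minus of_real_power real_sqrt_pow2 neg_0_le_iff_le)
      hence "z + \<i> * of_real l = of_real (sqrt (- x)) \<or> z + \<i> * of_real l = - of_real (sqrt (- x))"
        by (simp add: power2_eq_iff)
      hence "Im (z + \<i> * of_real l) = 0" by (metis Im_complex_of_real neg_equal_0_iff_equal uminus_complex.simps(2))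
      thus False using z l by simp
    qed
    hence nz: "E' ?A \<noteq> 0" using LP_class_zero[OF E'(2)] by blast
    have "norm (E ?B) \<le> norm (?B - a) ^ m * norm (E' ?A)"
      unfolding E'(3)[of ?B] norm_mult norm_power
      by (intro mult_left_mono LP_class_shift_mono E' z l) auto
    also have "\<dots> < norm (?A - a) ^ m * norm (E' ?A)"
      using square_shift_gap[OF ar z l] E'(1) nz by (intro mult_strict_right_mono power_strict_mono) auto
    also have "\<dots> = norm (E ?A)" by (simp add: E'(3)[of ?A] norm_mult norm_power)
    finally have "norm (E ?B) < norm (E ?A)" .
    thus ?thesis by (metis add_eq_0_iff norm_minus_cancel less_irrefl)
  qed
  have "(- z + \<i> * of_real l)\<^sup>2 = (z - \<i> * of_real l)\<^sup>2" "(- z - \<i> * of_real l)\<^sup>2 = (z + \<i> * of_real l)\<^sup>2"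
    by (simp_all add: power2_eq_square algebra_simps)
  note sq = this
  show ?thesis
  proof (cases "Im z > 0")
    case False
    hence "Im (- z) > 0" using z by (auto simp: complex_is_Real_iff)
    from pos[OF this] show ?thesis unfolding sq by (simp only: add.commute not_False_eq_True)
  qed (rule pos)
qed

section \<open>Cosine transforms of rapidly decreasing kernels\<close>

text \<open>The weight allows multiplication by any Gaussian \<open>exp (r u\<^sup>2)\<close> and, through the cubic term, by
  \<open>exp (u q)\<close> with an explicit dependence on \<open>q\<close> that keeps the order of the transforms below two.\<close>
definition rapid :: "(real \<Rightarrow> real) \<Rightarrow> bool" where
  "rapid \<phi> \<longleftrightarrow> \<phi> \<in> borel_measurable borel \<and>
     (\<forall>r. set_integrable lborel {0..} (\<lambda>u. exp (r * u\<^sup>2 + u ^ 3) * \<phi> u))"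

text \<open>Functions of this growth are integrable against every rapid kernel.\<close>
definition dominated :: "(real \<Rightarrow> 'a::real_normed_vector) \<Rightarrow> real \<Rightarrow> real \<Rightarrow> bool" where
  "dominated g B r \<longleftrightarrow> (\<forall>u\<ge>0. norm (g u) \<le> B * exp (r * u\<^sup>2 + u ^ 3))"

definition half_integral :: "(real \<Rightarrow> real) \<Rightarrow> (real \<Rightarrow> complex) \<Rightarrow> complex" where
  "half_integral \<phi> g = (LINT u:{0..}|lborel. complex_of_real (\<phi> u) * g u)"

text \<open>Only even powers enter, since the cosine is even; the index counts them.\<close>
definition moment :: "(real \<Rightarrow> real) \<Rightarrow> nat \<Rightarrow> real" where
  "moment \<phi> k = (LINT u:{0..}|lborel. \<phi> u * u ^ (2 * k))"

definition cos_transform :: "(real \<Rightarrow> real) \<Rightarrow> complex \<Rightarrow> complex" where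
  "cos_transform \<phi> x = half_integral \<phi> (\<lambda>u. cos (of_real u * x))"

text \<open>This is the function \<open>H\<close> with \<open>cos_transform \<phi> x = H (- x\<^sup>2)\<close>. Passing to \<open>- x\<^sup>2\<close> halves the order
  and turns real zeros into nonpositive ones.\<close>
definition moment_series :: "(real \<Rightarrow> real) \<Rightarrow> complex \<Rightarrow> complex" where
  "moment_series \<phi> w = (\<Sum>k. of_real (moment \<phi> k / fact (2 * k)) * w ^ k)"

lemma rapid_measurable [measurable_dest]: "rapid \<phi> \<Longrightarrow> \<phi> \<in> borel_measurable borel"
  by (simp add: rapid_def)

lemma rapid_integrable:
  assumes \<phi>: "rapid \<phi>" and [measurable]: "g \<in> borel_measurable borel" and g: "dominated g B r"
  shows "set_integrable lborel {0..} (\<lambda>u. complex_of_real (\<phi> u) * g u)"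
proof (rule set_integrable_bound)
  note [measurable] = rapid_measurable[OF \<phi>]
  show "set_integrable lborel {0..} (\<lambda>u. B * (exp (r * u\<^sup>2 + u ^ 3) * \<phi> u))"
    using \<phi> by (intro set_integrable_mult_right) (auto simp: rapid_def)
  show "set_borel_measurable lborel {0..} (\<lambda>u. complex_of_real (\<phi> u) * g u)"
    unfolding set_borel_measurable_def by measurable
  have "norm (g u) * \<bar>\<phi> u\<bar> \<le> \<bar>B\<bar> * exp (r * u\<^sup>2 + u ^ 3) * \<bar>\<phi> u\<bar>" if "u \<ge> 0" for u
  proof (rule mult_right_mono)
    have "norm (g u) \<le> B * exp (r * u\<^sup>2 + u ^ 3)" using g that by (auto simp: dominated_def)
    also have "\<dots> \<le> \<bar>B\<bar> * exp (r * u\<^sup>2 + u ^ 3)" by (intro mult_right_mono) auto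
    finally show "norm (g u) \<le> \<bar>B\<bar> * exp (r * u\<^sup>2 + u ^ 3)" .
  qed auto
  thus "AE u in lborel. u \<in> {0..} \<longrightarrow> norm (complex_of_real (\<phi> u) * g u) \<le> norm (B * (exp (r * u\<^sup>2 + u ^ 3) * \<phi> u))"
    by (intro AE_I2) (auto simp: norm_mult abs_mult mult_ac)
qed

lemma half_integral_tendsto:
  fixes g :: "nat \<Rightarrow> real \<Rightarrow> complex"
  assumes \<phi>: "rapid \<phi>" and [measurable]: "\<And>n. g n \<in> borel_measurable borel" "G \<in> borel_measurable borel"
    and dom: "\<And>n. dominated (g n) B r" and lim: "\<And>u. u \<ge> 0 \<Longrightarrow> (\<lambda>n. g n u) \<longlonglongrightarrow> G u"
  shows "(\<lambda>n. half_integral \<phi> (g n)) \<longlonglongrightarrow> half_integral \<phi> G"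
  unfolding half_integral_def set_lebesgue_integral_def
proof (rule integral_dominated_convergence)
  note [measurable] = rapid_measurable[OF \<phi>]
  show "integrable lborel (\<lambda>u. norm (indicator {0..} u *\<^sub>R (complex_of_real (\<phi> u) * of_real (B * exp (r * u\<^sup>2 + u ^ 3)))))"
    using rapid_integrable[OF \<phi>, of "\<lambda>u. of_real (B * exp (r * u\<^sup>2 + u ^ 3))" "\<bar>B\<bar>" r]
    unfolding set_integrable_def by (intro integrable_norm) (auto simp: dominated_def abs_mult norm_mult)
  show "AE u in lborel. (\<lambda>n. indicat_real {0..} u *\<^sub>R (complex_of_real (\<phi> u) * g n u))
      \<longlonglongrightarrow> indicat_real {0..} u *\<^sub>R (complex_of_real (\<phi> u) * G u)"
  proof (rule AE_I2)
    fix u :: real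
    show "(\<lambda>n. indicat_real {0..} u *\<^sub>R (complex_of_real (\<phi> u) * g n u))
      \<longlonglongrightarrow> indicat_real {0..} u *\<^sub>R (complex_of_real (\<phi> u) * G u)"
      using lim[of u] by (cases "u \<ge> 0") (auto intro!: tendsto_intros)
  qed
  show "(\<lambda>u. indicat_real {0..} u *\<^sub>R (complex_of_real (\<phi> u) * G u)) \<in> borel_measurable lborel"
    by measurable
  fix n
  show "(\<lambda>u. indicat_real {0..} u *\<^sub>R (complex_of_real (\<phi> u) * g n u)) \<in> borel_measurable lborel"
    by measurable
  show "AE u in lborel. norm (indicat_real {0..} u *\<^sub>R (complex_of_real (\<phi> u) * g n u))
      \<le> norm (indicator {0..} u *\<^sub>R (complex_of_real (\<phi> u) * of_real (B * exp (r * u\<^sup>2 + u ^ 3))))"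
  proof (rule AE_I2)
    fix u :: real
    have "norm (g n u) \<le> \<bar>B * exp (r * u\<^sup>2 + u ^ 3)\<bar>" if "u \<ge> 0"
      using dom[of n] that unfolding dominated_def by fastforce
    thus "norm (indicat_real {0..} u *\<^sub>R (complex_of_real (\<phi> u) * g n u))
      \<le> norm (indicator {0..} u *\<^sub>R (complex_of_real (\<phi> u) * of_real (B * exp (r * u\<^sup>2 + u ^ 3))))"
      by (cases "u \<ge> 0") (auto simp: norm_mult simp del: of_real_mult intro!: mult_left_mono)
  qed
qed

lemma half_integral_sum:
  assumes "rapid \<phi>" and "finite I" and "\<And>i. i \<in> I \<Longrightarrow> g i \<in> borel_measurable borel"
    and "\<And>i. i \<in> I \<Longrightarrow> dominated (g i) (B i) (r i)"
  shows "half_integral \<phi> (\<lambda>u. \<Sum>i\<in>I. g i u) = (\<Sum>i\<in>I. half_integral \<phi> (g i))"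
proof -
  have "half_integral \<phi> (\<lambda>u. \<Sum>i\<in>I. g i u) =
    (LINT u|lborel. (\<Sum>i\<in>I. indicat_real {0..} u *\<^sub>R (complex_of_real (\<phi> u) * g i u)))"
    unfolding half_integral_def set_lebesgue_integral_def
    by (simp add: sum_distrib_left scaleR_sum_right)
  also have "\<dots> = (\<Sum>i\<in>I. half_integral \<phi> (g i))"
    unfolding half_integral_def set_lebesgue_integral_def using assms
    by (intro Bochner_Integration.integral_sum) (auto simp: set_integrable_def[symmetric] intro!: rapid_integrable)
  finally show ?thesis .
qed

lemma half_integral_cmult: "half_integral \<phi> (\<lambda>u. c * g u) = c * half_integral \<phi> g"
proof -
  have "half_integral \<phi> (\<lambda>u. c * g u) = (LINT u:{0..}|lborel. c * (complex_of_real (\<phi> u) * g u))"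
    unfolding half_integral_def by (simp add: mult_ac)
  thus ?thesis unfolding half_integral_def by simp
qed

lemma half_integral_sums:
  fixes g :: "nat \<Rightarrow> real \<Rightarrow> complex"
  assumes \<phi>: "rapid \<phi>" and [measurable]: "\<And>n. g n \<in> borel_measurable borel" "G \<in> borel_measurable borel"
    and dom: "\<And>u n. u \<ge> 0 \<Longrightarrow> (\<Sum>k<n. norm (g k u)) \<le> B * exp (r * u\<^sup>2 + u ^ 3)"
    and lim: "\<And>u. u \<ge> 0 \<Longrightarrow> (\<lambda>n. g n u) sums G u"
  shows "(\<lambda>n. half_integral \<phi> (g n)) sums half_integral \<phi> G"
proof -
  have d1: "dominated (g n) B r" for n
    unfolding dominated_def
  proof (intro allI impI)
    fix u :: real assume u: "u \<ge> 0"
    have "norm (g n u) \<le> (\<Sum>k<Suc n. norm (g k u))" by (simp add: sum_nonneg)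
    also have "\<dots> \<le> B * exp (r * u\<^sup>2 + u ^ 3)" by (rule dom[OF u])
    finally show "norm (g n u) \<le> B * exp (r * u\<^sup>2 + u ^ 3)" .
  qed
  have "(\<lambda>n. half_integral \<phi> (\<lambda>u. \<Sum>k<n. g k u)) \<longlonglongrightarrow> half_integral \<phi> G"
  proof (rule half_integral_tendsto[OF \<phi>, where B = B and r = r])
    fix n
    show "dominated (\<lambda>u. \<Sum>k<n. g k u) B r"
      unfolding dominated_def using order_trans[OF norm_sum dom] by blast
    show "(\<lambda>u. \<Sum>k<n. g k u) \<in> borel_measurable borel" by measurable
  qed (use lim in \<open>auto simp: sums_def\<close>)
  thus ?thesis unfolding sums_def
    by (subst half_integral_sum[OF \<phi>, symmetric]) (auto intro: d1)
qed

lemma of_real_moment: "complex_of_real (moment \<phi> k) = half_integral \<phi> (\<lambda>u. of_real (u ^ (2 * k)))"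
  unfolding moment_def half_integral_def by (subst set_integral_complex_of_real[symmetric]) simp

text \<open>This is the inequality \<open>u q \<le> q\<^bsup>3/2\<^esup> + u\<^sup>3\<close>, seen by comparing \<open>q\<close> with \<open>u\<^sup>2\<close>.\<close>
lemma exp_linear_dominated:
  assumes "q \<ge> 0" "u \<ge> (0::real)" shows "exp (u * q) \<le> exp (q powr (3/2)) * exp (0 * u\<^sup>2 + u ^ 3)"
proof -
  have "u * q \<le> q powr (3/2) + u ^ 3"
  proof (cases "q \<le> u\<^sup>2")
    case True
    hence "u * q \<le> u * u\<^sup>2" using assms by (intro mult_left_mono) auto
    also have "\<dots> \<le> q powr (3/2) + u ^ 3" by (simp add: power2_eq_square power3_eq_cube)
    finally show ?thesis .
  next
    case False
    hence "u \<le> sqrt q" using assms by (intro real_le_rsqrt) auto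
    hence "u * q \<le> sqrt q * q" using assms by (intro mult_right_mono) auto
    also have "sqrt q * q = q powr (1/2) * q powr 1" using assms by (simp add: powr_half_sqrt)
    also have "\<dots> = q powr (3/2)" by (subst powr_add[symmetric]) simp
    finally show ?thesis using assms by (simp add: add_increasing2)
  qed
  thus ?thesis by (simp add: exp_add[symmetric])
qed

lemma cosh_series: "(\<lambda>n. z ^ (2 * n) / fact (2 * n)) sums cosh (z::'a::{banach,real_normed_field})"
proof -
  have "(\<lambda>n. (\<lambda>n. if even n then z ^ n /\<^sub>R fact n else 0) (2 * n)) sums cosh z"
    using cosh_converges[of z] by (subst sums_mono_reindex) (auto simp: strict_mono_def elim!: evenE)
  thus ?thesis by (simp add: scaleR_conv_of_real divide_inverse mult.commute)
qed

lemma cosh_partial_bound: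
  fixes z :: complex
  shows "(\<Sum>k<n. norm (z ^ (2 * k) / fact (2 * k))) \<le> exp (norm z)"
proof -
  have "(\<Sum>k<n. norm (z ^ (2 * k) / fact (2 * k))) = (\<Sum>k<n. norm z ^ (2 * k) / fact (2 * k))"
    by (simp add: norm_divide norm_power)
  also have "\<dots> \<le> cosh (norm z)"
    using cosh_series[of "norm z"] sum_le_suminf[of "\<lambda>k. norm z ^ (2 * k) / fact (2 * k)" "{..<n}"]
    by (simp add: sums_iff)
  also have "\<dots> \<le> exp (norm z)" by (simp add: cosh_def field_simps)
  finally show ?thesis .
qed

text \<open>The cosh series may be integrated term by term because its partial sums are dominated by
  \<open>exp (u * norm z)\<close>.\<close>
lemma cosh_transform_sums:
  assumes \<phi>: "rapid \<phi>"
  shows "(\<lambda>k. of_real (moment \<phi> k / fact (2 * k)) * (z\<^sup>2) ^ k) sums half_integral \<phi> (\<lambda>u. cosh (of_real u * z))"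
proof -
  have "(\<lambda>k. half_integral \<phi> (\<lambda>u. (of_real u * z) ^ (2 * k) / fact (2 * k)))
      sums half_integral \<phi> (\<lambda>u. cosh (of_real u * z))"
  proof (rule half_integral_sums[OF \<phi>, where B = "exp (norm z powr (3/2))" and r = 0])
    fix u :: real and n :: nat assume u: "u \<ge> 0"
    have "(\<Sum>k<n. norm ((of_real u * z) ^ (2 * k) / fact (2 * k))) \<le> exp (u * norm z)"
      using cosh_partial_bound[of "of_real u * z" n] u by (simp add: norm_mult)
    also have "\<dots> \<le> exp (norm z powr (3/2)) * exp (0 * u\<^sup>2 + u ^ 3)"
      by (rule exp_linear_dominated) (use u in auto)
    finally show "(\<Sum>k<n. norm ((of_real u * z) ^ (2 * k) / fact (2 * k))) \<le>
      exp (norm z powr (3/2)) * exp (0 * u\<^sup>2 + u ^ 3)" .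
    show "(\<lambda>k. (of_real u * z) ^ (2 * k) / fact (2 * k)) sums cosh (of_real u * z)" by (rule cosh_series)
  qed (auto simp: cosh_def scaleR_conv_of_real)
  moreover have "half_integral \<phi> (\<lambda>u. (of_real u * z) ^ (2 * k) / fact (2 * k)) =
      of_real (moment \<phi> k / fact (2 * k)) * (z\<^sup>2) ^ k" for k
  proof -
    have "(\<lambda>u. (of_real u * z) ^ (2 * k) / fact (2 * k)) = (\<lambda>u. (z\<^sup>2) ^ k / fact (2 * k) * complex_of_real (u ^ (2 * k)))"
      by (auto simp: power_mult_distrib power_mult)
    thus ?thesis by (simp only: half_integral_cmult of_real_moment[symmetric]) simp
  qed
  ultimately show ?thesis by simp
qed

lemma moment_series_square:
  assumes \<phi>: "rapid \<phi>"
  shows "moment_series \<phi> (z\<^sup>2) = half_integral \<phi> (\<lambda>u. cosh (of_real u * z))"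
  using cosh_transform_sums[OF \<phi>, of z] unfolding moment_series_def by (simp add: sums_iff)

lemma cos_transform_eq: "rapid \<phi> \<Longrightarrow> cos_transform \<phi> x = moment_series \<phi> (- x\<^sup>2)"
proof -
  assume \<phi>: "rapid \<phi>"
  have "(\<lambda>u. cosh (of_real u * (\<i> * x))) = (\<lambda>u. cos (of_real u * x))"
    by (auto simp: cosh_conv_cos algebra_simps)
  thus ?thesis using moment_series_square[OF \<phi>, of "\<i> * x"] by (simp add: cos_transform_def power_mult_distrib)
qed

lemma moment_series_sums:
  assumes "rapid \<phi>" shows "(\<lambda>k. of_real (moment \<phi> k / fact (2 * k)) * w ^ k) sums moment_series \<phi> w"
  using cosh_transform_sums[OF assms, of "csqrt w"] moment_series_square[OF assms, of "csqrt w"] by simp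

lemma moment_series_expansion:
  assumes "rapid \<phi>"
  shows "moment_series \<phi> has_fps_expansion Abs_fps (\<lambda>k. of_real (moment \<phi> k / fact (2 * k)))"
  by (intro has_fps_expansionI always_eventually allI) (use moment_series_sums[OF assms] in simp)

lemma higher_deriv_moment_series:
  assumes "rapid \<phi>"
  shows "(deriv ^^ k) (moment_series \<phi>) 0 = of_real (fact k * moment \<phi> k / fact (2 * k))"
  using fps_nth_fps_expansion[OF moment_series_expansion[OF assms], of k] by (simp add: field_simps)

lemma moment_series_holomorphic: assumes "rapid \<phi>" shows "moment_series \<phi> holomorphic_on UNIV"
  unfolding holomorphic_on_def
proof
  fix w :: complex
  have "((\<lambda>w. \<Sum>k. of_real (moment \<phi> k / fact (2 * k)) * w ^ k) has_field_derivative
     (\<Sum>k. diffs (\<lambda>k. of_real (moment \<phi> k / fact (2 * k))) k * w ^ k)) (at w)"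
    by (rule termdiffs_strong_converges_everywhere) (use moment_series_sums[OF assms] in \<open>auto simp: sums_iff\<close>)
  thus "moment_series \<phi> field_differentiable at w within UNIV"
    unfolding moment_series_def[abs_def] field_differentiable_def by auto
qed

lemma cosh_dominated:
  "dominated (\<lambda>u. cosh (of_real u * z :: complex)) (exp (norm z powr (3/2))) 0"
  unfolding dominated_def
proof (intro allI impI)
  fix u :: real assume u: "u \<ge> 0"
  have "norm (cosh (of_real u * z)) \<le> exp (u * norm z)"
  proof (rule tendsto_upperbound)
    show "(\<lambda>n. norm (\<Sum>k<n. (of_real u * z) ^ (2 * k) / fact (2 * k))) \<longlonglongrightarrow> norm (cosh (of_real u * z))"
      using cosh_series[of "of_real u * z"] unfolding sums_def by (rule tendsto_norm)
    show "\<forall>\<^sub>F n in sequentially. norm (\<Sum>k<n. (of_real u * z) ^ (2 * k) / fact (2 * k)) \<le> exp (u * norm z)"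
    proof (intro always_eventually allI)
      fix n
      show "norm (\<Sum>k<n. (of_real u * z) ^ (2 * k) / fact (2 * k)) \<le> exp (u * norm z)"
        using order_trans[OF norm_sum cosh_partial_bound[of "of_real u * z" n]] u by (simp add: norm_mult)
    qed
  qed auto
  also have "\<dots> \<le> exp (norm z powr (3/2)) * exp (0 * u\<^sup>2 + u ^ 3)"
    by (rule exp_linear_dominated) (use u in auto)
  finally show "norm (cosh (of_real u * z)) \<le> exp (norm z powr (3/2)) * exp (0 * u\<^sup>2 + u ^ 3)" .
qed

lemma half_integral_norm_bound:
  assumes \<phi>: "rapid \<phi>" and [measurable]: "g \<in> borel_measurable borel" and g: "dominated g B r"
  shows "norm (half_integral \<phi> g) \<le> B * (LINT u:{0..}|lborel. \<bar>\<phi> u\<bar> * exp (r * u\<^sup>2 + u ^ 3))"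
proof -
  note [measurable] = rapid_measurable[OF \<phi>]
  have i1: "set_integrable lborel {0..} (\<lambda>u. \<bar>\<phi> u\<bar> * exp (r * u\<^sup>2 + u ^ 3))"
  proof -
    have "set_integrable lborel {0..} (\<lambda>u. \<bar>exp (r * u\<^sup>2 + u ^ 3) * \<phi> u\<bar>)"
      using \<phi> by (intro set_integrable_abs) (auto simp: rapid_def)
    thus ?thesis by (simp add: abs_mult mult.commute)
  qed
  have "norm (half_integral \<phi> g) \<le> (LINT u:{0..}|lborel. norm (complex_of_real (\<phi> u) * g u))"
    unfolding half_integral_def by (rule set_integral_norm_bound[OF rapid_integrable[OF \<phi> _ g]]) measurable
  also have "\<dots> \<le> (LINT u:{0..}|lborel. B * (\<bar>\<phi> u\<bar> * exp (r * u\<^sup>2 + u ^ 3)))"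
  proof (rule set_integral_mono)
    show "set_integrable lborel {0..} (\<lambda>u. norm (complex_of_real (\<phi> u) * g u))"
      by (rule set_integrable_norm[OF rapid_integrable[OF \<phi> _ g]]) measurable
    show "norm (complex_of_real (\<phi> u) * g u) \<le> B * (\<bar>\<phi> u\<bar> * exp (r * u\<^sup>2 + u ^ 3))" if "u \<in> {0..}" for u
    proof -
      have "norm (g u) \<le> B * exp (r * u\<^sup>2 + u ^ 3)" using g that by (auto simp: dominated_def)
      hence "\<bar>\<phi> u\<bar> * norm (g u) \<le> \<bar>\<phi> u\<bar> * (B * exp (r * u\<^sup>2 + u ^ 3))" by (intro mult_left_mono) auto
      thus ?thesis by (simp add: norm_mult mult_ac)
    qed
  qed (use i1 in auto)
  also have "\<dots> = B * (LINT u:{0..}|lborel. \<bar>\<phi> u\<bar> * exp (r * u\<^sup>2 + u ^ 3))" by simp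
  finally show ?thesis .
qed

text \<open>For \<open>w = z\<^sup>2\<close> the integrand is at most \<open>exp (norm z powr (3/2))\<close> times a fixed integrable function,
  and \<open>norm z powr (3/2) = norm w powr (3/4)\<close>.\<close>
lemma moment_series_growth:
  assumes \<phi>: "rapid \<phi>"
  shows "\<exists>C. \<forall>w. norm (moment_series \<phi> w) \<le> C * exp (norm w powr (3/4))"
proof (intro exI allI)
  fix w :: complex
  define z where "z = csqrt w"
  have w: "w = z\<^sup>2" by (simp add: z_def)
  have "norm w powr (3/4) = norm z powr (3/2)"
    unfolding w norm_power using powr_powr[of "norm z" 2 "3/4"] by (simp add: powr_realpow')
  moreover have "norm (half_integral \<phi> (\<lambda>u. cosh (of_real u * z))) \<le>
      exp (norm z powr (3/2)) * (LINT u:{0..}|lborel. \<bar>\<phi> u\<bar> * exp (0 * u\<^sup>2 + u ^ 3))"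
    by (rule half_integral_norm_bound[OF \<phi> _ cosh_dominated]) (simp add: cosh_def)
  ultimately show "norm (moment_series \<phi> w) \<le>
      (LINT u:{0..}|lborel. \<bar>\<phi> u\<bar> * exp (0 * u\<^sup>2 + u ^ 3)) * exp (norm w powr (3/4))"
    unfolding w moment_series_square[OF \<phi>] by (simp add: mult.commute w)
qed

definition real_zeros :: "(real \<Rightarrow> real) \<Rightarrow> bool" where
  "real_zeros \<phi> \<longleftrightarrow> (\<forall>x. cos_transform \<phi> x = 0 \<longrightarrow> x \<in> \<real>)"

lemma real_zeros_imp_LP_class:
  assumes \<phi>: "rapid \<phi>" and rz: "real_zeros \<phi>"
  shows "LP_class (moment_series \<phi>)"
  unfolding LP_class_def
proof (intro conjI moment_series_holomorphic moment_series_growth \<phi> allI impI)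
  have "cos_transform \<phi> \<i> \<noteq> 0" using rz by (auto simp: real_zeros_def complex_is_Real_iff)
  thus "\<exists>w. moment_series \<phi> w \<noteq> 0" using cos_transform_eq[OF \<phi>] by metis
  fix w assume "moment_series \<phi> w = 0"
  hence "cos_transform \<phi> (csqrt (- w)) = 0" by (simp add: cos_transform_eq[OF \<phi>])
  hence "csqrt (- w) \<in> \<real>" using rz by (auto simp: real_zeros_def)
  then obtain x where x: "csqrt (- w) = of_real x" by (auto elim: Reals_cases)
  have "- w = (of_real x)\<^sup>2" using x by (metis power2_csqrt)
  hence "w = of_real (- x\<^sup>2)" by (metis minus_minus of_real_minus of_real_power)
  thus "w \<in> \<real>\<^sub>\<le>\<^sub>0" by (simp only: nonpos_Reals_of_real_iff) simp
qed

section \<open>Gaussian deformation of the kernel\<close>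

lemma rapid_mult:
  assumes \<phi>: "rapid \<phi>" and [measurable]: "h \<in> borel_measurable borel"
    and h: "\<And>u. u \<ge> 0 \<Longrightarrow> \<bar>h u\<bar> \<le> exp (c * u\<^sup>2)"
  shows "rapid (\<lambda>u. h u * \<phi> u)"
  unfolding rapid_def
proof (intro conjI allI)
  note [measurable] = rapid_measurable[OF \<phi>]
  show "(\<lambda>u. h u * \<phi> u) \<in> borel_measurable borel" by measurable
  fix r :: real
  show "set_integrable lborel {0..} (\<lambda>u. exp (r * u\<^sup>2 + u ^ 3) * (h u * \<phi> u))"
  proof (rule set_integrable_bound)
    show "set_integrable lborel {0..} (\<lambda>u. exp ((r + c) * u\<^sup>2 + u ^ 3) * \<phi> u)"
      using \<phi> by (auto simp: rapid_def)
    show "set_borel_measurable lborel {0..} (\<lambda>u. exp (r * u\<^sup>2 + u ^ 3) * (h u * \<phi> u))"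
      unfolding set_borel_measurable_def by measurable
    have "exp (r * u\<^sup>2 + u ^ 3) * (\<bar>h u\<bar> * \<bar>\<phi> u\<bar>) \<le> exp ((r + c) * u\<^sup>2 + u ^ 3) * \<bar>\<phi> u\<bar>" if "u \<ge> 0" for u
    proof -
      have "exp (r * u\<^sup>2 + u ^ 3) * (\<bar>h u\<bar> * \<bar>\<phi> u\<bar>) \<le> exp (r * u\<^sup>2 + u ^ 3) * (exp (c * u\<^sup>2) * \<bar>\<phi> u\<bar>)"
        using h[OF that] by (intro mult_left_mono mult_right_mono) auto
      also have "\<dots> = exp ((r + c) * u\<^sup>2 + u ^ 3) * \<bar>\<phi> u\<bar>"
        unfolding mult.assoc[symmetric] exp_add[symmetric] by (simp add: distrib_right)
      finally show ?thesis .
    qed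
    thus "AE u in lborel. u \<in> {0..} \<longrightarrow> norm (exp (r * u\<^sup>2 + u ^ 3) * (h u * \<phi> u)) \<le> norm (exp ((r + c) * u\<^sup>2 + u ^ 3) * \<phi> u)"
      by (intro AE_I2) (auto simp: abs_mult)
  qed
qed

abbreviation gauss_weight :: "real \<Rightarrow> (real \<Rightarrow> real) \<Rightarrow> real \<Rightarrow> real" where
  "gauss_weight t \<phi> \<equiv> (\<lambda>u. exp (t * u\<^sup>2) * \<phi> u)"

lemma rapid_gauss_weight: "rapid \<phi> \<Longrightarrow> rapid (gauss_weight t \<phi>)"
  by (rule rapid_mult[where c = t]) auto

text \<open>The comparison holds term by term, because \<open>2\<^sup>n n! \<le> (2n)!\<close>.\<close>
lemma cosh_le_exp_square: "cosh x \<le> exp (x\<^sup>2 / 2)" for x :: real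
proof (rule sums_le[OF _ cosh_series])
  have "(\<lambda>n. (x\<^sup>2 / 2) ^ n / fact n) = (\<lambda>n. (x\<^sup>2 / 2) ^ n /\<^sub>R fact n)"
    by (rule ext) (simp add: field_simps)
  thus "(\<lambda>n. (x\<^sup>2 / 2) ^ n / fact n) sums exp (x\<^sup>2 / 2)"
    using exp_converges[of "x\<^sup>2 / 2"] by metis
  fix n
  have "2 ^ n * fact n \<le> (fact (2 * n) :: real)"
  proof (induction n)
    case (Suc n)
    have "2 ^ Suc n * fact (Suc n) = (2 * real (Suc n)) * (2 ^ n * fact n)" by (simp add: algebra_simps)
    also have "\<dots> \<le> (2 * real (Suc n)) * fact (2 * n)" using Suc by (intro mult_left_mono) auto
    also have "\<dots> \<le> (real (2 * n + 2) * real (2 * n + 1)) * fact (2 * n)"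
      by (intro mult_right_mono) (auto simp: algebra_simps)
    also have "\<dots> = fact (2 * Suc n)" by (simp add: algebra_simps)
    finally show ?case .
  qed auto
  hence "(x\<^sup>2) ^ n / fact (2 * n) \<le> (x\<^sup>2) ^ n / (2 ^ n * fact n)"
    by (intro divide_left_mono) auto
  thus "x ^ (2 * n) / fact (2 * n) \<le> (x\<^sup>2 / 2) ^ n / fact n"
    by (simp add: power_mult power_divide)
qed

lemma cosh_measurable [measurable]: "(\<lambda>u. cosh (c * u)) \<in> borel_measurable borel" for c :: real
  unfolding cosh_def by measurable

lemma rapid_cosh: assumes "rapid \<phi>" shows "rapid (\<lambda>u. cosh (l * u) * \<phi> u)"
proof (rule rapid_mult[OF assms, where c = "l\<^sup>2 / 2"])
  fix u :: real
  show "\<bar>cosh (l * u)\<bar> \<le> exp (l\<^sup>2 / 2 * u\<^sup>2)"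
    using cosh_le_exp_square[of "l * u"] by (simp add: power_mult_distrib)
qed measurable

lemma cos_dominated:
  "dominated (\<lambda>u. cos (of_real u * z :: complex)) (exp (norm z powr (3/2))) 0"
  using cosh_dominated[of "\<i> * z"] by (simp add: cosh_conv_cos norm_mult dominated_def mult_ac)

text \<open>Multiplying the kernel by \<open>cosh (l u)\<close> averages the transform over the shifts by \<open>\<plusminus> \<i> l\<close>.\<close>
lemma cos_transform_cosh:
  assumes \<phi>: "rapid \<phi>"
  shows "2 * cos_transform (\<lambda>u. cosh (l * u) * \<phi> u) x = cos_transform \<phi> (x + \<i> * of_real l) + cos_transform \<phi> (x - \<i> * of_real l)"
proof -
  let ?a = "x + \<i> * of_real l" and ?b = "x - \<i> * of_real l"
  have pt: "cos (of_real u * ?a) + cos (of_real u * ?b) = 2 * of_real (cosh (l * u)) * cos (of_real u * x)" for u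
  proof -
    have "of_real (cosh (l * u)) = cos (\<i> * (of_real u * of_real l))"
    proof -
      have "of_real (cosh (l * u)) = cosh (complex_of_real (l * u))"
        by (simp add: cosh_def scaleR_conv_of_real exp_of_real[symmetric])
      thus ?thesis by (simp add: cosh_conv_cos mult_ac)
    qed
    thus ?thesis by (simp add: distrib_left right_diff_distrib cos_add cos_diff mult_ac)
  qed
  have "cos_transform \<phi> ?a + cos_transform \<phi> ?b = half_integral \<phi> (\<lambda>u. cos (of_real u * ?a) + cos (of_real u * ?b))"
  proof -
    have i: "set_integrable lborel {0..} (\<lambda>u. complex_of_real (\<phi> u) * cos (of_real u * z))" for z
      by (rule rapid_integrable[OF \<phi> _ cos_dominated]) measurable
    show ?thesis unfolding cos_transform_def half_integral_def distrib_left[of "complex_of_real (\<phi> _)"]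
      by (rule set_integral_add(2)[OF i i, symmetric])
  qed
  also have "\<dots> = 2 * cos_transform (\<lambda>u. cosh (l * u) * \<phi> u) x"
    unfolding pt cos_transform_def half_integral_cmult[symmetric] half_integral_def by (simp add: mult_ac)
  finally show ?thesis by simp
qed

lemma real_zeros_cosh:
  assumes \<phi>: "rapid \<phi>" and rz: "real_zeros \<phi>" and l: "l > 0"
  shows "real_zeros (\<lambda>u. cosh (l * u) * \<phi> u)"
  unfolding real_zeros_def
proof (intro allI impI)
  fix x assume "cos_transform (\<lambda>u. cosh (l * u) * \<phi> u) x = 0"
  hence "cos_transform \<phi> (x + \<i> * of_real l) + cos_transform \<phi> (x - \<i> * of_real l) = 0"
    using cos_transform_cosh[OF \<phi>, of l x] by simp
  thus "x \<in> \<real>"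
    using LP_class_shift_sum_nonzero[OF real_zeros_imp_LP_class[OF \<phi> rz] _ l, of x]
    unfolding cos_transform_eq[OF \<phi>] by blast
qed

lemma real_zeros_cosh_power:
  assumes \<phi>: "rapid \<phi>" and rz: "real_zeros \<phi>" and l: "l > 0"
  shows "rapid (\<lambda>u. cosh (l * u) ^ n * \<phi> u) \<and> real_zeros (\<lambda>u. cosh (l * u) ^ n * \<phi> u)"
proof (induction n)
  case (Suc n)
  have "(\<lambda>u. cosh (l * u) ^ Suc n * \<phi> u) = (\<lambda>u. cosh (l * u) * (cosh (l * u) ^ n * \<phi> u))" by (simp add: mult_ac)
  thus ?case using Suc rapid_cosh[of "\<lambda>u. cosh (l * u) ^ n * \<phi> u"]
      real_zeros_cosh[OF _ _ l, of "\<lambda>u. cosh (l * u) ^ n * \<phi> u"] by simp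
qed (use assms in auto)

lemma cos_transform_holomorphic: assumes "rapid \<phi>" shows "cos_transform \<phi> holomorphic_on A"
proof -
  have "(moment_series \<phi> \<circ> (\<lambda>x. - x\<^sup>2)) holomorphic_on A"
    by (rule holomorphic_on_compose_gen[where t = UNIV])
       (auto intro!: holomorphic_intros moment_series_holomorphic assms)
  thus ?thesis by (simp add: o_def cos_transform_eq[OF assms, abs_def, symmetric])
qed

text \<open>By Hurwitz's theorem a limit of functions without zeros in the upper or lower half plane has none
  there either, unless it vanishes identically, which the last hypothesis excludes. The locally uniform
  convergence comes from dominated convergence applied to the majorant \<open>k n\<close> of the difference of
  the integrands, which is independent of the point.\<close>
lemma real_zeros_limit:
  assumes \<phi>: "rapid \<phi>" and meas [measurable]: "\<And>n. h n \<in> borel_measurable borel" "H \<in> borel_measurable borel"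
    and bd: "\<And>n u. u \<ge> 0 \<Longrightarrow> \<bar>h n u\<bar> \<le> exp (c * u\<^sup>2)"
    and lim: "\<And>u. u \<ge> 0 \<Longrightarrow> (\<lambda>n. h n u) \<longlonglongrightarrow> H u"
    and rz: "\<And>n. real_zeros (\<lambda>u. h n u * \<phi> u)"
    and nz: "cos_transform (\<lambda>u. H u * \<phi> u) x0 \<noteq> 0"
  shows "real_zeros (\<lambda>u. H u * \<phi> u)"
proof -
  have bdH: "\<bar>H u\<bar> \<le> exp (c * u\<^sup>2)" if "u \<ge> 0" for u
    by (rule LIMSEQ_le_const2[OF tendsto_rabs[OF lim[OF that]]]) (use bd[OF that] in blast)
  have rh: "rapid (\<lambda>u. h n u * \<phi> u)" for n by (rule rapid_mult[OF \<phi> _ bd]) auto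
  have rH: "rapid (\<lambda>u. H u * \<phi> u)" by (rule rapid_mult[OF \<phi> _ bdH]) auto
  let ?f = "\<lambda>n. cos_transform (\<lambda>u. h n u * \<phi> u)" and ?g = "cos_transform (\<lambda>u. H u * \<phi> u)"
  have ul: "uniform_limit K ?f ?g sequentially" if K: "compact K" for K
  proof (rule uniform_limitI)
    fix e :: real assume e: "e > 0"
    obtain q where q: "q > 0" "\<And>x. x \<in> K \<Longrightarrow> norm x \<le> q"
      using compact_imp_bounded[OF K] unfolding bounded_pos by auto
    define \<psi> where "\<psi> u = \<bar>\<phi> u\<bar>" for u
    have r\<psi>: "rapid \<psi>" unfolding \<psi>_def rapid_def
    proof (intro conjI allI)
      show "(\<lambda>u. \<bar>\<phi> u\<bar>) \<in> borel_measurable borel" using rapid_measurable[OF \<phi>] by measurable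
      fix r
      have "set_integrable lborel {0..} (\<lambda>u. \<bar>exp (r * u\<^sup>2 + u ^ 3) * \<phi> u\<bar>)"
        using \<phi> by (intro set_integrable_abs) (auto simp: rapid_def)
      thus "set_integrable lborel {0..} (\<lambda>u. exp (r * u\<^sup>2 + u ^ 3) * \<bar>\<phi> u\<bar>)" by (simp add: abs_mult)
    qed
    define k where "k n u = \<bar>h n u - H u\<bar> * exp (u * q)" for n u
    have kdom: "dominated (k n) (2 * exp (q powr (3/2))) c" for n
      unfolding dominated_def
    proof (intro allI impI)
      fix u :: real assume u: "u \<ge> 0"
      have "norm (k n u) \<le> (2 * exp (c * u\<^sup>2)) * (exp (q powr (3/2)) * exp (0 * u\<^sup>2 + u ^ 3))"
        unfolding k_def real_norm_def abs_mult
        using bd[OF u, of n] bdH[OF u] exp_linear_dominated[of q u] q u by (intro mult_mono) auto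
      thus "norm (k n u) \<le> 2 * exp (q powr (3/2)) * exp (c * u\<^sup>2 + u ^ 3)"
        by (simp add: exp_add mult_ac)
    qed
    have kdom': "dominated (\<lambda>u. complex_of_real (k n u)) (2 * exp (q powr (3/2))) c" for n
      using kdom[of n] by (simp add: dominated_def)
    have km [measurable]: "k n \<in> borel_measurable borel" for n unfolding k_def[abs_def] by measurable
    have "(\<lambda>n. half_integral \<psi> (\<lambda>u. of_real (k n u))) \<longlonglongrightarrow> half_integral \<psi> (\<lambda>u. 0)"
    proof (rule half_integral_tendsto[OF r\<psi> _ _ kdom'])
      fix u :: real assume "u \<ge> 0"
      hence "(\<lambda>n. complex_of_real (\<bar>h n u - H u\<bar> * exp (u * q))) \<longlonglongrightarrow> of_real (\<bar>H u - H u\<bar> * exp (u * q))"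
        by (intro tendsto_intros lim)
      thus "(\<lambda>n. complex_of_real (k n u)) \<longlonglongrightarrow> 0" by (simp add: k_def)
    qed measurable
    hence "(\<lambda>n. half_integral \<psi> (\<lambda>u. of_real (k n u))) \<longlonglongrightarrow> 0" by (simp add: half_integral_def)
    hence "\<forall>\<^sub>F n in sequentially. norm (half_integral \<psi> (\<lambda>u. of_real (k n u))) < e"
      using order_tendstoD(2)[OF tendsto_norm_zero e] by blast
    thus "\<forall>\<^sub>F n in sequentially. \<forall>x\<in>K. dist (?f n x) (?g x) < e"
    proof eventually_elim
      case (elim n)
      show ?case
      proof
        fix x assume x: "x \<in> K"
        have i1: "set_integrable lborel {0..} (\<lambda>u. complex_of_real (h n u * \<phi> u) * cos (of_real u * x))"
          by (rule rapid_integrable[OF rh _ cos_dominated]) measurable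
        have i2: "set_integrable lborel {0..} (\<lambda>u. complex_of_real (H u * \<phi> u) * cos (of_real u * x))"
          by (rule rapid_integrable[OF rH _ cos_dominated]) measurable
        have ik: "set_integrable lborel {0..} (\<lambda>u. \<psi> u * k n u)"
          using rapid_integrable[OF r\<psi> _ kdom'[of n]] 
          by (simp add: set_integrable_def complex_of_real_integrable_eq scaleR_conv_of_real flip: of_real_mult)
        have "?f n x - ?g x = (LINT u:{0..}|lborel. complex_of_real (h n u * \<phi> u) * cos (of_real u * x)
             - complex_of_real (H u * \<phi> u) * cos (of_real u * x))"
          unfolding cos_transform_def half_integral_def by (rule set_integral_diff(2)[OF i1 i2, symmetric])
        also have "norm \<dots> \<le> (LINT u:{0..}|lborel. norm (complex_of_real (h n u * \<phi> u) * cos (of_real u * x)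
             - complex_of_real (H u * \<phi> u) * cos (of_real u * x)))"
          by (rule set_integral_norm_bound[OF set_integral_diff(1)[OF i1 i2]])
        also have "\<dots> \<le> (LINT u:{0..}|lborel. \<psi> u * k n u)"
        proof (rule set_integral_mono[OF set_integrable_norm[OF set_integral_diff(1)[OF i1 i2]] ik])
          fix u :: real assume "u \<in> {0..}"
          hence u: "u \<ge> 0" by simp
          have "norm (cos (of_real u * x)) \<le> exp (u * norm x)"
            using norm_cos_le[of "of_real u * x"] u by (simp add: norm_mult cosh_def field_simps)
          also have "\<dots> \<le> exp (u * q)" using q(2)[OF x] u by (simp add: mult_left_mono)
          finally have "norm (cos (of_real u * x)) \<le> exp (u * q)" .
          hence "\<bar>\<phi> u\<bar> * \<bar>h n u - H u\<bar> * norm (cos (of_real u * x)) \<le> \<bar>\<phi> u\<bar> * \<bar>h n u - H u\<bar> * exp (u * q)"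
            by (intro mult_left_mono) auto
          moreover have "complex_of_real (h n u * \<phi> u) * cos (of_real u * x) - complex_of_real (H u * \<phi> u) * cos (of_real u * x)
            = of_real (\<phi> u * (h n u - H u)) * cos (of_real u * x)" by (simp add: algebra_simps)
          ultimately show "norm (complex_of_real (h n u * \<phi> u) * cos (of_real u * x) - complex_of_real (H u * \<phi> u) * cos (of_real u * x))
             \<le> \<psi> u * k n u"
            by (simp add: norm_mult abs_mult \<psi>_def k_def mult_ac del: of_real_mult of_real_diff)
        qed
        also have "\<dots> \<le> norm (half_integral \<psi> (\<lambda>u. of_real (k n u)))"
          unfolding half_integral_def of_real_mult[symmetric] set_integral_complex_of_real by simp
        also have "\<dots> < e" by (rule elim)
        finally show "dist (?f n x) (?g x) < e" by (simp add: dist_norm)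
      qed
    qed
  qed
  have main: "?g x \<noteq> 0" if S: "open S" "connected S" "S \<inter> \<real> = {}" and x: "x \<in> S" for S x
  proof (cases "?g constant_on S")
    case False
    show ?thesis
    proof (rule Hurwitz_no_zeros[OF S(1,2) _ _ _ False _ x])
      show "?f n holomorphic_on S" for n by (rule cos_transform_holomorphic[OF rh])
      show "?g holomorphic_on S" by (rule cos_transform_holomorphic[OF rH])
      show "uniform_limit K ?f ?g sequentially" if "compact K" for K by (rule ul[OF that])
      show "?f n z \<noteq> 0" if "z \<in> S" for n z using rz[of n] that S(3) by (auto simp: real_zeros_def)
    qed
  next
    case True
    then obtain d where d: "\<And>z. z \<in> S \<Longrightarrow> ?g z = d" by (auto simp: constant_on_def)
    have "?g x0 = d"
    proof (rule analytic_continuation[of "\<lambda>z. ?g z - d" UNIV S x x0, simplified])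
      show "(\<lambda>z. ?g z - d) holomorphic_on UNIV"
        by (intro holomorphic_intros cos_transform_holomorphic[OF rH])
      show "x islimpt S" using S(1) x by (simp add: interior_limit_point interior_open)
    qed (use d x in auto)
    thus ?thesis using nz d[OF x] by simp
  qed
  show ?thesis unfolding real_zeros_def
  proof (intro allI impI, rule ccontr)
    fix x assume x: "?g x = 0" "x \<notin> \<real>"
    have "Im x > 0 \<or> Im x < 0" using x(2) by (auto simp: complex_is_Real_iff)
    thus False
    proof
      assume "Im x > 0"
      moreover have "{z. Im z > 0} \<inter> \<real> = {}" by (auto simp: complex_is_Real_iff)
      ultimately show False using main[of "{z. Im z > 0}" x] x(1)
        by (auto simp: open_halfspace_Im_gt convex_halfspace_Im_gt convex_connected)
    next
      assume "Im x < 0"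
      moreover have "{z. Im z < 0} \<inter> \<real> = {}" by (auto simp: complex_is_Real_iff)
      ultimately show False using main[of "{z. Im z < 0}" x] x(1)
        by (auto simp: open_halfspace_Im_lt convex_halfspace_Im_lt convex_connected)
    qed
  qed
qed

lemma gauss_weight_add: "gauss_weight s (gauss_weight t \<phi>) = gauss_weight (s + t) \<phi>"
  by (auto simp: exp_add[symmetric] distrib_right mult.assoc[symmetric])

lemma power_le_fact_exp: "0 \<le> x \<Longrightarrow> x ^ k \<le> fact k * exp (x::real)"
proof -
  assume x: "0 \<le> x"
  have "x ^ k /\<^sub>R fact k \<le> (\<Sum>n. x ^ n /\<^sub>R fact n)"
    using x by (intro sum_le_suminf[of _ "{k}", simplified] summable_exp_generic) auto
  thus ?thesis by (simp add: exp_def field_simps)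
qed

text \<open>Expanding \<open>exp (s u\<^sup>2)\<close> shows that the moments are entire functions of the deformation parameter.\<close>
lemma moment_gauss_sums:
  assumes \<phi>: "rapid \<phi>"
  shows "(\<lambda>n. s ^ n / fact n * moment \<phi> (k + n)) sums moment (gauss_weight s \<phi>) k"
proof -
  have "(\<lambda>n. half_integral \<phi> (\<lambda>u. of_real (u ^ (2 * k) * ((s * u\<^sup>2) ^ n / fact n))))
      sums half_integral \<phi> (\<lambda>u. of_real (u ^ (2 * k) * exp (s * u\<^sup>2)))"
  proof (rule half_integral_sums[OF \<phi>, where B = "fact k" and r = "\<bar>s\<bar> + 1"])
    fix u :: real and n :: nat assume u: "u \<ge> 0"
    have e: "(\<lambda>n. x ^ n / fact n) sums exp x" for x :: real
      using exp_converges[of x] by (simp add: field_simps)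
    have "(\<Sum>j<n. norm (complex_of_real (u ^ (2 * k) * ((s * u\<^sup>2) ^ j / fact j))))
        = u ^ (2 * k) * (\<Sum>j<n. (\<bar>s\<bar> * u\<^sup>2) ^ j / fact j)"
      unfolding norm_of_real sum_distrib_left using u by (simp add: abs_mult power_abs)
    also have "\<dots> \<le> u ^ (2 * k) * exp (\<bar>s\<bar> * u\<^sup>2)"
      using e[of "\<bar>s\<bar> * u\<^sup>2"] sum_le_suminf[of "\<lambda>j. (\<bar>s\<bar> * u\<^sup>2) ^ j / fact j" "{..<n}"] u
      by (intro mult_left_mono) (auto simp: sums_iff)
    also have "\<dots> \<le> (fact k * exp (u\<^sup>2)) * exp (\<bar>s\<bar> * u\<^sup>2)"
      unfolding power_mult by (intro mult_right_mono power_le_fact_exp) auto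
    also have "\<dots> = fact k * exp ((\<bar>s\<bar> + 1) * u\<^sup>2)" by (simp add: exp_add distrib_right mult_ac)
    also have "\<dots> \<le> fact k * exp ((\<bar>s\<bar> + 1) * u\<^sup>2 + u ^ 3)" using u by simp
    finally show "(\<Sum>j<n. norm (complex_of_real (u ^ (2 * k) * ((s * u\<^sup>2) ^ j / fact j))))
        \<le> fact k * exp ((\<bar>s\<bar> + 1) * u\<^sup>2 + u ^ 3)" .
    show "(\<lambda>j. complex_of_real (u ^ (2 * k) * ((s * u\<^sup>2) ^ j / fact j))) sums of_real (u ^ (2 * k) * exp (s * u\<^sup>2))"
      by (intro sums_of_real sums_mult e)
  qed auto
  moreover have "half_integral \<phi> (\<lambda>u. of_real (u ^ (2 * k) * ((s * u\<^sup>2) ^ n / fact n)))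
     = of_real (s ^ n / fact n * moment \<phi> (k + n))" for n
  proof -
    have "(\<lambda>u. complex_of_real (u ^ (2 * k) * ((s * u\<^sup>2) ^ n / fact n)))
        = (\<lambda>u. of_real (s ^ n / fact n) * of_real (u ^ (2 * (k + n))))"
      by (auto simp: power_mult_distrib power_add power_mult)
    thus ?thesis by (simp only: half_integral_cmult of_real_moment[symmetric] of_real_mult)
  qed
  moreover have "half_integral \<phi> (\<lambda>u. of_real (u ^ (2 * k) * exp (s * u\<^sup>2))) = of_real (moment (gauss_weight s \<phi>) k)"
    unfolding of_real_moment half_integral_def by (simp add: mult_ac)
  ultimately show ?thesis by (simp only: sums_of_real_iff)
qed

lemma DERIV_moment:
  assumes \<phi>: "rapid \<phi>"
  shows "((\<lambda>t. moment (gauss_weight t \<phi>) k) has_real_derivative moment (gauss_weight t \<phi>) (Suc k)) (at t)"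
proof -
  define c where "c n = moment (gauss_weight t \<phi>) (k + n) / fact n" for n
  have s: "(\<lambda>n. c n * s ^ n) sums moment (gauss_weight (s + t) \<phi>) k" for s
    using moment_gauss_sums[OF rapid_gauss_weight[OF \<phi>, of t], of s k]
    unfolding gauss_weight_add c_def by (simp add: mult_ac)
  have "((\<lambda>s. \<Sum>n. c n * s ^ n) has_field_derivative (\<Sum>n. diffs c n * 0 ^ n)) (at 0)"
    by (rule termdiffs_strong_converges_everywhere) (use s in \<open>auto simp: sums_iff\<close>)
  moreover have "(\<Sum>n. diffs c n * 0 ^ n) = moment (gauss_weight t \<phi>) (Suc k)"
    using powser_zero[of "diffs c"] by (simp add: diffs_def c_def)
  moreover have "(\<lambda>s. \<Sum>n. c n * s ^ n) = (\<lambda>s. moment (gauss_weight (s + t) \<phi>) k)"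
    using s by (auto simp: sums_iff)
  ultimately show ?thesis using DERIV_shift[of "\<lambda>t. moment (gauss_weight t \<phi>) k" _ 0 t] by simp
qed

lemma moments_zero_imp_cos_transform_zero:
  assumes \<phi>: "rapid \<phi>" and z: "\<And>k. moment (gauss_weight s \<phi>) k = 0"
  shows "cos_transform \<phi> x = 0"
proof -
  have "moment \<phi> k = 0" for k
    using moment_gauss_sums[OF rapid_gauss_weight[OF \<phi>, of s], of "- s" k] z
    unfolding gauss_weight_add by (simp add: sums_iff)
  thus ?thesis by (simp add: cos_transform_eq[OF \<phi>] moment_series_def)
qed

text \<open>The deformation is invertible on moments, so it cannot annihilate a transform. This provides the
  nonvanishing hypothesis for Hurwitz's theorem.\<close>
lemma cos_transform_gauss_nontrivial:
  assumes \<phi>: "rapid \<phi>" and nz: "cos_transform \<phi> x0 \<noteq> 0"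
  shows "\<exists>x. cos_transform (gauss_weight s \<phi>) x \<noteq> 0"
proof (rule ccontr)
  assume "\<not> ?thesis"
  hence z: "cos_transform (gauss_weight s \<phi>) x = 0" for x by blast
  have r: "rapid (gauss_weight s \<phi>)" by (rule rapid_gauss_weight[OF \<phi>])
  have "moment_series (gauss_weight s \<phi>) w = 0" for w
    using z[of "csqrt (- w)"] by (simp add: cos_transform_eq[OF r])
  hence "moment_series (gauss_weight s \<phi>) = (\<lambda>w. 0)" by auto
  hence "moment (gauss_weight s \<phi>) k = 0" for k
    using higher_deriv_moment_series[OF r, of k] by simp
  from moments_zero_imp_cos_transform_zero[OF \<phi> this] nz show False by blast
qed

lemma real_zeros_nontrivial: "real_zeros \<phi> \<Longrightarrow> cos_transform \<phi> \<i> \<noteq> 0"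
  by (auto simp: real_zeros_def complex_is_Real_iff)

text \<open>De Bruijn's theorem. The factor \<open>exp (d u\<^sup>2)\<close> is the limit of \<open>cosh (u \<surd>(2d/n))\<^sup>n\<close>, and each factor
  cosh preserves real zeros. The same Gaussian bounds all members of the sequence.\<close>
lemma real_zeros_gauss_weight:
  assumes \<phi>: "rapid \<phi>" and rz: "real_zeros \<phi>" and d: "d \<ge> 0"
  shows "real_zeros (gauss_weight d \<phi>)"
proof (cases "d = 0")
  case True thus ?thesis using rz by simp
next
  case False
  hence d: "d > 0" using d by simp
  obtain x where x: "cos_transform (gauss_weight d \<phi>) x \<noteq> 0"
    using cos_transform_gauss_nontrivial[OF \<phi> real_zeros_nontrivial[OF rz]] by blast
  define l where "l n = sqrt (2 * d / real (Suc n))" for n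
  have lpos: "l n > 0" for n using d by (simp add: l_def)
  show ?thesis
  proof (rule real_zeros_limit[OF \<phi> _ _ _ _ _ x, of "\<lambda>n u. cosh (l n * u) ^ Suc n" d])
    show "real_zeros (\<lambda>u. cosh (l n * u) ^ Suc n * \<phi> u)" for n
      using real_zeros_cosh_power[OF \<phi> rz lpos] by blast
    show "\<bar>cosh (l n * u) ^ Suc n\<bar> \<le> exp (d * u\<^sup>2)" for n u
    proof -
      have "cosh (l n * u) ^ Suc n \<le> exp ((l n * u)\<^sup>2 / 2) ^ Suc n"
        by (intro power_mono cosh_le_exp_square) (simp add: less_imp_le)
      also have "\<dots> = exp (real (Suc n) * ((l n * u)\<^sup>2 / 2))" by (simp only: exp_of_nat_mult)
      also have "real (Suc n) * ((l n * u)\<^sup>2 / 2) = d * u\<^sup>2"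
        using d by (simp add: l_def power_mult_distrib field_simps)
      finally show ?thesis by simp
    qed
    show "(\<lambda>n. cosh (l n * u) ^ Suc n) \<longlonglongrightarrow> exp (d * u\<^sup>2)" if "u \<ge> 0" for u
    proof (cases "u = 0")
      case False
      define a where "a = sqrt (2 * d) * u"
      have a: "a > 0" using False that d by (simp add: a_def)
      have "((\<lambda>x. ((exp (a / sqrt x) + exp (- a / sqrt x)) / 2) powr x) \<longlongrightarrow> exp (a * a / 2)) at_top"
        using a by real_asymp
      hence "(\<lambda>n. ((exp (a / sqrt (real (Suc n))) + exp (- a / sqrt (real (Suc n)))) / 2) powr real (Suc n)) \<longlonglongrightarrow> exp (a * a / 2)"
        by (rule filterlim_compose) (intro filterlim_compose[OF filterlim_real_sequentially filterlim_Suc])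
      moreover have "((exp (a / sqrt (real (Suc n))) + exp (- a / sqrt (real (Suc n)))) / 2) powr real (Suc n) = cosh (l n * u) ^ Suc n" for n
      proof -
        have "a / sqrt (real (Suc n)) = l n * u" by (simp add: a_def l_def real_sqrt_divide)
        thus ?thesis by (subst powr_realpow) (auto simp: cosh_def add_pos_pos)
      qed
      moreover have "a * a / 2 = d * u\<^sup>2" using d by (simp add: a_def power2_eq_square)
      ultimately show ?thesis by simp
    qed auto
  qed auto
qed

lemma moment_series_pos_axis:
  assumes \<phi>: "rapid \<phi>" and x: "x \<ge> 0"
  shows "moment_series \<phi> (of_real x) = of_real (moment (\<lambda>u. cosh (sqrt x * u) * \<phi> u) 0)"
proof -
  have c: "cosh (of_real u * complex_of_real (sqrt x)) = of_real (cosh (sqrt x * u))" for u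
    by (simp add: cosh_def scaleR_conv_of_real exp_of_real[symmetric] mult.commute)
  have "moment_series \<phi> (of_real x) = moment_series \<phi> ((of_real (sqrt x))\<^sup>2)"
    using x by (metis of_real_power real_sqrt_pow2)
  also have "\<dots> = of_real (moment (\<lambda>u. cosh (sqrt x * u) * \<phi> u) 0)"
    unfolding moment_series_square[OF \<phi>] c of_real_moment half_integral_def by (simp add: mult_ac)
  finally show ?thesis .
qed

text \<open>On the interval the functions \<open>H\<^sub>s\<close> have no positive zeros, so \<open>H\<^sub>s(x)\<close> cannot change sign and stays
  positive; this sign then determines the sign of all Taylor coefficients. To see \<open>H\<^sub>s(x)\<close> as a
  continuous function of \<open>s\<close>, it is written as a moment of the kernel \<open>cosh (u \<surd>x) \<phi> u\<close>.\<close>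
lemma moments_nonneg_backward:
  assumes \<phi>: "rapid \<phi>" and rz: "real_zeros (gauss_weight (- T) \<phi>)"
    and x: "x > 0" "Re (moment_series \<phi> (of_real x)) > 0"
    and t: "- T \<le> t" "t \<le> 0"
  shows "moment (gauss_weight t \<phi>) k \<ge> 0"
proof -
  define \<psi> where "\<psi> u = cosh (sqrt x * u) * \<phi> u" for u
  have r\<psi>: "rapid \<psi>" unfolding \<psi>_def by (rule rapid_cosh[OF \<phi>])
  have f: "moment_series (gauss_weight s \<phi>) (of_real x) = of_real (moment (gauss_weight s \<psi>) 0)" for s
    using moment_series_pos_axis[OF rapid_gauss_weight[OF \<phi>], of x s] x(1) by (simp add: \<psi>_def mult_ac)
  have LP: "LP_class (moment_series (gauss_weight s \<phi>))" if "s \<ge> - T" for s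
  proof (rule real_zeros_imp_LP_class[OF rapid_gauss_weight[OF \<phi>]])
    have "real_zeros (gauss_weight (s + T) (gauss_weight (- T) \<phi>))"
      by (rule real_zeros_gauss_weight[OF rapid_gauss_weight[OF \<phi>] rz]) (use that in simp)
    thus "real_zeros (gauss_weight s \<phi>)" unfolding gauss_weight_add by simp
  qed
  have nz: "moment (gauss_weight s \<psi>) 0 \<noteq> 0" if "s \<ge> - T" for s
    using LP_class_zero[OF LP[OF that], of "of_real x"] x(1) f[of s] by auto
  have pos0: "moment (gauss_weight 0 \<psi>) 0 > 0" using f[of 0] x(2) by simp
  have "moment (gauss_weight t \<psi>) 0 > 0"
  proof (rule ccontr)
    assume "\<not> ?thesis"
    hence "\<exists>s. t \<le> s \<and> s \<le> 0 \<and> moment (gauss_weight s \<psi>) 0 = 0"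
      using pos0 t by (intro IVT') (auto intro!: DERIV_continuous_on DERIV_subset[OF DERIV_moment[OF r\<psi>]])
    thus False using nz t(1) by force
  qed
  hence "moment_series (gauss_weight t \<phi>) (of_real x) \<in> \<real>\<^sub>\<ge>\<^sub>0" unfolding f by simp
  from LP_class_derivs_nonneg[OF LP[OF t(1)] x(1) this, of k]
  have "fact k * moment (gauss_weight t \<phi>) k / fact (2 * k) \<ge> 0"
    unfolding higher_deriv_moment_series[OF rapid_gauss_weight[OF \<phi>]] by (simp only: nonneg_Reals_of_real_iff)
  hence "0 \<le> fact k * moment (gauss_weight t \<phi>) k / fact (2 * k) * (fact (2 * k) / fact k)"
    by (rule mult_nonneg_nonneg) simp
  thus ?thesis by simp
qed

text \<open>The moments \<open>a k t\<close> satisfy \<open>a k\<close>' \<open>= a (k + 1)\<close> and are nonnegative on the interval if real zeros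
  persist down to \<open>- T\<close>. The inequality \<open>2 a\<^sub>0 a\<^sub>2 \<le> a\<^sub>1\<^sup>2\<close> then propagates backwards from \<open>t = 0\<close>, makes
  \<open>\<surd>a\<^sub>0\<close> concave, and \<open>\<surd>a\<^sub>0\<close> lies below its tangent at \<open>0\<close>, which vanishes at
  \<open>- 2 a\<^sub>0(0) / a\<^sub>1(0)\<close>.\<close>
lemma no_real_zeros_far_back:
  assumes \<phi>: "rapid \<phi>" and x: "x > 0" "Re (moment_series \<phi> (of_real x)) > 0"
    and turan: "2 * moment \<phi> 0 * moment \<phi> 2 \<le> (moment \<phi> 1)\<^sup>2" and m1: "moment \<phi> 1 > 0"
    and T: "T > 2 * moment \<phi> 0 / moment \<phi> 1" and T0: "T > 0"
  shows "\<not> real_zeros (gauss_weight (- T) \<phi>)"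
proof
  assume rz: "real_zeros (gauss_weight (- T) \<phi>)"
  define a where "a k t = moment (gauss_weight t \<phi>) k" for k t
  have a0: "a k 0 = moment \<phi> k" for k by (simp add: a_def)
  have D: "(a k has_real_derivative a (Suc k) t) (at t)" for k t
    unfolding a_def by (rule DERIV_moment[OF \<phi>])
  have nn: "a k t \<ge> 0" if "- T \<le> t" "t \<le> 0" for k t
    unfolding a_def by (rule moments_nonneg_backward[OF \<phi> rz x that])
  have mono: "a k s \<le> a k t" if "- T \<le> s" "s \<le> t" "t \<le> 0" for k s t
    by (rule DERIV_nonneg_imp_nondecreasing[OF that(2)]) (use D nn that in force)
  \<comment> \<open>If \<open>a 0\<close> vanished at an interior point, it would vanish on an interval to the left, with all its derivatives, so all moments and hence the transform would be zero.\<close>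
  have pos: "a 0 t > 0" if t: "- T < t" "t \<le> 0" for t
  proof (rule ccontr)
    assume "\<not> a 0 t > 0"
    hence z: "a 0 t = 0" using nn[of t 0] t by simp
    have az: "a 0 s = 0" if "- T < s" "s < t" for s using mono[of s t 0] nn[of s 0] that t z by simp
    have all: "\<forall>s. - T < s \<and> s < t \<longrightarrow> a k s = 0" for k
    proof (induction k)
      case (Suc k)
      show ?case
      proof (intro allI impI)
        fix s assume s: "- T < s \<and> s < t"
        have "((\<lambda>_. 0) has_real_derivative a (Suc k) s) (at s)"
          using D[of k s]
        proof (rule has_field_derivative_transform_within_open[where S = "{- T<..<t}"])
          show "\<And>r. r \<in> {- T<..<t} \<Longrightarrow> a k r = 0" using Suc by auto
        qed (use s in auto)
        thus "a (Suc k) s = 0" using DERIV_const DERIV_unique by blast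
      qed
    qed (use az in auto)
    define s where "s = (t - T) / 2"
    have s: "- T < s" "s < t" using t by (auto simp: s_def field_simps)
    have "moment (gauss_weight s \<phi>) k = 0" for k using all[of k] s by (auto simp: a_def)
    hence "cos_transform \<phi> y = 0" for y by (rule moments_zero_imp_cos_transform_zero[OF \<phi>])
    hence "moment_series \<phi> w = 0" for w using cos_transform_eq[OF \<phi>, of "csqrt (- w)"] by simp
    thus False using x(2) by simp
  qed
  \<comment> \<open>In the derivative of \<open>R\<close> the terms with \<open>a 1 * a 2\<close> cancel.\<close>
  define R where "R t = 2 * a 0 t * a 2 t - (a 1 t)\<^sup>2" for t
  have DR: "(R has_real_derivative 2 * a 0 t * a 3 t) (at t)" for t
    unfolding R_def[abs_def] using D[of 0 t] D[of 1 t] D[of 2 t]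
    by (auto intro!: derivative_eq_intros simp: numeral_2_eq_2 numeral_3_eq_3 algebra_simps)
  have R: "R t \<le> 0" if t: "- T \<le> t" "t \<le> 0" for t
  proof -
    have "R t \<le> R 0"
      by (rule DERIV_nonneg_imp_nondecreasing[OF t(2)]) (use DR nn t in \<open>force intro: mult_nonneg_nonneg\<close>)
    also have "\<dots> \<le> 0" using turan by (simp add: R_def a0)
    finally show ?thesis .
  qed
  define c where "c = (a 1 0)\<^sup>2 / a 0 0"
  have a00: "a 0 0 > 0" using pos[of 0] T0 by simp
  have cpos: "c > 0" using a00 m1 by (simp add: c_def a0)
  have H: "(a 1 t)\<^sup>2 \<ge> c * a 0 t" if t: "- T < t" "t \<le> 0" for t
  proof -
    have "(a 1 0)\<^sup>2 / a 0 0 \<le> (a 1 t)\<^sup>2 / a 0 t"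
    proof (rule DERIV_nonpos_imp_nonincreasing[OF t(2), of "\<lambda>s. (a 1 s)\<^sup>2 / a 0 s"])
      fix s assume s: "t \<le> s" "s \<le> 0"
      have p: "a 0 s > 0" using pos s t by simp
      have "((\<lambda>s. (a 1 s)\<^sup>2 / a 0 s) has_real_derivative a 1 s * R s / (a 0 s)\<^sup>2) (at s)"
        using D[of 0 s] D[of 1 s] p unfolding R_def
        by (auto intro!: derivative_eq_intros simp: numeral_2_eq_2 field_simps)
      moreover have "a 1 s * R s / (a 0 s)\<^sup>2 \<le> 0"
        using nn[of s 1] R[of s] s t by (intro divide_nonpos_nonneg mult_nonneg_nonpos) auto
      ultimately show "\<exists>y. ((\<lambda>s. (a 1 s)\<^sup>2 / a 0 s) has_real_derivative y) (at s) \<and> y \<le> 0" by blast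
    qed
    thus ?thesis using pos[OF t] by (simp add: c_def field_simps)
  qed
  \<comment> \<open>Positivity of \<open>a 0\<close> is known only inside the interval, so the contradiction is drawn at a point strictly between the bound and \<open>T\<close>.\<close>
  define T' where "T' = (max 0 (2 * moment \<phi> 0 / moment \<phi> 1) + T) / 2"
  have T': "T' < T" "T' > 2 * moment \<phi> 0 / moment \<phi> 1" "T' > 0" using T T0 by (auto simp: T'_def)
  have "sqrt (a 0 (- T')) - sqrt c / 2 * (- T') \<le> sqrt (a 0 0) - sqrt c / 2 * 0"
  proof (rule DERIV_nonneg_imp_nondecreasing[of _ _ "\<lambda>s. sqrt (a 0 s) - sqrt c / 2 * s"])
    show "- T' \<le> 0" using T' by simp
    fix s assume s: "- T' \<le> s" "s \<le> 0"
    have s': "- T < s" using s T' by simp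
    have p: "a 0 s > 0" by (rule pos[OF s' s(2)])
    have "((\<lambda>s. sqrt (a 0 s) - sqrt c / 2 * s) has_real_derivative a 1 s / (2 * sqrt (a 0 s)) - sqrt c / 2) (at s)"
      using D[of 0 s] p by (auto intro!: derivative_eq_intros simp: field_simps)
    moreover have "sqrt c * sqrt (a 0 s) \<le> a 1 s"
      using real_sqrt_le_mono[OF H[OF s' s(2)]] nn[of s 1] s s' by (simp add: real_sqrt_mult)
    hence "a 1 s / (2 * sqrt (a 0 s)) - sqrt c / 2 \<ge> 0" using p by (simp add: field_simps)
    ultimately show "\<exists>y. ((\<lambda>s. sqrt (a 0 s) - sqrt c / 2 * s) has_real_derivative y) (at s) \<and> y \<ge> 0" by blast
  qed
  moreover have "sqrt (a 0 (- T')) \<ge> 0" using nn[of "- T'" 0] T' by simp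
  moreover have "sqrt c * T' > 2 * sqrt (a 0 0)"
  proof -
    have "sqrt c = moment \<phi> 1 / sqrt (a 0 0)" using m1 a00 by (simp add: c_def real_sqrt_divide a0)
    moreover have "moment \<phi> 1 * T' > 2 * a 0 0" using T'(2) m1 by (simp add: a0 field_simps)
    hence "moment \<phi> 1 * T' / sqrt (a 0 0) > 2 * a 0 0 / sqrt (a 0 0)" using a00 by (simp add: divide_strict_right_mono)
    moreover have "2 * a 0 0 / sqrt (a 0 0) = 2 * sqrt (a 0 0)"
      using a00 by (simp add: field_simps)
    ultimately show ?thesis by simp
  qed
  ultimately show False by simp
qed

text \<open>The set of parameters with real zeros is upward closed by de Bruijn's theorem, bounded below by the
  preceding lemma, and contains its infimum by Hurwitz's theorem.\<close>
theorem deformation_threshold: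
  assumes \<phi>: "rapid \<phi>" and rz: "real_zeros \<phi>"
    and x: "x > 0" "Re (moment_series \<phi> (of_real x)) > 0"
    and turan: "2 * moment \<phi> 0 * moment \<phi> 2 \<le> (moment \<phi> 1)\<^sup>2" and m1: "moment \<phi> 1 > 0"
  shows "\<exists>l. (\<forall>t. real_zeros (gauss_weight t \<phi>) \<longleftrightarrow> l \<le> t) \<and> l \<ge> - (2 * moment \<phi> 0 / moment \<phi> 1)"
proof -
  define S where "S = {t. real_zeros (gauss_weight t \<phi>)}"
  define b where "b = 2 * moment \<phi> 0 / moment \<phi> 1"
  have up: "t \<in> S" if "s \<in> S" "s \<le> t" for s t
  proof -
    have "real_zeros (gauss_weight (t - s) (gauss_weight s \<phi>))"
      by (rule real_zeros_gauss_weight[OF rapid_gauss_weight[OF \<phi>]]) (use that in \<open>auto simp: S_def\<close>)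
    thus ?thesis unfolding gauss_weight_add by (simp add: S_def)
  qed
  have S0: "0 \<in> S" using rz by (simp add: S_def)
  have b0: "b \<ge> 0"
  proof -
    have "moment \<phi> 0 \<ge> 0" using moments_nonneg_backward[OF \<phi>, of 0 x 0 0] rz x by simp
    thus ?thesis using m1 by (simp add: b_def)
  qed
  have lower: "- b \<le> t" if "t \<in> S" for t
  proof (rule ccontr)
    assume "\<not> - b \<le> t"
    hence "- t > b" by simp
    from no_real_zeros_far_back[OF \<phi> x turan m1 this[unfolded b_def]] this b0 that show False
      by (simp add: S_def)
  qed
  have bdd: "bdd_below S" using lower by (rule bdd_belowI)
  define l where "l = Inf S"
  have lb: "l \<ge> - b" unfolding l_def using S0 lower by (intro cInf_greatest) auto
  have above: "t \<in> S" if "t > l" for t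
  proof -
    have "S \<noteq> {}" "Inf S < t" using S0 that by (auto simp: l_def)
    then obtain s where "s \<in> S" "s < t" using cInf_lessD by metis
    thus ?thesis using up[of s t] by simp
  qed
  obtain y where y: "cos_transform (gauss_weight l \<phi>) y \<noteq> 0"
    using cos_transform_gauss_nontrivial[OF \<phi> real_zeros_nontrivial[OF rz]] by blast
  have "real_zeros (gauss_weight l \<phi>)"
  proof (rule real_zeros_limit[OF \<phi> _ _ _ _ _ y, of "\<lambda>n u. exp ((l + 1 / real (Suc n)) * u\<^sup>2)" "l + 1"])
    show "real_zeros (\<lambda>u. exp ((l + 1 / real (Suc n)) * u\<^sup>2) * \<phi> u)" for n
      using above[of "l + 1 / real (Suc n)"] by (simp add: S_def)
    show "\<bar>exp ((l + 1 / real (Suc n)) * u\<^sup>2)\<bar> \<le> exp ((l + 1) * u\<^sup>2)" for n u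
      by (simp add: mult_right_mono)
    have "(\<lambda>n. 1 / real (Suc n)) \<longlonglongrightarrow> 0" using LIMSEQ_inverse_real_of_nat by (simp add: inverse_eq_divide)
    from tendsto_exp[OF tendsto_mult[OF tendsto_add[OF tendsto_const this] tendsto_const]]
    show "(\<lambda>n. exp ((l + 1 / real (Suc n)) * u\<^sup>2)) \<longlonglongrightarrow> exp (l * u\<^sup>2)" for u by simp
  qed auto
  hence "l \<in> S" by (simp add: S_def)
  have "t \<in> S \<longleftrightarrow> l \<le> t" for t
    using up[OF \<open>l \<in> S\<close>] cInf_lower[OF _ bdd] by (auto simp: l_def)
  thus ?thesis using lb unfolding S_def b_def by auto
qed

section \<open>Legendre and Jacobi symbols\<close>

lemma Legendre_values: "Legendre a p \<in> {-1, 0, 1}"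
  by (simp add: Legendre_def)

text \<open>Distinct elements of \<open>{-1, 0, 1}\<close> are incongruent modulo \<open>p > 2\<close>, so Euler's criterion
  determines the symbol exactly.\<close>
lemma Legendre_eqI:
  assumes p: "p > 2" and x: "x \<in> {-1, 0, 1}" and c: "[Legendre a (int p) = x] (mod int p)"
  shows "Legendre a (int p) = x"
proof -
  have "int p dvd Legendre a (int p) - x" using c by (simp add: cong_iff_dvd_diff)
  moreover have "\<bar>Legendre a (int p) - x\<bar> < int p" using Legendre_values[of a "int p"] x p by auto
  ultimately have "Legendre a (int p) - x = 0"
    by (metis abs_of_nat dvd_imp_le_int not_le)
  thus ?thesis by simp
qed

lemma Legendre_mult:
  assumes p: "prime p" "p > 2"
  shows "Legendre (a * b) (int p) = Legendre a (int p) * Legendre b (int p)"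
proof (rule Legendre_eqI[OF p(2)])
  show "Legendre a (int p) * Legendre b (int p) \<in> {- 1, 0, 1}"
    using Legendre_values[of a "int p"] Legendre_values[of b "int p"] by auto
  have "[Legendre (a * b) (int p) = (a * b) ^ ((p - 1) div 2)] (mod int p)"
    by (rule euler_criterion[OF p])
  hence *: "[Legendre (a * b) (int p) = a ^ ((p - 1) div 2) * b ^ ((p - 1) div 2)] (mod int p)"
    by (simp only: power_mult_distrib)
  have "[Legendre a (int p) * Legendre b (int p) = a ^ ((p - 1) div 2) * b ^ ((p - 1) div 2)] (mod int p)"
    by (intro cong_mult euler_criterion p)
  from cong_trans[OF * cong_sym[OF this]]
  show "[Legendre (a * b) (int p) = Legendre a (int p) * Legendre b (int p)] (mod int p)" .
qed

lemma Legendre_cong: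
  assumes "[a = b] (mod m)" shows "Legendre a m = Legendre b m"
proof -
  have "[a = 0] (mod m) \<longleftrightarrow> [b = 0] (mod m)" using assms by (simp add: cong_def)
  moreover have "QuadRes m a \<longleftrightarrow> QuadRes m b" unfolding QuadRes_def using assms by (simp add: cong_def)
  ultimately show ?thesis by (simp add: Legendre_def)
qed

lemma Legendre_zero_iff: "Legendre a m = 0 \<longleftrightarrow> m dvd a"
  by (simp add: Legendre_def cong_0_iff)

lemma Legendre_one: "p > 1 \<Longrightarrow> Legendre 1 p = 1"
proof -
  assume p: "p > 1"
  have "\<not> p dvd 1" using p by (auto dest: zdvd_imp_le)
  moreover have "QuadRes p 1" unfolding QuadRes_def by (rule exI[of _ 1]) simp
  ultimately show ?thesis by (simp add: Legendre_def cong_0_iff)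
qed

text \<open>The quadratic characters modulo \<open>4\<close> and modulo \<open>8\<close>: at odd \<open>n\<close> they are
  \<open>(-1)\<^bsup>(n-1)/2\<^esup>\<close> and \<open>(-1)\<^bsup>(n\<^sup>2-1)/8\<^esup>\<close>.\<close>
definition sign4 :: "int \<Rightarrow> int" where
  "sign4 n = (if even n then 0 else if n mod 4 = 1 then 1 else -1)"

definition sign8 :: "int \<Rightarrow> int" where
  "sign8 n = (if even n then 0 else if n mod 8 = 1 \<or> n mod 8 = 7 then 1 else -1)"

lemma odd_mod_4: "odd (n::int) \<Longrightarrow> n mod 4 = 1 \<or> n mod 4 = 3" by presburger
lemma odd_mod_8: "odd (n::int) \<Longrightarrow> n mod 8 = 1 \<or> n mod 8 = 3 \<or> n mod 8 = 5 \<or> n mod 8 = 7" by presburger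

lemma sign4_mult: "sign4 (a * b) = sign4 a * sign4 b"
proof (cases "odd a \<and> odd b")
  case True
  have "(a * b) mod 4 = ((a mod 4) * (b mod 4)) mod 4" by (rule mod_mult_eq[symmetric])
  hence e: "a mod 4 = r \<Longrightarrow> b mod 4 = t \<Longrightarrow> (a * b) mod 4 = (r * t) mod 4" for r t by metis
  have "odd a" "odd b" using True by auto
  from odd_mod_4[OF this(1)] odd_mod_4[OF this(2)] this show ?thesis
    by (elim disjE) (simp_all add: sign4_def e)
qed (auto simp: sign4_def)

lemma sign8_mult: "sign8 (a * b) = sign8 a * sign8 b"
proof (cases "odd a \<and> odd b")
  case True
  have "(a * b) mod 8 = ((a mod 8) * (b mod 8)) mod 8" by (rule mod_mult_eq[symmetric])
  hence e: "a mod 8 = r \<Longrightarrow> b mod 8 = t \<Longrightarrow> (a * b) mod 8 = (r * t) mod 8" for r t by metis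
  have "odd a" "odd b" using True by auto
  from odd_mod_8[OF this(1)] odd_mod_8[OF this(2)] this show ?thesis
    by (elim disjE) (simp_all add: sign8_def e)
qed (auto simp: sign8_def)

lemma sign4_prod: "sign4 (prod f A) = (\<Prod>x\<in>A. sign4 (f x))"
  by (induction A rule: infinite_finite_induct) (simp_all add: sign4_mult, simp_all add: sign4_def)

lemma sign8_prod: "sign8 (prod f A) = (\<Prod>x\<in>A. sign8 (f x))"
  by (induction A rule: infinite_finite_induct) (simp_all add: sign8_mult, simp_all add: sign8_def)

lemma prime_gt_2_odd: "prime (p::nat) \<Longrightarrow> p > 2 \<Longrightarrow> odd p"
  using prime_odd_nat by blast

lemma minus_one_power_half: "odd p \<Longrightarrow> (-1) ^ ((p - 1) div 2) = sign4 (int p)"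
proof -
  assume o: "odd p"
  then obtain m where m: "p = 2 * m + 1" by (auto elim: oddE)
  have "int p mod 4 = (if even m then 1 else 3)" unfolding m by (auto elim!: evenE oddE)
  thus ?thesis using m by (auto simp: sign4_def)
qed

lemma Legendre_minus_one:
  assumes p: "prime p" "p > 2" shows "Legendre (-1) (int p) = sign4 (int p)"
proof (rule Legendre_eqI[OF p(2)])
  show "[Legendre (- 1) (int p) = sign4 (int p)] (mod int p)"
    using euler_criterion[OF p, of "-1"] minus_one_power_half[OF prime_gt_2_odd[OF p]] by simp
qed (auto simp: sign4_def)

text \<open>By Gauss's lemma the symbol is the parity of the number of \<open>x \<le> h\<close> with \<open>2x > h\<close>, where
  \<open>p = 2h + 1\<close>.\<close>
lemma Legendre_two:
  assumes p: "prime p" "p > 2" shows "Legendre 2 (int p) = sign8 (int p)"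
proof -
  have op: "odd p" by (rule prime_gt_2_odd[OF p])
  have "\<not> int p dvd 2" using p(2) by (auto dest: zdvd_imp_le)
  then interpret G: GAUSS p 2
    by unfold_locales (use p in \<open>auto simp: cong_0_iff\<close>)
  define h where "h = (int p - 1) div 2"
  have h: "int p = 2 * h + 1" using op unfolding h_def by presburger
  have C: "G.C = (\<lambda>x. 2 * x) ` {0<..h}"
  proof -
    have "(x * 2) mod int p = 2 * x" if "x \<in> {0<..h}" for x using that h by auto
    hence "(\<lambda>x. x mod int p) ` (\<lambda>x. x * 2) ` {0<..h} = (\<lambda>x. 2 * x) ` {0<..h}"
      unfolding image_image by (intro image_cong) auto
    thus ?thesis unfolding G.C_def G.B_def G.A_def h_def .
  qed
  have "G.E = (\<lambda>x. 2 * x) ` {h div 2<..h}"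
  proof -
    have iff: "h < 2 * x \<longleftrightarrow> h div 2 < x" for x by presburger
    have h0: "0 \<le> h div 2" using h p(2) by simp
    have "(\<lambda>x. 2 * x) ` {0<..h} \<inter> {h<..} = (\<lambda>x. 2 * x) ` {x \<in> {0<..h}. h < 2 * x}" by blast
    also have "{x \<in> {0<..h}. h < 2 * x} = {h div 2<..h}" unfolding iff using h0 by auto
    finally show ?thesis unfolding G.E_def C h_def[symmetric] .
  qed
  hence "card G.E = card {h div 2<..h}" by (simp add: card_image inj_on_def)
  also have "\<dots> = nat (h - h div 2)" by simp
  finally have "Legendre 2 (int p) = (-1) ^ nat (h - h div 2)" using G.gauss_lemma by simp
  moreover have "(-1::int) ^ nat (h - h div 2) = sign8 (int p)"
  proof -
    have "h \<ge> 0" using h by simp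
    have "even (nat (h - h div 2)) \<longleftrightarrow> even (h - h div 2)" using \<open>h \<ge> 0\<close> by (simp add: even_nat_iff)
    also have "\<dots> \<longleftrightarrow> h mod 4 = 0 \<or> h mod 4 = 3" by presburger
    also have "\<dots> \<longleftrightarrow> int p mod 8 = 1 \<or> int p mod 8 = 7" unfolding h by presburger
    finally show ?thesis using op by (auto simp: sign8_def uminus_power_if)
  qed
  ultimately show ?thesis by simp
qed

text \<open>Quadratic reciprocity, with the sign written so that it is multiplicative in \<open>p\<close>.\<close>
lemma reciprocity_sign:
  assumes p: "prime p" "p > 2" and q: "prime q" "q > 2" and ne: "p \<noteq> q"
  shows "Legendre (int p) (int q) = Legendre (int q) (int p) * (if sign4 (int q) = 1 then 1 else sign4 (int p))"
proof -
  have "(-1::int) ^ ((p - 1) div 2 * ((q - 1) div 2)) = sign4 (int p) ^ ((q - 1) div 2)"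
    using minus_one_power_half[OF prime_gt_2_odd[OF p]] by (simp add: power_mult)
  also have "\<dots> = (if sign4 (int q) = 1 then 1 else sign4 (int p))"
  proof (cases "even ((q - 1) div 2)")
    case True
    have "sign4 (int p) = 1 \<or> sign4 (int p) = -1" using prime_gt_2_odd[OF p] by (auto simp: sign4_def)
    hence "sign4 (int p) ^ ((q - 1) div 2) = 1" using True by auto
    thus ?thesis using minus_one_power_half[OF prime_gt_2_odd[OF q]] True by simp
  next
    case False
    have "sign4 (int p) = 1 \<or> sign4 (int p) = -1" using prime_gt_2_odd[OF p] by (auto simp: sign4_def)
    hence "sign4 (int p) ^ ((q - 1) div 2) = sign4 (int p)" using False by auto
    thus ?thesis using minus_one_power_half[OF prime_gt_2_odd[OF q]] False by (simp add: uminus_power_if)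
  qed
  finally have r: "Legendre (int p) (int q) * Legendre (int q) (int p) = (if sign4 (int q) = 1 then 1 else sign4 (int p))"
    using Quadratic_Reciprocity[OF p q ne] by simp
  have "Legendre (int q) (int p) * Legendre (int q) (int p) = 1"
  proof -
    have "\<not> int p dvd int q" using p q ne using primes_dvd_imp_eq[of p q] by auto
    hence "Legendre (int q) (int p) \<noteq> 0" by (simp add: Legendre_zero_iff)
    thus ?thesis using Legendre_values[of "int q" "int p"] by auto
  qed
  hence "Legendre (int p) (int q) = Legendre (int p) (int q) * Legendre (int q) (int p) * Legendre (int q) (int p)"
    by (simp only: mult.assoc mult_1_right)
  thus ?thesis unfolding r by (simp only: mult.commute)
qed

text \<open>For squarefree \<open>k\<close>, the only case of interest, this is the Jacobi symbol.\<close>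
definition jacobi :: "nat \<Rightarrow> int \<Rightarrow> int" where
  "jacobi k n = (\<Prod>p\<in>prime_factors k. Legendre n (int p))"

lemma odd_prime_factor: "odd (k::nat) \<Longrightarrow> p \<in> prime_factors k \<Longrightarrow> prime p \<and> p > 2"
proof -
  assume k: "odd k" and p: "p \<in> prime_factors k"
  hence "prime p" "p dvd k" by (auto simp: in_prime_factors_iff)
  moreover have "p \<noteq> 2" using k calculation(2) by blast
  ultimately show "prime p \<and> p > 2" using prime_ge_2_nat[of p] by simp
qed

lemma squarefree_eq_prod_primes: "squarefree (k::nat) \<Longrightarrow> k > 0 \<Longrightarrow> (\<Prod>p\<in>prime_factors k. p) = k"
proof -
  assume k: "squarefree k" "k > 0"
  have "(\<Prod>p\<in>prime_factors k. p) = (\<Prod>p\<in>prime_factors k. p ^ multiplicity p k)"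
    using k squarefree_factorial_semiring'[of k] by (intro prod.cong) auto
  thus ?thesis using prime_factorization_nat[OF k(2)] by simp
qed

lemma jacobi_mult: "odd k \<Longrightarrow> jacobi k (a * b) = jacobi k a * jacobi k b"
  unfolding jacobi_def prod.distrib[symmetric] by (intro prod.cong refl Legendre_mult) (auto dest: odd_prime_factor)

lemma jacobi_cong: "[a = b] (mod int k) \<Longrightarrow> jacobi k a = jacobi k b"
  unfolding jacobi_def
  by (intro prod.cong refl Legendre_cong) (auto intro: cong_dvd_modulus simp: in_prime_factors_iff)

lemma jacobi_one: "jacobi k 1 = 1"
  unfolding jacobi_def by (intro prod.neutral ballI Legendre_one) (auto simp: in_prime_factors_iff dest!: prime_gt_1_nat)

lemma jacobi_values: "jacobi k n \<in> {-1, 0, 1}"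
proof -
  have "\<bar>jacobi k n\<bar> \<le> 1"
    unfolding jacobi_def abs_prod 
    by (intro prod_le_1 conjI abs_ge_zero) (auto simp: Legendre_def)
  thus ?thesis by auto
qed

lemma jacobi_zero_iff: "k > 0 \<Longrightarrow> jacobi k n = 0 \<longleftrightarrow> \<not> coprime n (int k)"
proof
  assume k: "k > 0"
  show "jacobi k n = 0" if "\<not> coprime n (int k)"
  proof -
    have "gcd n (int k) \<noteq> 1" using that by (simp add: coprime_iff_gcd_eq_1)
    hence "nat (gcd n (int k)) \<noteq> 1" by (simp add: nat_eq_iff)
    from prime_factor_nat[OF this] obtain p where p: "prime p" "p dvd nat (gcd n (int k))" by blast
    from p(2) have "int p dvd int (nat (gcd n (int k)))" by (simp only: int_dvd_int_iff)
    hence "int p dvd gcd n (int k)" by simp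
    hence "int p dvd n" "p dvd k" by auto
    thus ?thesis using p k unfolding jacobi_def by (auto simp: prod_zero_iff Legendre_zero_iff in_prime_factors_iff intro!: bexI[of _ p])
  qed
  assume "jacobi k n = 0"
  then obtain p where p: "p \<in> prime_factors k" "int p dvd n"
    unfolding jacobi_def by (auto simp: prod_zero_iff Legendre_zero_iff)
  hence "prime p" "int p dvd int k" by (auto simp: in_prime_factors_iff)
  show "\<not> coprime n (int k)"
  proof
    assume "coprime n (int k)"
    hence "is_unit (int p)" using p(2) \<open>int p dvd int k\<close> by (rule coprime_common_divisor)
    thus False using \<open>prime p\<close> by (simp add: zdvd1_eq)
  qed
qed

lemma jacobi_minus_one: assumes "odd k" "squarefree k" shows "jacobi k (-1) = sign4 (int k)"
proof -
  have k: "k > 0" using assms(1) by (auto intro: Nat.gr0I)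
  have "jacobi k (-1) = (\<Prod>p\<in>prime_factors k. sign4 (int p))"
    unfolding jacobi_def using odd_prime_factor[OF assms(1)] by (intro prod.cong refl Legendre_minus_one) auto
  also have "\<dots> = sign4 (int (\<Prod>p\<in>prime_factors k. p))" by (simp add: sign4_prod)
  finally show ?thesis using squarefree_eq_prod_primes[OF assms(2) k] by simp
qed

lemma jacobi_two: assumes "odd k" "squarefree k" shows "jacobi k 2 = sign8 (int k)"
proof -
  have k: "k > 0" using assms(1) by (auto intro: Nat.gr0I)
  have "jacobi k 2 = (\<Prod>p\<in>prime_factors k. sign8 (int p))"
    unfolding jacobi_def using odd_prime_factor[OF assms(1)] by (intro prod.cong refl Legendre_two) auto
  also have "\<dots> = sign8 (int (\<Prod>p\<in>prime_factors k. p))" by (simp add: sign8_prod)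
  finally show ?thesis using squarefree_eq_prod_primes[OF assms(2) k] by simp
qed

lemma jacobi_reciprocity:
  assumes k: "odd k" "squarefree k" and q: "prime q" "q > 2" "\<not> q dvd k"
  shows "Legendre (int k) (int q) = jacobi k (int q) * (if sign4 (int q) = 1 then 1 else sign4 (int k))"
proof -
  have k0: "k > 0" using k(1) by (auto intro: Nat.gr0I)
  have Lp: "Legendre (int (\<Prod>p\<in>A. p)) (int q) = (\<Prod>p\<in>A. Legendre (int p) (int q))" for A
    by (induction A rule: infinite_finite_induct) (use q in \<open>auto simp: Legendre_mult Legendre_one\<close>)
  have "Legendre (int k) (int q) = (\<Prod>p\<in>prime_factors k. Legendre (int p) (int q))"
    using Lp[of "prime_factors k"] squarefree_eq_prod_primes[OF k(2) k0] by simp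
  also have "\<dots> = (\<Prod>p\<in>prime_factors k. Legendre (int q) (int p) * (if sign4 (int q) = 1 then 1 else sign4 (int p)))"
    using odd_prime_factor[OF k(1)] q by (intro prod.cong refl reciprocity_sign) (auto simp: in_prime_factors_iff)
  also have "\<dots> = jacobi k (int q) * (\<Prod>p\<in>prime_factors k. if sign4 (int q) = 1 then 1 else sign4 (int p))"
    by (simp add: prod.distrib jacobi_def)
  also have "(\<Prod>p\<in>prime_factors k. if sign4 (int q) = 1 then 1 else sign4 (int p)) =
      (if sign4 (int q) = 1 then 1 else sign4 (int (\<Prod>p\<in>prime_factors k. p)))"
    by (simp add: sign4_prod)
  finally show ?thesis using squarefree_eq_prod_primes[OF k(2) k0] by simp
qed

text \<open>Otherwise squaring would permute the nonzero residues, although \<open>1\<close> and \<open>p - 1\<close> have the same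
  square.\<close>
lemma exists_nonresidue:
  assumes p: "prime p" "p > 2" shows "\<exists>a. Legendre a (int p) = -1"
proof (rule ccontr)
  assume "\<not> ?thesis"
  hence all: "QuadRes (int p) a" if "\<not> int p dvd a" for a
    using that unfolding Legendre_def cong_0_iff by (metis (full_types))
  let ?S = "{1..int p - 1}"
  let ?f = "\<lambda>x. x\<^sup>2 mod int p"
  have "?S \<subseteq> ?f ` ?S"
  proof
    fix a assume a: "a \<in> ?S"
    hence "\<not> int p dvd a" by (auto dest: zdvd_imp_le)
    then obtain y where y: "[y\<^sup>2 = a] (mod int p)" using all unfolding QuadRes_def by blast
    have e: "?f (y mod int p) = a" using y a by (simp add: cong_def power_mod)
    have "y mod int p \<noteq> 0" using e a by auto
    moreover have "0 \<le> y mod int p" "y mod int p < int p" using p by auto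
    ultimately have "y mod int p \<in> ?S" by auto
    thus "a \<in> ?f ` ?S" using e by blast
  qed
  hence "inj_on ?f ?S" by (intro eq_card_imp_inj_on) (auto intro!: antisym card_image_le[of "{1..int p - 1}", simplified] dest!: card_mono[rotated])
  moreover have "?f 1 = ?f (int p - 1)"
  proof -
    have "(int p - 1)\<^sup>2 = 1 + int p * (int p - 2)" by (simp add: power2_eq_square algebra_simps)
    thus ?thesis by simp
  qed
  ultimately have "1 = int p - 1" by (rule inj_onD) (use p in auto)
  thus False using p by simp
qed

section \<open>Primitivity of the Kronecker character\<close>

text \<open>The last clause is primitivity in the form needed for Gauss sums: for no prime \<open>p\<close> dividing \<open>D\<close>
  does the character factor through residues modulo \<open>D / p\<close>. The domain is \<open>int\<close>, since oddness and
  the theta series refer to negative arguments.\<close>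
definition odd_primitive_char :: "nat \<Rightarrow> (int \<Rightarrow> int) \<Rightarrow> bool" where
  "odd_primitive_char D X \<longleftrightarrow>
     (\<forall>a b. X (a * b) = X a * X b) \<and> (\<forall>a b. [a = b] (mod int D) \<longrightarrow> X a = X b) \<and>
     X 1 = 1 \<and> X (-1) = -1 \<and> (\<forall>n. X n \<in> {-1, 0, 1}) \<and>
     (\<forall>n. X n = 0 \<longleftrightarrow> \<not> coprime n (int D)) \<and>
     (\<forall>p. prime p \<and> p dvd D \<longrightarrow>
        (\<exists>a. [a = 1] (mod int (D div p)) \<and> coprime a (int D) \<and> X a = -1))"

text \<open>The component at \<open>2\<close> of the character of discriminant \<open>- c k\<close> with \<open>k\<close> odd. For \<open>c = 8\<close> there are
  two primitive characters modulo \<open>8\<close>, and the residue of \<open>k\<close> modulo \<open>4\<close> selects the one whose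
  product with the Jacobi symbol is odd.\<close>
definition two_part :: "nat \<Rightarrow> nat \<Rightarrow> int \<Rightarrow> int" where
  "two_part c k n = (if c = 1 then 1 else if c = 4 then sign4 n
     else if k mod 4 = 1 then sign4 n * sign8 n else sign8 n)"

definition disc_parts :: "nat \<Rightarrow> nat \<Rightarrow> bool" where
  "disc_parts c k \<longleftrightarrow> odd k \<and> squarefree k \<and> (c = 1 \<and> k mod 4 = 3 \<or> c = 4 \<and> k mod 4 = 1 \<or> c = 8)"

lemma squarefree_int_imp_nat: "squarefree (int n) \<Longrightarrow> squarefree n"
proof (rule squarefreeI)
  fix x assume "squarefree (int n)" "x\<^sup>2 dvd n"
  hence "(int x)\<^sup>2 dvd int n" by (metis int_dvd_int_iff of_nat_power)
  hence "int x dvd 1" using \<open>squarefree (int n)\<close> squarefreeD by blast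
  thus "x dvd 1" by (metis int_dvd_int_iff of_nat_1)
qed

lemma neg_fund_disc_parts:
  assumes "neg_fund_disc D" shows "\<exists>c k. disc_parts c k \<and> D = c * k"
proof -
  have fd: "fundamental_discriminant (- int D)" using assms by (simp add: neg_fund_disc_def)
  show ?thesis
  proof (cases "(- int D) mod 4 = 1 \<and> squarefree (- int D)")
    case True
    have "(- int D) mod 4 = 1" using True by blast
    hence "D mod 4 = 3" by presburger
    moreover have "squarefree D" using True by (intro squarefree_int_imp_nat) simp
    moreover have "odd D" using \<open>D mod 4 = 3\<close> by presburger
    ultimately have "disc_parts 1 D" by (simp add: disc_parts_def)
    thus ?thesis by (intro exI[of _ 1] exI[of _ D]) simp
  next
    case False
    then obtain m where m: "- int D = 4 * m" "m mod 4 = 2 \<or> m mod 4 = 3" "squarefree m"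
      using fd unfolding fundamental_discriminant_def by blast
    define k where "k = nat (- m)"
    have k: "m = - int k" "D = 4 * k" using m(1) by (auto simp: k_def)
    have sk: "squarefree k" using m(3) k by (intro squarefree_int_imp_nat) simp
    show ?thesis
    proof (cases "m mod 4 = 3")
      case True
      hence "k mod 4 = 1" using k(1) by presburger
      moreover have "odd k" using \<open>k mod 4 = 1\<close> by presburger
      ultimately have "disc_parts 4 k" using sk by (simp add: disc_parts_def)
      thus ?thesis using k(2) by blast
    next
      case False
      hence "k mod 4 = 2" using m(2) k(1) by presburger
      define j where "j = k div 2"
      have j: "k = 2 * j" "odd j" using \<open>k mod 4 = 2\<close> unfolding j_def by presburger+
      have "squarefree j" using sk by (rule squarefree_mono[rotated]) (simp add: j)
      hence "disc_parts 8 j" using j by (simp add: disc_parts_def)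
      moreover have "D = 8 * j" using k j by simp
      ultimately show ?thesis by blast
    qed
  qed
qed

definition real_char :: "nat \<Rightarrow> nat \<Rightarrow> int \<Rightarrow> int" where
  "real_char c k n = two_part c k n * jacobi k n"

lemma two_part_mult: "two_part c k (a * b) = two_part c k a * two_part c k b"
  by (simp add: two_part_def sign4_mult sign8_mult mult_ac)

lemma sign4_cong: "[a = b] (mod 4) \<Longrightarrow> sign4 a = sign4 b"
  unfolding sign4_def cong_def by presburger

lemma sign8_cong: "[a = b] (mod 8) \<Longrightarrow> sign8 a = sign8 b"
proof -
  assume c: "[a = b] (mod 8)"
  hence "even a \<longleftrightarrow> even b" unfolding cong_def by presburger
  thus ?thesis using c by (simp add: sign8_def cong_def)
qed

lemma two_part_cong:
  assumes "disc_parts c k" "[a = b] (mod int c)" shows "two_part c k a = two_part c k b"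
proof -
  have "[a = b] (mod 8) \<Longrightarrow> [a = b] (mod 4)" by (rule cong_dvd_modulus) auto
  thus ?thesis using assms sign4_cong[of a b] sign8_cong[of a b]
    by (auto simp: two_part_def disc_parts_def)
qed

lemma two_part_zero_iff: "disc_parts c k \<Longrightarrow> two_part c k n = 0 \<longleftrightarrow> c \<noteq> 1 \<and> even n"
  by (auto simp: two_part_def disc_parts_def sign4_def sign8_def)

lemma two_part_values: "two_part c k n \<in> {-1, 0, 1}"
  by (auto simp: two_part_def sign4_def sign8_def)

lemma two_part_one: "two_part c k 1 = 1"
  by (simp add: two_part_def sign4_def sign8_def)

lemma sign4_nat: "odd k \<Longrightarrow> sign4 (int k) = (if k mod 4 = 1 then 1 else -1)"
proof -
  have "int k mod 4 = 1 \<longleftrightarrow> k mod 4 = 1" by presburger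
  thus "odd k \<Longrightarrow> ?thesis" by (simp add: sign4_def)
qed

text \<open>The Jacobi symbol at \<open>-1\<close> depends on \<open>k\<close> modulo \<open>4\<close>, and in each of the three cases the component
  at \<open>2\<close> has the opposite parity.\<close>
lemma real_char_minus_one: "disc_parts c k \<Longrightarrow> real_char c k (-1) = -1"
proof -
  assume d: "disc_parts c k"
  have "jacobi k (-1) = (if k mod 4 = 1 then 1 else -1)"
    using d jacobi_minus_one[of k] sign4_nat[of k] by (auto simp: disc_parts_def)
  thus ?thesis using d by (auto simp: real_char_def two_part_def disc_parts_def sign4_def sign8_def)
qed

lemma coprime_two_part:
  assumes "disc_parts c k" shows "coprime n (int (c * k)) \<longleftrightarrow> (c = 1 \<or> odd n) \<and> coprime n (int k)"
proof -
  have 4: "coprime n 4 \<longleftrightarrow> odd n" and 8: "coprime n 8 \<longleftrightarrow> odd n"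
    using coprime_power_right_iff[of n 2 2] coprime_power_right_iff[of n 2 3] by auto
  have "c = 1 \<or> c = 4 \<or> c = 8" using assms by (auto simp: disc_parts_def)
  hence "coprime n (int c) \<longleftrightarrow> c = 1 \<or> odd n"
  proof (elim disjE)
    assume c: "c = 4" show ?thesis using 4 by (simp only: c of_nat_numeral) simp
  next
    assume c: "c = 8" show ?thesis using 8 by (simp only: c of_nat_numeral) simp
  qed simp
  thus ?thesis by (simp only: of_nat_mult coprime_mult_right_iff)
qed

lemma real_char_zero_iff:
  assumes "disc_parts c k" shows "real_char c k n = 0 \<longleftrightarrow> \<not> coprime n (int (c * k))"
proof -
  have "k > 0" using assms by (auto simp: disc_parts_def intro: Nat.gr0I)
  thus ?thesis unfolding coprime_two_part[OF assms] real_char_def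
    using two_part_zero_iff[OF assms, of n] jacobi_zero_iff[of k n] by auto
qed

text \<open>At \<open>q = 2\<close> both sides vanish unless \<open>c = 1\<close>, and then the Jacobi symbol at \<open>2\<close> decides. For odd \<open>q\<close> not dividing \<open>k\<close>,
  reciprocity moves \<open>k\<close> into the modulus, and its sign combines with the symbols of \<open>-1\<close> and \<open>c\<close>
  to the component at \<open>2\<close>.\<close>
lemma real_char_prime:
  assumes d: "disc_parts c k" and q: "prime q"
  shows "kronecker_prime (- int (c * k)) q = real_char c k (int q)"
proof (cases "q = 2")
  case True
  have k: "odd k" "squarefree k" using d by (auto simp: disc_parts_def)
  show ?thesis
  proof (cases "c = 1")
    case False
    hence "even c" using d by (auto simp: disc_parts_def)
    thus ?thesis using True two_part_zero_iff[OF d, of 2] False by (simp add: kronecker_prime_def real_char_def)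
  next
    case c: True
    have "(- int k) mod 8 = 1 \<or> (- int k) mod 8 = 7 \<longleftrightarrow> int k mod 8 = 1 \<or> int k mod 8 = 7" by presburger
    thus ?thesis using True c k jacobi_two[OF k]
      by (simp add: kronecker_prime_def real_char_def two_part_def sign8_def)
  qed
next
  case False
  have q2: "q > 2" using q False prime_ge_2_nat[of q] by simp
  have k: "odd k" "squarefree k" using d by (auto simp: disc_parts_def)
  have oq: "odd q" by (rule prime_gt_2_odd[OF q q2])
  have s4: "sign4 (int q) = 1 \<or> sign4 (int q) = -1" using oq by (auto simp: sign4_def)
  have kp: "kronecker_prime (- int (c * k)) q = Legendre (- int (c * k)) (int q)"
    using False by (simp add: kronecker_prime_def)
  show ?thesis
  proof (cases "q dvd k")
    case True
    hence "int q dvd - int (c * k)" by (simp add: dvd_mult)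
    hence "Legendre (- int (c * k)) (int q) = 0" by (simp only: Legendre_zero_iff)
    moreover have "jacobi k (int q) = 0"
    proof -
      have "\<not> coprime (int q) (int k)" using True prime_gt_1_nat[OF q] by (simp add: coprime_absorb_left)
      moreover have "k > 0" using k(1) by (auto intro: Nat.gr0I)
      ultimately show ?thesis by (simp add: jacobi_zero_iff)
    qed
    ultimately show ?thesis unfolding kp real_char_def by simp
  next
    case ndvd: False
    have c: "Legendre (int c) (int q) = (if c = 8 then sign8 (int q) else 1)"
    proof -
      have L2: "Legendre 2 (int q) = sign8 (int q)" by (rule Legendre_two[OF q q2])
      have s8: "sign8 (int q) * sign8 (int q) = 1" using oq by (auto simp: sign8_def)
      have L4: "Legendre 4 (int q) = 1" using Legendre_mult[OF q q2, of 2 2] L2 s8 by simp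
      have L8: "Legendre 8 (int q) = sign8 (int q)" using Legendre_mult[OF q q2, of 4 2] L2 L4 by simp
      show ?thesis using d L4 L8 Legendre_one[of "int q"] q2 by (auto simp: disc_parts_def)
    qed
    have "Legendre (- int (c * k)) (int q) = Legendre ((-1) * (int c * int k)) (int q)" by simp
    also have "\<dots> = sign4 (int q) * (Legendre (int c) (int q) * Legendre (int k) (int q))"
      by (simp only: Legendre_mult[OF q q2] Legendre_minus_one[OF q q2])
    also have "Legendre (int k) (int q) = jacobi k (int q) * (if sign4 (int q) = 1 then 1 else sign4 (int k))"
      by (rule jacobi_reciprocity[OF k q q2 ndvd])
    finally show ?thesis unfolding kp c real_char_def using d s4 sign4_nat[OF k(1)]
      by (auto simp: two_part_def disc_parts_def)
  qed
qed

lemma completely_multiplicative_factorization: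
  fixes X :: "int \<Rightarrow> int"
  assumes X: "\<And>a b. X (a * b) = X a * X b" "X 1 = 1" and n: "n > 0"
  shows "X (int n) = (\<Prod>p\<in>prime_factors n. X (int p) ^ multiplicity p n)"
proof -
  have pw: "X (a ^ j) = X a ^ j" for a j by (induction j) (auto simp: X)
  have pr: "X (prod f A) = (\<Prod>x\<in>A. X (f x))" for f :: "nat \<Rightarrow> int" and A
    by (induction A rule: infinite_finite_induct) (auto simp: X)
  have "int n = (\<Prod>p\<in>prime_factors n. int p ^ multiplicity p n)"
    by (subst prime_factorization_nat[OF n]) simp
  thus ?thesis by (metis (no_types, lifting) pr pw prod.cong)
qed

lemma real_char_mult: "odd k \<Longrightarrow> real_char c k (a * b) = real_char c k a * real_char c k b"
  by (simp add: real_char_def two_part_mult jacobi_mult mult_ac)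

lemma real_char_cong:
  assumes d: "disc_parts c k" and ab: "[a = b] (mod int (c * k))"
  shows "real_char c k a = real_char c k b"
proof -
  have "[a = b] (mod int c)" "[a = b] (mod int k)" using ab by (auto intro: cong_dvd_modulus)
  thus ?thesis unfolding real_char_def using two_part_cong[OF d] jacobi_cong by metis
qed

lemma real_char_one: "real_char c k 1 = 1"
  by (simp add: real_char_def two_part_one jacobi_one)

text \<open>For odd \<open>p\<close> the Chinese remainder theorem gives a residue that is a nonresidue modulo \<open>p\<close> and \<open>1\<close>
  modulo \<open>D / p\<close>, as \<open>k\<close> is squarefree. For \<open>p = 2\<close> the residue \<open>1 + D / 2\<close> works.\<close>
lemma real_char_primitive:
  assumes d: "disc_parts c k" and p: "prime p" "p dvd c * k"
  shows "\<exists>a. [a = 1] (mod int (c * k div p)) \<and> coprime a (int (c * k)) \<and> real_char c k a = -1"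
proof -
  have k: "odd k" "squarefree k" "k > 0" using d by (auto simp: disc_parts_def intro: Nat.gr0I)
  have "\<exists>a. [a = 1] (mod int (c * k div p)) \<and> real_char c k a = -1"
  proof (cases "p dvd k")
    case True
    have pk: "p \<in> prime_factors k" using True p k by (auto simp: in_prime_factors_iff)
    have p2: "p > 2" using odd_prime_factor[OF k(1) pk] by simp
    define r where "r = k div p"
    have r: "k = p * r" using True by (simp add: r_def)
    have "\<not> p dvd r"
    proof
      assume "p dvd r"
      hence "p\<^sup>2 dvd k" unfolding r power2_eq_square by (rule mult_dvd_mono[OF dvd_refl])
      hence "p dvd 1" using k(2) squarefreeD by blast
      thus False using p by simp
    qed
    hence cpr: "coprime p r" using p(1) by (simp add: prime_imp_coprime)
    have "coprime p c"
    proof -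
      have "coprime p 2" using p(1) p2 by (metis primes_coprime two_is_prime_nat less_irrefl)
      hence cp: "coprime p (2 ^ j)" for j by simp
      have "c = 2 ^ 0 \<or> c = 2 ^ 2 \<or> c = 2 ^ 3" using d by (auto simp: disc_parts_def)
      thus ?thesis using cp by metis
    qed
    hence cp: "coprime (int p) (int (c * r))" using cpr by simp
    obtain g where g: "Legendre g (int p) = -1" using exists_nonresidue[OF p(1) p2] by blast
    obtain a where a: "[a = g] (mod int p)" "[a = 1] (mod int (c * r))"
      using binary_chinese_remainder_int[OF cp] by blast
    have eq: "c * k div p = c * r" using r p(1) by (simp add: prime_gt_0_nat)
    have "[a = 1] (mod int c)" using a(2) by (auto intro: cong_dvd_modulus)
    hence "two_part c k a = 1" using two_part_cong[OF d] two_part_one by metis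
    moreover have "jacobi k a = Legendre a (int p) * (\<Prod>q\<in>prime_factors k - {p}. Legendre a (int q))"
      unfolding jacobi_def using pk by (subst prod.remove) auto
    moreover have "Legendre a (int p) = -1" using g Legendre_cong[OF a(1)] by simp
    moreover have "(\<Prod>q\<in>prime_factors k - {p}. Legendre a (int q)) = 1"
    proof (rule prod.neutral, rule ballI)
      fix q assume q: "q \<in> prime_factors k - {p}"
      hence "prime q" "q dvd p * r" "q \<noteq> p" using r by (auto simp: in_prime_factors_iff)
      hence "q dvd r" using p(1) by (metis prime_dvd_mult_iff primes_dvd_imp_eq)
      hence "int q dvd int (c * r)" by simp
      hence "[a = 1] (mod int q)" using a(2) cong_dvd_modulus by blast
      thus "Legendre a (int q) = 1" using Legendre_cong Legendre_one[of "int q"] \<open>prime q\<close>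
        by (metis of_nat_1 of_nat_less_iff prime_gt_1_nat)
    qed
    ultimately show ?thesis using a(2) unfolding eq real_char_def by auto
  next
    case False
    hence "p dvd c" using p by (simp add: prime_dvd_mult_iff)
    hence pc: "p = 2 \<and> (c = 4 \<or> c = 8)"
    proof -
      have "p dvd 2 ^ 2 \<Longrightarrow> p = 2" "p dvd 2 ^ 3 \<Longrightarrow> p = 2"
        using p(1) prime_dvd_power primes_dvd_imp_eq two_is_prime_nat by blast+
      thus ?thesis using \<open>p dvd c\<close> d p(1) by (auto simp: disc_parts_def)
    qed
    define a where "a = 1 + int (c * k div 2)"
    have j: "jacobi k a = 1"
    proof -
      have "int k dvd a - 1" using pc by (auto simp: a_def)
      hence "[a = 1] (mod int k)" by (simp add: cong_iff_dvd_diff)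
      thus ?thesis using jacobi_cong jacobi_one by metis
    qed
    have t: "two_part c k a = -1"
    proof (cases "c = 4")
      case True
      have "a = 1 + 2 * int k" using True by (simp add: a_def)
      hence "a mod 4 = 3" using k(1) by presburger
      hence "sign4 a = -1" unfolding sign4_def by presburger
      thus ?thesis using True by (simp add: two_part_def)
    next
      case False
      hence c8: "c = 8" using pc by simp
      have "a = 1 + 4 * int k" using c8 by (simp add: a_def)
      hence a8: "a mod 8 = 5" using k(1) by presburger
      hence "sign8 a = -1" "sign4 a = 1" unfolding sign8_def sign4_def by presburger+
      thus ?thesis using c8 by (simp add: two_part_def)
    qed
    have "[a = 1] (mod int (c * k div p))" using pc by (auto simp: a_def cong_iff_dvd_diff)
    thus ?thesis using j t by (auto simp: real_char_def intro!: exI[of _ a])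
  qed
  then obtain a where a: "[a = 1] (mod int (c * k div p))" "real_char c k a = -1" by blast
  have "coprime a (int (c * k))" using real_char_zero_iff[OF d, of a] a(2) by simp
  thus ?thesis using a by blast
qed

text \<open>The Kronecker symbol is defined through prime factorisations, so agreement at primes suffices. At
  \<open>n = 0\<close> both sides vanish since \<open>D \<noteq> 1\<close>.\<close>
theorem chi_odd_primitive_char:
  assumes D: "neg_fund_disc D"
  shows "\<exists>X. odd_primitive_char D X \<and> (\<forall>n. chi D n = X (int n))"
proof -
  obtain c k where d: "disc_parts c k" "D = c * k" using neg_fund_disc_parts[OF D] by blast
  let ?X = "real_char c k"
  have k: "odd k" using d by (simp add: disc_parts_def)
  have mult: "?X (a * b) = ?X a * ?X b" for a b by (rule real_char_mult[OF k])
  have "odd_primitive_char D ?X" unfolding odd_primitive_char_def d(2)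
  proof (intro conjI allI impI)
    show "?X n \<in> {-1, 0, 1}" for n
      using two_part_values[of c k n] jacobi_values[of k n] by (auto simp: real_char_def)
  qed (use mult real_char_cong[OF d(1)] real_char_one real_char_minus_one[OF d(1)]
         real_char_zero_iff[OF d(1)] real_char_primitive[OF d(1)] in auto)
  moreover have "chi D n = ?X (int n)" for n
  proof (cases "n = 0")
    case True
    have "D \<noteq> 1" using D by (auto simp: neg_fund_disc_def fundamental_discriminant_def)
    moreover have "D > 0" using D by (simp add: neg_fund_disc_def)
    ultimately have "?X 0 = 0" using real_char_zero_iff[OF d(1), of 0] d(2) by simp
    thus ?thesis using True \<open>D \<noteq> 1\<close> by (simp add: chi_def kronecker_def)
  next
    case False
    hence "?X (int n) = (\<Prod>p\<in>prime_factors n. ?X (int p) ^ multiplicity p n)"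
      using completely_multiplicative_factorization[of ?X n] mult real_char_one by simp
    also have "\<dots> = (\<Prod>p\<in>prime_factors n. kronecker_prime (- int D) p ^ multiplicity p n)"
      unfolding d(2) by (intro prod.cong refl arg_cong2[where f = power] real_char_prime[OF d(1), symmetric])
        (auto simp: in_prime_factors_iff)
    finally show ?thesis using False by (simp add: chi_def kronecker_def)
  qed
  ultimately show ?thesis by blast
qed

section \<open>Uniqueness of Fourier coefficients\<close>

inductive trig_poly :: "(real \<Rightarrow> complex) \<Rightarrow> bool" where
  trig_basic: "trig_poly (\<lambda>a. c * cis (2 * pi * real_of_int m * a))"
| trig_add: "trig_poly p \<Longrightarrow> trig_poly q \<Longrightarrow> trig_poly (\<lambda>a. p a + q a)"

lemma trig_const: "trig_poly (\<lambda>a. c)"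
  using trig_basic[of c 0] by simp

lemma trig_mult:
  assumes "trig_poly p" "trig_poly q" shows "trig_poly (\<lambda>a. p a * q a)"
  using assms
proof (induction p rule: trig_poly.induct)
  case (trig_basic c m)
  from trig_basic show ?case
  proof (induction q rule: trig_poly.induct)
    case (trig_basic d n)
    have "(\<lambda>a. c * cis (2 * pi * real_of_int m * a) * (d * cis (2 * pi * real_of_int n * a)))
        = (\<lambda>a. (c * d) * cis (2 * pi * real_of_int (m + n) * a))"
      by (auto simp: cis_mult[symmetric] algebra_simps)
    thus ?case by (simp only: trig_poly.trig_basic)
  next
    case (trig_add p q)
    thus ?case by (simp add: distrib_left trig_poly.trig_add)
  qed
next
  case (trig_add p q')
  thus ?case by (simp add: distrib_right trig_poly.trig_add)
qed

lemma trig_real_polynomial: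
  fixes r :: "complex \<Rightarrow> real"
  assumes "real_polynomial_function r"
  shows "trig_poly (\<lambda>a. of_real (r (cis (2 * pi * a))))"
  using assms
proof (induction r rule: real_polynomial_function.induct)
  case (linear r)
  interpret bounded_linear r by fact
  have eq: "complex_of_real (r (cis t)) = ((of_real (r 1) - \<i> * of_real (r \<i>)) / 2) * cis t
      + ((of_real (r 1) + \<i> * of_real (r \<i>)) / 2) * cis (- t)" for t
  proof -
    have "cis t = cos t *\<^sub>R 1 + sin t *\<^sub>R \<i>" by (auto simp: complex_eq_iff)
    hence "r (cis t) = cos t * r 1 + sin t * r \<i>" using add scaleR by simp
    thus ?thesis by (simp add: complex_eq_iff field_simps)
  qed
  have "trig_poly (\<lambda>a. ((of_real (r 1) - \<i> * of_real (r \<i>)) / 2) * cis (2 * pi * real_of_int 1 * a)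
      + ((of_real (r 1) + \<i> * of_real (r \<i>)) / 2) * cis (2 * pi * real_of_int (- 1) * a))"
    by (intro trig_poly.intros)
  thus ?case unfolding eq by simp
next
  case (const c) show ?case by (rule trig_const)
qed (auto intro: trig_mult trig_poly.intros)

lemma trig_polynomial:
  fixes g :: "complex \<Rightarrow> complex"
  assumes g: "polynomial_function g"
  shows "trig_poly (\<lambda>a. g (cis (2 * pi * a)))"
proof -
  have "trig_poly (\<lambda>a. of_real (Re (g (cis (2 * pi * a)))))" "trig_poly (\<lambda>a. of_real (Im (g (cis (2 * pi * a)))))"
    using g trig_real_polynomial[of "Re \<circ> g"] trig_real_polynomial[of "Im \<circ> g"] bounded_linear_Re bounded_linear_Im
    unfolding polynomial_function_def by (auto simp: o_def)
  hence "trig_poly (\<lambda>a. of_real (Re (g (cis (2 * pi * a)))) + \<i> * of_real (Im (g (cis (2 * pi * a)))))"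
    by (intro trig_add trig_mult trig_const)
  thus ?thesis by (simp add: complex_eq[symmetric])
qed

lemma trig_continuous: "trig_poly p \<Longrightarrow> continuous_on A p"
  by (induction p rule: trig_poly.induct) (auto intro!: continuous_intros)

lemma periodic_of_int:
  fixes f :: "real \<Rightarrow> 'a"
  assumes "\<And>a. f (a + 1) = f a" shows "f (a + of_int n) = f a"
proof (induction n rule: int_induct[of _ 0])
  case (step1 i) thus ?case using assms[of "a + of_int i"] by (simp add: add.assoc)
next
  case (step2 i) thus ?case using assms[of "a + of_int i - 1"] by (simp add: algebra_simps)
qed simp

lemma cis_eq_imp_periodic_eq:
  fixes f :: "real \<Rightarrow> 'a"
  assumes per: "\<And>a. f (a + 1) = f a" and eq: "cis (2 * pi * a) = cis (2 * pi * b)"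
  shows "f a = f b"
proof -
  have "exp (\<i> * of_real (2 * pi * a)) = exp (\<i> * of_real (2 * pi * b))" using eq by (simp add: cis_conv_exp)
  then obtain n :: int where "\<i> * complex_of_real (2 * pi * a) = \<i> * of_real (2 * pi * b) + of_real (real_of_int (2 * n) * pi) * \<i>"
    unfolding exp_eq by blast
  hence "\<i> * complex_of_real (2 * pi * a) = \<i> * of_real (2 * pi * (b + of_int n))" by (simp add: algebra_simps)
  hence "complex_of_real (2 * pi * a) = of_real (2 * pi * (b + of_int n))" by (metis complex_i_not_zero mult_left_cancel)
  hence "a = b + of_int n" by (simp only: of_real_eq_iff) simp
  thus ?thesis using periodic_of_int[of f, OF per] by simp
qed

text \<open>The function on the circle is \<open>f (Arg z / (2 pi))\<close>. The principal argument is discontinuous on the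
  negative axis; there the argument of \<open>- z\<close>, shifted by half a period, gives the same function.\<close>
lemma periodic_descends_to_circle:
  fixes f :: "real \<Rightarrow> complex"
  assumes cont: "continuous_on UNIV f" and per: "\<And>a. f (a + 1) = f a"
  shows "\<exists>F. continuous_on (sphere 0 1) F \<and> (\<forall>a. F (cis (2 * pi * a)) = f a)"
proof -
  define F where "F z = f (Arg z / (2 * pi))" for z
  have F: "F z = f a" if "z = cis (2 * pi * a)" for z a
  proof -
    have "cis (Arg z) = z" using that by (subst cis_Arg) (auto simp: sgn_eq)
    hence "cis (2 * pi * (Arg z / (2 * pi))) = cis (2 * pi * a)" using that by simp
    thus ?thesis unfolding F_def by (rule cis_eq_imp_periodic_eq[of f, OF per])
  qed
  have isC: "isCont f a" for a using cont by (simp add: continuous_on_eq_continuous_at)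
  have "continuous_on (sphere 0 1) F"
    unfolding continuous_on_eq_continuous_within
  proof
    fix z :: complex assume z: "z \<in> sphere 0 1"
    show "continuous (at z within sphere 0 1) F"
    proof (cases "z \<in> \<real>\<^sub>\<le>\<^sub>0")
      case False
      have "isCont (\<lambda>z. f (Arg z / (2 * pi))) z"
        by (intro isCont_o2[OF _ isC] continuous_intros continuous_at_Arg False) auto
      thus ?thesis unfolding F_def[abs_def] by (rule continuous_at_imp_continuous_within)
    next
      case True
      have nz: "- z \<notin> \<real>\<^sub>\<le>\<^sub>0"
        using True z by (auto simp: complex_nonpos_Reals_iff complex_eq_iff cmod_def)
      define F' where "F' w = f (Arg (- w) / (2 * pi) + 1 / 2)" for w
      have "isCont (\<lambda>w. Arg (- w)) z"
        by (rule isCont_o2[where f = uminus and g = Arg, OF _ continuous_at_Arg[OF nz]]) (intro continuous_intros)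
      hence "isCont (\<lambda>w. Arg (- w) / (2 * pi) + 1 / 2) z" by (intro continuous_intros) auto
      hence "isCont F' z" unfolding F'_def[abs_def] by (rule isCont_o2[OF _ isC])
      hence cF': "continuous (at z within sphere 0 1) F'" by (rule continuous_at_imp_continuous_within)
      have FF: "F' w = F w" if w: "w \<in> sphere 0 1" for w
      proof -
        have "cis (Arg (- w)) = - w" using w by (subst cis_Arg) (auto simp: sgn_eq)
        hence "w = cis (Arg (- w) + pi)" by (simp add: cis_mult[symmetric])
        also have "Arg (- w) + pi = 2 * pi * (Arg (- w) / (2 * pi) + 1 / 2)" by (simp add: field_simps)
        finally have "F w = f (Arg (- w) / (2 * pi) + 1 / 2)" by (rule F)
        thus ?thesis by (simp only: F'_def)
      qed
      show ?thesis by (rule continuous_transform_within[OF cF' zero_less_one z]) (rule FF)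
    qed
  qed
  thus ?thesis using F by blast
qed

text \<open>By the Stone-Weierstrass theorem on the circle, the conjugate of \<open>f\<close> is a uniform limit of
  trigonometric polynomials, to which \<open>f\<close> is orthogonal; hence the integral of \<open>norm (f a)\<^sup>2\<close> is zero.\<close>
theorem fourier_uniqueness:
  fixes f :: "real \<Rightarrow> complex"
  assumes cont: "continuous_on UNIV f" and per: "\<And>a. f (a + 1) = f a"
    and zero: "\<And>m::int. integral {0..1} (\<lambda>a. f a * cis (2 * pi * real_of_int m * a)) = 0"
  shows "f a = 0"
proof -
  have cf: "continuous_on A f" for A using cont by (rule continuous_on_subset) auto
  have trig0: "integral {0..1} (\<lambda>a. f a * p a) = 0" if "trig_poly p" for p
    using that
  proof (induction p rule: trig_poly.induct)
    case (trig_basic c m)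
    have "(\<lambda>a. f a * (c * cis (2 * pi * real_of_int m * a))) = (\<lambda>a. c * (f a * cis (2 * pi * real_of_int m * a)))"
      by (simp add: mult_ac)
    thus ?case using zero[of m] by simp
  next
    case (trig_add p q)
    have "integral {0..1} (\<lambda>a. f a * p a + f a * q a) = integral {0..1} (\<lambda>a. f a * p a) + integral {0..1} (\<lambda>a. f a * q a)"
      by (intro Henstock_Kurzweil_Integration.integral_add integrable_continuous_interval continuous_intros cf trig_continuous trig_add)
    thus ?case using trig_add by (simp add: distrib_left)
  qed
  have "continuous_on UNIV (\<lambda>a. cnj (f a))" by (intro continuous_intros cf)
  then obtain F where F: "continuous_on (sphere 0 1) F" "\<And>a. F (cis (2 * pi * a)) = cnj (f a)"
    using periodic_descends_to_circle[of "\<lambda>a. cnj (f a)"] per by auto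
  have "bounded (f ` {0..1})"
    by (rule compact_imp_bounded[OF compact_continuous_image[OF cf[of "{0..1}"] compact_Icc]])
  then obtain M where "M > 0" "\<forall>x\<in>f ` {0..1}. norm x \<le> M" unfolding bounded_pos by blast
  hence M: "\<And>a. a \<in> {0..1} \<Longrightarrow> norm (f a) \<le> M" "M > 0" by auto
  let ?I = "integral {0..1} (\<lambda>a. f a * cnj (f a))"
  have "norm ?I \<le> e" if e: "e > 0" for e
  proof -
    obtain g where g: "polynomial_function g" "\<And>z. z \<in> sphere 0 1 \<Longrightarrow> norm (F z - g z) < e / M"
      using Stone_Weierstrass_polynomial_function[OF compact_sphere F(1), of "e / M"] e M(2) by auto
    define p where "p a = g (cis (2 * pi * a))" for a
    have tp: "trig_poly p" unfolding p_def by (rule trig_polynomial[OF g(1)])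
    have "?I = ?I - integral {0..1} (\<lambda>a. f a * p a)" using trig0[OF tp] by simp
    also have "\<dots> = integral {0..1} (\<lambda>a. f a * cnj (f a) - f a * p a)"
      by (intro Henstock_Kurzweil_Integration.integral_diff[symmetric] integrable_continuous_interval continuous_intros cf trig_continuous tp)
    also have "norm \<dots> \<le> e * (1 - 0)"
    proof (rule integral_bound)
      show "continuous_on {0..1} (\<lambda>a. f a * cnj (f a) - f a * p a)"
        by (intro continuous_intros cf trig_continuous tp)
      fix a :: real assume a: "a \<in> {0..1}"
      have "norm (f a * cnj (f a) - f a * p a) = norm (f a) * norm (cnj (f a) - p a)"
        by (simp add: norm_mult[symmetric] right_diff_distrib)
      also have "\<dots> \<le> M * (e / M)"
        using M(1)[OF a] g(2)[of "cis (2 * pi * a)"] F(2)[of a] M(2)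
        by (intro mult_mono) (auto simp: p_def)
      finally show "norm (f a * cnj (f a) - f a * p a) \<le> e" using M(2) by simp
    qed auto
    finally show ?thesis by simp
  qed
  hence "norm ?I \<le> 0 + e" if "e > 0" for e using that by simp
  hence "norm ?I \<le> 0" by (rule field_le_epsilon)
  hence "?I = 0" by simp
  moreover have "?I = of_real (integral {0..1} (\<lambda>a. (norm (f a))\<^sup>2))"
  proof -
    have "(\<lambda>a. f a * cnj (f a)) = (\<lambda>a. complex_of_real ((norm (f a))\<^sup>2))" by (simp only: complex_norm_square)
    moreover have "(\<lambda>a. (norm (f a))\<^sup>2) integrable_on {0..1}"
      by (intro integrable_continuous_interval continuous_intros cf)
    hence "((complex_of_real \<circ> (\<lambda>a. (norm (f a))\<^sup>2)) has_integral of_real (integral {0..1} (\<lambda>a. (norm (f a))\<^sup>2))) {0..1}"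
      by (intro has_integral_linear[OF _ bounded_linear_of_real] integrable_integral)
    hence "((\<lambda>a. complex_of_real ((norm (f a))\<^sup>2)) has_integral of_real (integral {0..1} (\<lambda>a. (norm (f a))\<^sup>2))) {0..1}"
      by (simp only: o_def)
    ultimately show ?thesis by (simp only: integral_unique)
  qed
  ultimately have I0: "integral {0..1} (\<lambda>a. (norm (f a))\<^sup>2) = 0" by simp
  have f0: "f b = 0" if "b \<in> {0..1}" for b
  proof -
    have "\<forall>a\<in>{0..1}. (norm (f a))\<^sup>2 = 0"
      using I0 by (subst integral_eq_0_iff[symmetric]) (auto intro!: continuous_intros cf)
    thus ?thesis using that by simp
  qed
  have "f a = f (frac a + of_int \<lfloor>a\<rfloor>)" by (simp add: frac_def)
  also have "\<dots> = f (frac a)" by (rule periodic_of_int[of f, OF per])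
  also have "\<dots> = 0" by (rule f0) (auto simp: frac_ge_0 less_imp_le[OF frac_lt_1])
  finally show ?thesis .
qed

section \<open>Poisson summation for the odd Gaussian\<close>

lemma summable_exp_minus_nat: "summable (\<lambda>n. exp (- real n))"
proof -
  have "(\<lambda>n. exp (- real n)) = (\<lambda>n. exp (-1) ^ n)"
    by (simp add: exp_of_nat_mult[symmetric])
  thus ?thesis by (simp add: summable_geometric)
qed

lemma summable_exp_minus_int: "(\<lambda>n::int. exp (- real_of_int \<bar>n\<bar>)) summable_on UNIV"
proof -
  have nat: "(\<lambda>n::nat. exp (- real n)) summable_on UNIV"
    using summable_exp_minus_nat by (simp add: summable_on_UNIV_nonneg_real_iff)
  have "(\<lambda>n::int. exp (- real_of_int \<bar>n\<bar>)) summable_on range int"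
    using nat by (subst summable_on_reindex) (auto simp: o_def inj_on_def)
  moreover have "(\<lambda>n::int. exp (- real_of_int \<bar>n\<bar>)) summable_on range (\<lambda>n. - int n)"
    using nat by (subst summable_on_reindex) (auto simp: o_def inj_on_def)
  ultimately have "(\<lambda>n::int. exp (- real_of_int \<bar>n\<bar>)) summable_on (range int \<union> range (\<lambda>n. - int n))"
    by (rule summable_on_union)
  moreover have "range int \<union> range (\<lambda>n. - int n) = UNIV"
  proof -
    have "n \<in> range int \<union> range (\<lambda>n. - int n)" for n by (cases n rule: int_cases2) auto
    thus ?thesis by blast
  qed
  ultimately show ?thesis by simp
qed

text \<open>Exponential decay in \<open>n\<close>, uniform on bounded sets of \<open>a\<close>, justifies every exchange of sums with
  limits and integrals below.\<close>
definition exp_dominated :: "(int \<Rightarrow> real \<Rightarrow> complex) \<Rightarrow> bool" where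
  "exp_dominated p \<longleftrightarrow> (\<forall>n. continuous_on UNIV (p n)) \<and>
     (\<forall>R. \<exists>K. \<forall>n a. \<bar>a\<bar> \<le> R \<longrightarrow> norm (p n a) \<le> K * exp (- real_of_int \<bar>n\<bar>))"

lemma exp_dominated_uniform_limit:
  assumes p: "exp_dominated p"
  shows "uniform_limit {-R..R} (\<lambda>X a. \<Sum>n\<in>X. p n a) (\<lambda>a. \<Sum>\<^sub>\<infinity>n. p n a) (finite_subsets_at_top UNIV)"
proof -
  obtain K where K: "\<And>n a. \<bar>a\<bar> \<le> R \<Longrightarrow> norm (p n a) \<le> K * exp (- real_of_int \<bar>n\<bar>)"
    using p unfolding exp_dominated_def by metis
  show ?thesis
  proof (rule Weierstrass_m_test_general)
    show "norm (p n a) \<le> K * exp (- real_of_int \<bar>n\<bar>)" if "a \<in> {-R..R}" for n a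
      using K that by (simp add: abs_le_iff)
    show "(\<lambda>n. K * exp (- real_of_int \<bar>n\<bar>)) summable_on UNIV"
      by (intro summable_on_cmult_right summable_exp_minus_int)
  qed
qed

lemma exp_dominated_continuous:
  assumes p: "exp_dominated p" shows "continuous_on UNIV (\<lambda>a. \<Sum>\<^sub>\<infinity>n. p n a)"
proof -
  have cR: "continuous_on {-R..R} (\<lambda>a. \<Sum>\<^sub>\<infinity>n. p n a)" for R
  proof (rule uniform_limit_theorem[OF _ exp_dominated_uniform_limit[OF p]])
    show "\<forall>\<^sub>F X in finite_subsets_at_top UNIV. continuous_on {-R..R} (\<lambda>a. \<Sum>n\<in>X. p n a)"
      using p unfolding exp_dominated_def
      by (intro always_eventually allI continuous_on_sum) (meson continuous_on_subset subset_UNIV)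
  qed simp
  have "continuous_on {-R<..<R} (\<lambda>a. \<Sum>\<^sub>\<infinity>n. p n a)" for R
    by (rule continuous_on_subset[OF cR[of R]]) auto
  hence "continuous_on (\<Union>R\<in>UNIV. {-R<..<R}) (\<lambda>a. \<Sum>\<^sub>\<infinity>n. p n a)"
    by (intro continuous_on_open_UN) auto
  moreover have "(\<Union>R\<in>UNIV. {-R<..<R}) = (UNIV :: real set)"
  proof -
    have "a \<in> {- (\<bar>a\<bar> + 1)<..<\<bar>a\<bar> + 1}" for a :: real by auto
    thus ?thesis by blast
  qed
  ultimately show ?thesis by simp
qed

lemma exp_dominated_integral:
  assumes p: "exp_dominated p"
  shows "((\<lambda>n. integral {0..1} (p n)) has_sum integral {0..1} (\<lambda>a. \<Sum>\<^sub>\<infinity>n. p n a)) UNIV"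
proof -
  have cp: "continuous_on {0..1} (p n)" for n
    using p unfolding exp_dominated_def by (meson continuous_on_subset subset_UNIV)
  have ul: "uniform_limit {0..1} (\<lambda>X a. \<Sum>n\<in>X. p n a) (\<lambda>a. \<Sum>\<^sub>\<infinity>n. p n a) (finite_subsets_at_top UNIV)"
    by (rule uniform_limit_on_subset[OF exp_dominated_uniform_limit[OF p, of 1]]) auto
  have cs: "continuous_on {0..1} (\<lambda>a. \<Sum>n\<in>X. p n a)" for X by (intro continuous_on_sum cp)
  obtain I J where IJ: "\<And>X. ((\<lambda>a. \<Sum>n\<in>X. p n a) has_integral I X) {0..1}"
      "((\<lambda>a. \<Sum>\<^sub>\<infinity>n. p n a) has_integral J) {0..1}" "(I \<longlongrightarrow> J) (finite_subsets_at_top UNIV)"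
    using uniform_limit_integral[OF ul cs finite_subsets_at_top_neq_bot] by blast
  have "I X = (\<Sum>n\<in>X. integral {0..1} (p n))" if "finite X" for X
  proof -
    have "I X = integral {0..1} (\<lambda>a. \<Sum>n\<in>X. p n a)" by (rule integral_unique[OF IJ(1), symmetric])
    also have "\<dots> = (\<Sum>n\<in>X. integral {0..1} (p n))"
      by (rule integral_sum[OF that]) (rule integrable_continuous_interval[OF cp])
    finally show ?thesis .
  qed
  hence "((\<lambda>X. \<Sum>n\<in>X. integral {0..1} (p n)) \<longlongrightarrow> J) (finite_subsets_at_top UNIV)"
    by (intro Lim_transform_eventually[OF IJ(3)] eventually_finite_subsets_at_top_weakI) simp
  thus ?thesis unfolding has_sum_def using IJ(2) by (simp add: integral_unique)
qed

lemma integral_cis: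
  fixes k :: int
  shows "integral {0..1} (\<lambda>a. cis (2 * pi * real_of_int k * a)) = (if k = 0 then 1 else 0)"
proof (cases "k = 0")
  case False
  define c where "c = \<i> * of_real (2 * pi * real_of_int k)"
  have c: "c \<noteq> 0" using False by (simp add: c_def)
  have "((\<lambda>a. exp (c * of_real a)) has_integral (exp (c * of_real 1) / c - exp (c * of_real 0) / c)) {0..1}"
  proof (rule fundamental_theorem_of_calculus)
    fix a :: real
    have "((\<lambda>z. exp (c * z) / c) has_field_derivative exp (c * of_real a)) (at (of_real a))"
      using c by (auto intro!: derivative_eq_intros)
    hence "((\<lambda>a. exp (c * of_real a) / c) has_vector_derivative exp (c * of_real a)) (at a)"
      by (rule has_vector_derivative_real_field)
    thus "((\<lambda>a. exp (c * of_real a) / c) has_vector_derivative exp (c * of_real a)) (at a within {0..1})"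
      by (rule has_vector_derivative_at_within)
  qed simp
  moreover have "exp c = 1"
  proof -
    have "c = of_int (2 * k) * of_real pi * \<i>" by (simp add: c_def mult_ac)
    thus ?thesis by (simp only: exp_eq_1) (auto simp: c_def)
  qed
  moreover have "(\<lambda>a. exp (c * of_real a)) = (\<lambda>a. cis (2 * pi * real_of_int k * a))"
    by (simp add: c_def cis_conv_exp mult_ac)
  ultimately show ?thesis using False by (simp add: integral_unique)
qed simp

lemma cis_int_period: "cis (2 * pi * real_of_int m * (a + real_of_int n)) = cis (2 * pi * real_of_int m * a)"
proof -
  have "2 * pi * real_of_int m * (a + real_of_int n) = 2 * pi * real_of_int m * a + 2 * pi * real_of_int (m * n)"
    by (simp add: algebra_simps)
  moreover have "cis (2 * pi * real_of_int (m * n)) = 1" by (rule cis_multiple_2pi) simp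
  ultimately show ?thesis by (simp only: cis_mult[symmetric] mult_1_right)
qed

lemma sum_shifted_integrals:
  fixes Q :: "real \<Rightarrow> complex"
  assumes Q: "continuous_on UNIV Q"
  shows "(\<Sum>n\<in>{- int N..<int N}. integral {0..1} (\<lambda>a. Q (a + real_of_int n))) = integral {- real N..real N} Q"
proof (induction N)
  case (Suc N)
  have int: "Q integrable_on {a..b}" for a b
    by (intro integrable_continuous_interval continuous_on_subset[OF Q]) auto
  have sh: "integral {0..1} (\<lambda>a. Q (a + c)) = integral {c..c + 1} Q" for c
    using integral_shift_Icc_real[of 0 1 Q c] by (simp add: add.commute o_def)
  have "{- int (Suc N)..<int (Suc N)} = insert (- int (Suc N)) (insert (int N) {- int N..<int N})" by auto
  hence "(\<Sum>n\<in>{- int (Suc N)..<int (Suc N)}. integral {0..1} (\<lambda>a. Q (a + real_of_int n)))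
     = integral {- real (Suc N)..- real N} Q + (integral {real N..real N + 1} Q + integral {- real N..real N} Q)"
    using Suc sh[of "- real (Suc N)"] sh[of "real N"] by simp
  also have "\<dots> = integral {- real (Suc N)..- real N} Q + integral {- real N..real N + 1} Q"
    using Henstock_Kurzweil_Integration.integral_combine[of "- real N" "real N" "real N + 1" Q] int by (simp add: add.commute)
  also have "\<dots> = integral {- real (Suc N)..real N + 1} Q"
    by (rule Henstock_Kurzweil_Integration.integral_combine) (use int in auto)
  finally show ?case by (simp add: add.commute)
qed simp

lemma has_sum_symmetric_limit:
  fixes f :: "int \<Rightarrow> complex"
  assumes "(f has_sum S) UNIV" shows "(\<lambda>N. \<Sum>n\<in>{- int N..<int N}. f n) \<longlonglongrightarrow> S"
proof -
  have "filterlim (\<lambda>N. {- int N..<int N}) (finite_subsets_at_top UNIV) sequentially"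
    unfolding filterlim_finite_subsets_at_top
  proof (intro allI impI)
    fix X :: "int set" assume X: "finite X \<and> X \<subseteq> UNIV"
    obtain B where B: "\<And>x. x \<in> X \<Longrightarrow> \<bar>x\<bar> \<le> B"
    proof -
      have "bdd_above (abs ` X)" using X by (intro bdd_above_finite) auto
      thus ?thesis using that unfolding bdd_above_def by auto
    qed
    show "\<forall>\<^sub>F N in sequentially. finite {- int N..<int N} \<and> X \<subseteq> {- int N..<int N} \<and> {- int N..<int N} \<subseteq> UNIV"
      using eventually_gt_at_top[of "nat B"]
    proof eventually_elim
      case (elim N)
      have "x \<in> {- int N..<int N}" if "x \<in> X" for x using B[OF that] elim by auto
      thus ?case by auto
    qed
  qed
  from filterlim_compose[OF assms[unfolded has_sum_def] this] show ?thesis .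
qed

text \<open>Completing the square: \<open>2 \<bar>y\<bar> \<le> c y\<^sup>2 + 1 / c\<close>.\<close>
lemma linear_gauss_bound:
  fixes c y :: real
  assumes c: "c > 0" shows "\<bar>y\<bar> * exp (- c * y\<^sup>2) \<le> exp (1 / c) * exp (- \<bar>y\<bar>)"
proof -
  have "0 \<le> (c * \<bar>y\<bar> - 1)\<^sup>2 / c" using c by simp
  also have "\<dots> = c * y\<^sup>2 - 2 * \<bar>y\<bar> + 1 / c"
    using c by (simp add: power2_eq_square field_simps)
  finally have e: "\<bar>y\<bar> + - c * y\<^sup>2 \<le> 1 / c + - \<bar>y\<bar>" by simp
  have "\<bar>y\<bar> \<le> exp \<bar>y\<bar>" using exp_ge_add_one_self[of "\<bar>y\<bar>"] by linarith
  hence "\<bar>y\<bar> * exp (- c * y\<^sup>2) \<le> exp \<bar>y\<bar> * exp (- c * y\<^sup>2)" by (rule mult_right_mono) simp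
  also have "\<dots> = exp (\<bar>y\<bar> + - c * y\<^sup>2)" by (rule exp_add[symmetric])
  also have "\<dots> \<le> exp (1 / c + - \<bar>y\<bar>)" using e by simp
  also have "\<dots> = exp (1 / c) * exp (- \<bar>y\<bar>)" by (rule exp_add)
  finally show ?thesis .
qed

text \<open>The odd Gaussian \<open>y exp (- pi x y\<^sup>2)\<close> is used because the character is odd, so that the theta series
  with the even Gaussian would vanish.\<close>
definition odd_gauss :: "real \<Rightarrow> real \<Rightarrow> complex" where
  "odd_gauss x y = of_real (y * exp (- (pi * x) * y\<^sup>2))"

text \<open>The Fourier transform of \<open>odd_gauss x\<close> at the integer \<open>m\<close>.\<close>
definition odd_gauss_dual :: "real \<Rightarrow> int \<Rightarrow> complex" where
  "odd_gauss_dual x m = - \<i> * of_real (real_of_int m * exp (- (pi / x) * (real_of_int m)\<^sup>2) / (x * sqrt x))"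

lemma odd_gauss_exp_dominated:
  assumes x: "x > 0"
  shows "exp_dominated (\<lambda>n a. odd_gauss x (a + real_of_int n) * cis (2 * pi * real_of_int m * a))"
  unfolding exp_dominated_def
proof (intro conjI allI)
  show "continuous_on UNIV (\<lambda>a. odd_gauss x (a + real_of_int n) * cis (2 * pi * real_of_int m * a))" for n
    unfolding odd_gauss_def by (intro continuous_intros)
  fix R
  show "\<exists>K. \<forall>n a. \<bar>a\<bar> \<le> R \<longrightarrow>
     norm (odd_gauss x (a + real_of_int n) * cis (2 * pi * real_of_int m * a)) \<le> K * exp (- real_of_int \<bar>n\<bar>)"
  proof (intro exI allI impI)
    fix n a assume a: "\<bar>a\<bar> \<le> R"
    have "norm (odd_gauss x (a + real_of_int n) * cis (2 * pi * real_of_int m * a)) =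
       \<bar>a + real_of_int n\<bar> * exp (- (pi * x) * (a + real_of_int n)\<^sup>2)"
      unfolding odd_gauss_def norm_mult norm_cis norm_of_real abs_mult by simp
    also have "\<dots> \<le> exp (1 / (pi * x)) * exp (- \<bar>a + real_of_int n\<bar>)"
      by (rule linear_gauss_bound) (use x in simp)
    also have "\<dots> \<le> exp (1 / (pi * x)) * exp (R + - real_of_int \<bar>n\<bar>)"
      using a by (intro mult_left_mono) auto
    also have "\<dots> = exp (1 / (pi * x)) * exp R * exp (- real_of_int \<bar>n\<bar>)" by (simp only: exp_add mult.assoc)
    finally show "norm (odd_gauss x (a + real_of_int n) * cis (2 * pi * real_of_int m * a))
       \<le> exp (1 / (pi * x)) * exp R * exp (- real_of_int \<bar>n\<bar>)" .
  qed
qed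

lemma norm_odd_gauss_dual:
  assumes x: "x > 0"
  shows "norm (odd_gauss_dual x n) \<le> exp (1 / (pi / x)) / (x * sqrt x) * exp (- real_of_int \<bar>n\<bar>)"
proof -
  have "norm (odd_gauss_dual x n) = (\<bar>real_of_int n\<bar> * exp (- (pi / x) * (real_of_int n)\<^sup>2)) / (x * sqrt x)"
    unfolding odd_gauss_dual_def norm_mult norm_of_real abs_divide abs_mult using x by simp
  also have "\<dots> \<le> (exp (1 / (pi / x)) * exp (- \<bar>real_of_int n\<bar>)) / (x * sqrt x)"
    by (intro divide_right_mono linear_gauss_bound) (use x in auto)
  finally show ?thesis by simp
qed

lemma odd_gauss_dual_exp_dominated:
  assumes x: "x > 0"
  shows "exp_dominated (\<lambda>n a. odd_gauss_dual x n * cis (2 * pi * real_of_int n * a) * cis (2 * pi * real_of_int m * a))"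
  unfolding exp_dominated_def
proof (intro conjI allI)
  show "continuous_on UNIV (\<lambda>a. odd_gauss_dual x n * cis (2 * pi * real_of_int n * a) * cis (2 * pi * real_of_int m * a))" for n
    by (intro continuous_intros)
  show "\<exists>K. \<forall>n a. \<bar>a\<bar> \<le> R \<longrightarrow>
     norm (odd_gauss_dual x n * cis (2 * pi * real_of_int n * a) * cis (2 * pi * real_of_int m * a)) \<le> K * exp (- real_of_int \<bar>n\<bar>)" for R
    unfolding norm_mult norm_cis mult_1_right using norm_odd_gauss_dual[OF x] by blast
qed

text \<open>A linear substitution reduces this to the characteristic function of the standard normal
  distribution.\<close>
lemma gauss_fourier_integral:
  assumes x: "x > 0"
  shows "integrable lborel (\<lambda>y. of_real (exp (- (pi * x) * y\<^sup>2)) * cis (2 * pi * t * y))"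
    and "(LINT y|lborel. of_real (exp (- (pi * x) * y\<^sup>2)) * cis (2 * pi * t * y)) = of_real (exp (- (pi / x) * t\<^sup>2) / sqrt x)"
proof -
  define s where "s = sqrt (2 * pi * x)"
  have s: "s > 0" "s\<^sup>2 = 2 * pi * x" using x by (auto simp: s_def)
  define w where "w = 2 * pi * t / s"
  let ?f = "\<lambda>y. std_normal_density y *\<^sub>R iexp (w * y)"
  have i1: "integrable lborel ?f"
  proof (rule Bochner_Integration.integrable_bound)
    show "integrable lborel std_normal_density" by (rule integrable_normal_density) simp
  qed (auto simp: norm_mult)
  have v1: "(LINT y|lborel. ?f y) = of_real (exp (- (w\<^sup>2) / 2))"
  proof -
    have "char std_normal_distribution w = (LINT y|lborel. ?f y)"
      unfolding char_def by (subst integral_density) auto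
    thus ?thesis unfolding char_std_normal_distribution by simp
  qed
  have pt: "?f (0 + s * y) = of_real (1 / sqrt (2 * pi)) * (of_real (exp (- (pi * x) * y\<^sup>2)) * cis (2 * pi * t * y))" for y
  proof -
    have "- (s * y)\<^sup>2 / 2 = - (pi * x) * y\<^sup>2" using s(2) by (simp add: power_mult_distrib)
    hence 1: "std_normal_density (0 + s * y) = 1 / sqrt (2 * pi) * exp (- (pi * x) * y\<^sup>2)"
      unfolding std_normal_density_def by (simp only: add_0)
    have "w * (0 + s * y) = 2 * pi * t * y" using s(1) by (simp add: w_def)
    hence 2: "iexp (w * (0 + s * y)) = cis (2 * pi * t * y)" by (simp only: cis_conv_exp)
    show ?thesis unfolding 1 2 by (simp only: scaleR_conv_of_real of_real_mult mult.assoc)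
  qed
  have i2: "integrable lborel (\<lambda>y. ?f (0 + s * y))"
    by (rule lborel_integrable_real_affine[OF i1]) (use s in simp)
  hence "integrable lborel (\<lambda>y. of_real (sqrt (2 * pi)) * ?f (0 + s * y))" by (rule integrable_mult_right)
  moreover have eq: "(\<lambda>y. of_real (sqrt (2 * pi)) * ?f (0 + s * y)) = (\<lambda>y. of_real (exp (- (pi * x) * y\<^sup>2)) * cis (2 * pi * t * y))"
  proof -
    have "complex_of_real (sqrt (2 * pi)) * of_real (1 / sqrt (2 * pi)) = 1"
      unfolding of_real_mult[symmetric] by simp
    thus ?thesis unfolding pt by (simp only: mult.assoc[symmetric] mult_1_left)
  qed
  ultimately show "integrable lborel (\<lambda>y. of_real (exp (- (pi * x) * y\<^sup>2)) * cis (2 * pi * t * y))" by simp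
  have "(LINT y|lborel. of_real (exp (- (pi * x) * y\<^sup>2)) * cis (2 * pi * t * y)) = of_real (sqrt (2 * pi)) * (LINT y|lborel. ?f (0 + s * y))"
    unfolding eq[symmetric] by (rule Bochner_Integration.integral_mult_right_zero)
  also have "(LINT y|lborel. ?f (0 + s * y)) = of_real (exp (- (w\<^sup>2) / 2)) / of_real s"
    using lborel_integral_real_affine[of s ?f 0] s(1) v1 by (simp add: scaleR_conv_of_real field_simps)
  also have "of_real (sqrt (2 * pi)) * (of_real (exp (- (w\<^sup>2) / 2)) / complex_of_real s) = of_real (exp (- (w\<^sup>2) / 2) * (sqrt (2 * pi) / s))"
    by simp
  also have "sqrt (2 * pi) / s = 1 / sqrt x" using x by (simp add: s_def real_sqrt_mult)
  also have "- (w\<^sup>2) / 2 = - (pi / x) * t\<^sup>2"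
    unfolding w_def power_divide s(2) using x by (simp add: power2_eq_square field_simps)
  finally show "(LINT y|lborel. of_real (exp (- (pi * x) * y\<^sup>2)) * cis (2 * pi * t * y)) = of_real (exp (- (pi / x) * t\<^sup>2) / sqrt x)"
    by simp
qed

lemma gauss_fourier_limit:
  assumes x: "x > 0"
  shows "(\<lambda>N. integral {- real N..real N} (\<lambda>y. of_real (exp (- (pi * x) * y\<^sup>2)) * cis (2 * pi * t * y)))
     \<longlonglongrightarrow> of_real (exp (- (pi / x) * t\<^sup>2) / sqrt x)"
proof -
  let ?g = "\<lambda>y. complex_of_real (exp (- (pi * x) * y\<^sup>2)) * cis (2 * pi * t * y)"
  have "(\<lambda>N. LINT y|lborel. indicat_real {- real N..real N} y *\<^sub>R ?g y) \<longlonglongrightarrow> (LINT y|lborel. ?g y)"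
  proof (rule integral_dominated_convergence)
    show "integrable lborel (\<lambda>y. norm (?g y))" using gauss_fourier_integral(1)[OF x] by (rule integrable_norm)
    show m: "?g \<in> borel_measurable lborel" using gauss_fourier_integral(1)[OF x] by (rule borel_measurable_integrable)
    show "(\<lambda>y. indicat_real {- real N..real N} y *\<^sub>R ?g y) \<in> borel_measurable lborel" for N
      using m by measurable
    show "AE y in lborel. (\<lambda>N. indicat_real {- real N..real N} y *\<^sub>R ?g y) \<longlonglongrightarrow> ?g y"
    proof (rule AE_I2)
      fix y :: real
      have "\<forall>\<^sub>F N in sequentially. ?g y = indicat_real {- real N..real N} y *\<^sub>R ?g y"
        using eventually_ge_at_top[of "nat \<lceil>\<bar>y\<bar>\<rceil>"]
      proof eventually_elim
        case (elim N)
        hence "y \<in> {- real N..real N}" by (auto simp: abs_le_iff)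
        thus ?case by simp
      qed
      thus "(\<lambda>N. indicat_real {- real N..real N} y *\<^sub>R ?g y) \<longlonglongrightarrow> ?g y"
        by (rule Lim_transform_eventually[OF tendsto_const])
    qed
    show "AE y in lborel. norm (indicat_real {- real N..real N} y *\<^sub>R ?g y) \<le> norm (?g y)" for N
      by (rule AE_I2) (auto simp: indicator_def)
  qed
  moreover have "(LINT y|lborel. indicat_real {- real N..real N} y *\<^sub>R ?g y) = integral {- real N..real N} ?g" for N
  proof -
    have "set_integrable lborel {- real N..real N} ?g"
      by (rule borel_integrable_atLeastAtMost') (intro continuous_intros)
    from set_borel_integral_eq_integral(2)[OF this] show ?thesis by (simp add: set_lebesgue_integral_def)
  qed
  ultimately show ?thesis unfolding gauss_fourier_integral(2)[OF x] by simp
qed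

text \<open>Integration by parts: the odd Gaussian is, up to a constant factor, the derivative of the even one.\<close>
lemma odd_gauss_fourier_limit:
  assumes x: "x > 0"
  shows "(\<lambda>N. integral {- real N..real N} (\<lambda>y. odd_gauss x y * cis (2 * pi * real_of_int m * y)))
     \<longlonglongrightarrow> odd_gauss_dual x (- m)"
proof -
  let ?P = "\<lambda>y. complex_of_real (exp (- (pi * x) * y\<^sup>2)) * cis (2 * pi * real_of_int m * y)"
  let ?Q = "\<lambda>y. odd_gauss x y * cis (2 * pi * real_of_int m * y)"
  have cP: "continuous_on A ?P" and cQ: "continuous_on A ?Q" for A
    unfolding odd_gauss_def by (intro continuous_intros)+
  have D: "(?P has_vector_derivative (- of_real (2 * pi * x) * ?Q y + \<i> * of_real (2 * pi * real_of_int m) * ?P y)) (at y within A)" for y A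
  proof -
    have "((\<lambda>z. exp (- of_real (pi * x) * z\<^sup>2) * exp (\<i> * of_real (2 * pi * real_of_int m) * z)) has_field_derivative
      (- of_real (2 * pi * x) * (of_real y * exp (- of_real (pi * x) * (of_real y)\<^sup>2) * exp (\<i> * of_real (2 * pi * real_of_int m) * of_real y))
       + \<i> * of_real (2 * pi * real_of_int m) * (exp (- of_real (pi * x) * (of_real y)\<^sup>2) * exp (\<i> * of_real (2 * pi * real_of_int m) * of_real y)))) (at (of_real y))"
      by (auto intro!: derivative_eq_intros simp: algebra_simps)
    hence "((\<lambda>y. exp (- of_real (pi * x) * (of_real y)\<^sup>2) * exp (\<i> * of_real (2 * pi * real_of_int m) * of_real y)) has_vector_derivative
      (- of_real (2 * pi * x) * (of_real y * exp (- of_real (pi * x) * (of_real y)\<^sup>2) * exp (\<i> * of_real (2 * pi * real_of_int m) * of_real y))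
       + \<i> * of_real (2 * pi * real_of_int m) * (exp (- of_real (pi * x) * (of_real y)\<^sup>2) * exp (\<i> * of_real (2 * pi * real_of_int m) * of_real y)))) (at y)"
      by (rule has_vector_derivative_real_field)
    moreover have "exp (- of_real (pi * x) * (complex_of_real y)\<^sup>2) * exp (\<i> * of_real (2 * pi * real_of_int m) * of_real y) = ?P y" for y
      by (simp add: cis_conv_exp exp_of_real[symmetric] mult.assoc)
    moreover have "of_real y * exp (- of_real (pi * x) * (complex_of_real y)\<^sup>2) * exp (\<i> * of_real (2 * pi * real_of_int m) * of_real y) = ?Q y"
      by (simp add: cis_conv_exp exp_of_real[symmetric] mult.assoc odd_gauss_def)
    ultimately show ?thesis by (simp only: has_vector_derivative_at_within)
  qed
  have parts: "integral {- real N..real N} ?Q =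
     (\<i> * of_real (2 * pi * real_of_int m) * integral {- real N..real N} ?P - (?P (real N) - ?P (- real N))) / of_real (2 * pi * x)" for N
  proof -
    have "((\<lambda>y. - of_real (2 * pi * x) * ?Q y + \<i> * of_real (2 * pi * real_of_int m) * ?P y) has_integral (?P (real N) - ?P (- real N))) {- real N..real N}"
      by (rule fundamental_theorem_of_calculus[OF _ D]) simp
    moreover have "((\<lambda>y. - of_real (2 * pi * x) * ?Q y + \<i> * of_real (2 * pi * real_of_int m) * ?P y) has_integral
       (- of_real (2 * pi * x) * integral {- real N..real N} ?Q + \<i> * of_real (2 * pi * real_of_int m) * integral {- real N..real N} ?P)) {- real N..real N}"
      by (intro has_integral_add has_integral_mult_right integrable_integral integrable_continuous_interval cP cQ)
    ultimately have "?P (real N) - ?P (- real N) = - of_real (2 * pi * x) * integral {- real N..real N} ?Q + \<i> * of_real (2 * pi * real_of_int m) * integral {- real N..real N} ?P"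
      by (rule has_integral_unique)
    thus ?thesis using x by (simp add: field_simps)
  qed
  have P0: "(\<lambda>N. ?P (c * real N)) \<longlonglongrightarrow> 0" if "c = 1 \<or> c = -1" for c
  proof (rule tendsto_norm_zero_cancel)
    have "((\<lambda>y. exp (- (pi * x) * y\<^sup>2)) \<longlongrightarrow> 0) at_top" using x by real_asymp
    hence "(\<lambda>N. exp (- (pi * x) * (real N)\<^sup>2)) \<longlonglongrightarrow> 0"
      by (rule filterlim_compose) (rule filterlim_real_sequentially)
    thus "(\<lambda>N. norm (?P (c * real N))) \<longlonglongrightarrow> 0" using that by (auto simp: norm_mult)
  qed
  have "(\<lambda>N. (\<i> * of_real (2 * pi * real_of_int m) * integral {- real N..real N} ?P - (?P (1 * real N) - ?P (-1 * real N))) / of_real (2 * pi * x))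
    \<longlonglongrightarrow> (\<i> * of_real (2 * pi * real_of_int m) * of_real (exp (- (pi / x) * (real_of_int m)\<^sup>2) / sqrt x) - (0 - 0)) / of_real (2 * pi * x)"
    by (intro tendsto_divide tendsto_diff tendsto_mult tendsto_const gauss_fourier_limit[OF x] P0) (use x in auto)
  moreover have "(\<i> * of_real (2 * pi * real_of_int m) * of_real (exp (- (pi / x) * (real_of_int m)\<^sup>2) / sqrt x) - (0 - 0)) / of_real (2 * pi * x)
     = odd_gauss_dual x (- m)"
    using x by (simp add: odd_gauss_dual_def field_simps)
  ultimately show ?thesis unfolding parts by simp
qed

text \<open>Both sides are continuous and 1-periodic in \<open>a\<close>, and they have the same Fourier coefficients: on the
  left the integrals over the translates of \<open>{0..1}\<close> join to the integral over the line.\<close>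
theorem poisson_odd_gauss:
  assumes x: "x > 0"
  shows "(\<Sum>\<^sub>\<infinity>n. odd_gauss x (a + real_of_int n)) = (\<Sum>\<^sub>\<infinity>n. odd_gauss_dual x n * cis (2 * pi * real_of_int n * a))"
proof -
  define f where "f a = (\<Sum>\<^sub>\<infinity>n. odd_gauss x (a + real_of_int n))" for a
  define G where "G a = (\<Sum>\<^sub>\<infinity>n. odd_gauss_dual x n * cis (2 * pi * real_of_int n * a))" for a
  have ed1: "exp_dominated (\<lambda>n a. odd_gauss x (a + real_of_int n) * cis (2 * pi * real_of_int m * a))" for m
    by (rule odd_gauss_exp_dominated[OF x])
  have ed2: "exp_dominated (\<lambda>n a. odd_gauss_dual x n * cis (2 * pi * real_of_int n * a) * cis (2 * pi * real_of_int m * a))" for m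
    by (rule odd_gauss_dual_exp_dominated[OF x])
  have cf: "continuous_on UNIV f" using exp_dominated_continuous[OF ed1[of 0]] by (simp add: f_def)
  have cG: "continuous_on UNIV G" using exp_dominated_continuous[OF ed2[of 0]] by (simp add: G_def)
  have perf: "f (a + 1) = f a" for a
  proof -
    have "f (a + 1) = (\<Sum>\<^sub>\<infinity>n. odd_gauss x (a + real_of_int (n + 1)))" by (simp add: f_def add_ac)
    also have "\<dots> = f a" unfolding f_def
      by (rule infsum_reindex_bij_betw[of "\<lambda>n. n + 1" UNIV UNIV "\<lambda>n. odd_gauss x (a + real_of_int n)"])
         (auto intro!: bij_betwI[of _ _ _ "\<lambda>n. n - 1"])
    finally show ?thesis .
  qed
  have perG: "G (a + 1) = G a" for a
    unfolding G_def using cis_int_period[of _ a 1] by simp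
  have If: "integral {0..1} (\<lambda>a. f a * cis (2 * pi * real_of_int m * a)) = odd_gauss_dual x (- m)" for m
  proof -
    let ?Q = "\<lambda>y. odd_gauss x y * cis (2 * pi * real_of_int m * y)"
    have cQ: "continuous_on UNIV ?Q" unfolding odd_gauss_def by (intro continuous_intros)
    have "((\<lambda>n. integral {0..1} (\<lambda>a. odd_gauss x (a + real_of_int n) * cis (2 * pi * real_of_int m * a))) has_sum
       integral {0..1} (\<lambda>a. \<Sum>\<^sub>\<infinity>n. odd_gauss x (a + real_of_int n) * cis (2 * pi * real_of_int m * a))) UNIV"
      by (rule exp_dominated_integral[OF ed1])
    moreover have "(\<lambda>a. \<Sum>\<^sub>\<infinity>n. odd_gauss x (a + real_of_int n) * cis (2 * pi * real_of_int m * a)) = (\<lambda>a. f a * cis (2 * pi * real_of_int m * a))"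
      unfolding f_def by (subst infsum_cmult_left') simp
    moreover have "(\<lambda>a. odd_gauss x (a + real_of_int n) * cis (2 * pi * real_of_int m * a)) = (\<lambda>a. ?Q (a + real_of_int n))" for n
      by (simp only: cis_int_period)
    ultimately have "((\<lambda>n. integral {0..1} (\<lambda>a. ?Q (a + real_of_int n))) has_sum integral {0..1} (\<lambda>a. f a * cis (2 * pi * real_of_int m * a))) UNIV"
      by (simp only:)
    from has_sum_symmetric_limit[OF this]
    have "(\<lambda>N. integral {- real N..real N} ?Q) \<longlonglongrightarrow> integral {0..1} (\<lambda>a. f a * cis (2 * pi * real_of_int m * a))"
      unfolding sum_shifted_integrals[OF cQ] .
    thus ?thesis using odd_gauss_fourier_limit[OF x, of m] LIMSEQ_unique by blast
  qed
  have IG: "integral {0..1} (\<lambda>a. G a * cis (2 * pi * real_of_int m * a)) = odd_gauss_dual x (- m)" for m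
  proof -
    have "((\<lambda>n. integral {0..1} (\<lambda>a. odd_gauss_dual x n * cis (2 * pi * real_of_int n * a) * cis (2 * pi * real_of_int m * a))) has_sum
       integral {0..1} (\<lambda>a. \<Sum>\<^sub>\<infinity>n. odd_gauss_dual x n * cis (2 * pi * real_of_int n * a) * cis (2 * pi * real_of_int m * a))) UNIV"
      by (rule exp_dominated_integral[OF ed2])
    moreover have "(\<lambda>a. \<Sum>\<^sub>\<infinity>n. odd_gauss_dual x n * cis (2 * pi * real_of_int n * a) * cis (2 * pi * real_of_int m * a)) = (\<lambda>a. G a * cis (2 * pi * real_of_int m * a))"
      unfolding G_def by (subst infsum_cmult_left') simp
    moreover have "integral {0..1} (\<lambda>a. odd_gauss_dual x n * cis (2 * pi * real_of_int n * a) * cis (2 * pi * real_of_int m * a))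
       = (if n = - m then odd_gauss_dual x (- m) else 0)" for n
    proof -
      have "(\<lambda>a. odd_gauss_dual x n * cis (2 * pi * real_of_int n * a) * cis (2 * pi * real_of_int m * a))
         = (\<lambda>a. odd_gauss_dual x n * cis (2 * pi * real_of_int (n + m) * a))"
        by (rule ext) (simp add: mult.assoc cis_mult algebra_simps)
      thus ?thesis using integral_cis[of "n + m"] by (auto simp: add_eq_0_iff2)
    qed
    ultimately have "((\<lambda>n. if n = - m then odd_gauss_dual x (- m) else 0) has_sum integral {0..1} (\<lambda>a. G a * cis (2 * pi * real_of_int m * a))) UNIV"
      by (simp only:)
    moreover have "((\<lambda>n. if n = - m then odd_gauss_dual x (- m) else 0) has_sum odd_gauss_dual x (- m)) UNIV"
      by (rule has_sum_finite_neutralI[of "{- m}"]) auto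
    ultimately show ?thesis using has_sum_unique by blast
  qed
  have "f a - G a = 0"
  proof (rule fourier_uniqueness[of "\<lambda>a. f a - G a"])
    show "continuous_on UNIV (\<lambda>a. f a - G a)" by (intro continuous_intros cf cG)
    show "f (a + 1) - G (a + 1) = f a - G a" for a by (simp only: perf perG)
    fix m :: int
    have "integral {0..1} (\<lambda>a. (f a - G a) * cis (2 * pi * real_of_int m * a)) =
       integral {0..1} (\<lambda>a. f a * cis (2 * pi * real_of_int m * a)) - integral {0..1} (\<lambda>a. G a * cis (2 * pi * real_of_int m * a))"
      unfolding left_diff_distrib
      by (intro Henstock_Kurzweil_Integration.integral_diff integrable_continuous_interval continuous_intros
            continuous_on_subset[OF cf] continuous_on_subset[OF cG]) auto
    thus "integral {0..1} (\<lambda>a. (f a - G a) * cis (2 * pi * real_of_int m * a)) = 0" by (simp only: If IG) simp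
  qed
  thus ?thesis by (simp add: f_def G_def)
qed

section \<open>Gauss sums and the theta series of the character\<close>

lemma
  assumes X: "odd_primitive_char D X"
  shows opc_mult: "X (a * b) = X a * X b"
    and opc_cong: "[a = b] (mod int D) \<Longrightarrow> X a = X b"
    and opc_one: "X 1 = 1" and opc_minus_one: "X (-1) = -1"
    and opc_values: "X n \<in> {-1, 0, 1}"
    and opc_zero_iff: "X n = 0 \<longleftrightarrow> \<not> coprime n (int D)"
    and opc_primitive: "prime p \<Longrightarrow> p dvd D \<Longrightarrow>
        \<exists>a. [a = 1] (mod int (D div p)) \<and> coprime a (int D) \<and> X a = -1"
  using X unfolding odd_primitive_char_def by blast+

lemma opc_minus: "odd_primitive_char D X \<Longrightarrow> X (- n) = - X n"
  using opc_mult[of D X "-1" n] opc_minus_one[of D X] by simp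

lemma opc_abs_le: "odd_primitive_char D X \<Longrightarrow> \<bar>X n\<bar> \<le> 1"
  using opc_values[of D X n] by auto

definition gauss_sum :: "nat \<Rightarrow> (int \<Rightarrow> int) \<Rightarrow> int \<Rightarrow> complex" where
  "gauss_sum D X m = (\<Sum>b\<in>{0..<int D}. of_int (X b) * cis (2 * pi * real_of_int (m * b) / real D))"

lemma cis_cong:
  assumes D: "D > 0" and c: "[a = b] (mod int D)"
  shows "cis (2 * pi * real_of_int a / real D) = cis (2 * pi * real_of_int b / real D)"
proof -
  obtain k where k: "a = b + int D * k" using c by (metis cong_iff_lin cong_sym)
  have "2 * pi * real_of_int a / real D = 2 * pi * real_of_int b / real D + 2 * pi * real_of_int k"
    unfolding k using D by (simp add: field_simps)
  moreover have "cis (2 * pi * real_of_int k) = 1" by (rule cis_multiple_2pi) simp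
  ultimately show ?thesis by (simp only: cis_mult[symmetric] mult_1_right)
qed

lemma residue_mult_bij:
  assumes D: "D > 0" and a: "coprime a (int D)"
  shows "bij_betw (\<lambda>b. (a * b) mod int D) {0..<int D} {0..<int D}"
proof -
  have "inj_on (\<lambda>b. (a * b) mod int D) {0..<int D}"
  proof (rule inj_onI)
    fix x y assume xy: "x \<in> {0..<int D}" "y \<in> {0..<int D}" "(a * x) mod int D = (a * y) mod int D"
    hence "[a * x = a * y] (mod int D)" by (simp add: cong_def)
    hence "[x = y] (mod int D)" using a by (simp add: cong_mult_lcancel)
    thus "x = y" using xy by (simp add: cong_def)
  qed
  moreover have "(\<lambda>b. (a * b) mod int D) ` {0..<int D} \<subseteq> {0..<int D}" using D by auto
  ultimately show ?thesis by (intro bij_betw_imageI endo_inj_surj) auto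
qed

lemma gauss_sum_mult:
  assumes X: "odd_primitive_char D X" and D: "D > 0" and a: "coprime a (int D)"
  shows "gauss_sum D X m = of_int (X a) * gauss_sum D X (m * a)"
proof -
  have "gauss_sum D X m = (\<Sum>b\<in>{0..<int D}. of_int (X ((a * b) mod int D)) * cis (2 * pi * real_of_int (m * ((a * b) mod int D)) / real D))"
    unfolding gauss_sum_def by (rule sum.reindex_bij_betw[OF residue_mult_bij[OF D a], symmetric])
  also have "\<dots> = (\<Sum>b\<in>{0..<int D}. of_int (X a) * (of_int (X b) * cis (2 * pi * real_of_int ((m * a) * b) / real D)))"
  proof (rule sum.cong[OF refl])
    fix b
    have c: "[(a * b) mod int D = a * b] (mod int D)" by (simp add: cong_def)
    have "X ((a * b) mod int D) = X a * X b" using opc_cong[OF X c] opc_mult[OF X] by simp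
    moreover have "[m * ((a * b) mod int D) = (m * a) * b] (mod int D)"
      using cong_scalar_left[OF c, of m] by (simp add: mult.assoc)
    from cis_cong[OF D this]
    have "cis (2 * pi * real_of_int (m * ((a * b) mod int D)) / real D) = cis (2 * pi * real_of_int ((m * a) * b) / real D)" .
    ultimately show "of_int (X ((a * b) mod int D)) * cis (2 * pi * real_of_int (m * ((a * b) mod int D)) / real D)
       = of_int (X a) * (of_int (X b) * cis (2 * pi * real_of_int ((m * a) * b) / real D))" by (simp only: of_int_mult mult.assoc)
  qed
  finally show ?thesis by (simp add: gauss_sum_def sum_distrib_left)
qed

text \<open>For \<open>m\<close> coprime to \<open>D\<close> the substitution \<open>b \<mapsto> m b\<close> gives the claim. Otherwise take a prime \<open>p\<close>
  dividing both and the witness \<open>a\<close> of primitivity at \<open>p\<close>: the substitution \<open>b \<mapsto> a b\<close> leaves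
  \<open>m b\<close> unchanged modulo \<open>D\<close> but reverses the sign of the character, so the sum is zero.\<close>
lemma gauss_sum_separable:
  assumes X: "odd_primitive_char D X" and D: "D > 0"
  shows "gauss_sum D X m = of_int (X m) * gauss_sum D X 1"
proof (cases "coprime m (int D)")
  case True
  have "X m * X m = 1" using opc_values[OF X, of m] opc_zero_iff[OF X, of m] True by auto
  hence "complex_of_int (X m) * of_int (X m) = 1" by (metis of_int_1 of_int_mult)
  moreover have "gauss_sum D X 1 = of_int (X m) * gauss_sum D X m" using gauss_sum_mult[OF X D True, of 1] by simp
  ultimately show ?thesis by (simp add: mult.assoc[symmetric])
next
  case False
  hence X0: "X m = 0" using opc_zero_iff[OF X] by blast
  have "nat (gcd m (int D)) \<noteq> 1" using False D by (simp add: coprime_iff_gcd_eq_1 nat_eq_iff)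
  from prime_factor_nat[OF this] obtain p where p: "prime p" "p dvd nat (gcd m (int D))" by blast
  from p(2) have "int p dvd int (nat (gcd m (int D)))" by (simp only: int_dvd_int_iff)
  hence "int p dvd gcd m (int D)" by simp
  hence pm: "int p dvd m" and pD: "p dvd D" by auto
  obtain a where a: "[a = 1] (mod int (D div p))" "coprime a (int D)" "X a = -1"
    using opc_primitive[OF X p(1) pD] by blast
  obtain t where t: "m = int p * t" using pm by (rule dvdE)
  have "[m * a = m] (mod int D)"
  proof -
    have "int (D div p) dvd a - 1" using a(1) by (simp add: cong_iff_dvd_diff)
    hence "int p * int (D div p) dvd int p * (t * (a - 1))" by (intro mult_dvd_mono dvd_refl dvd_mult)
    moreover have "int p * int (D div p) = int D" using pD by (metis dvd_mult_div_cancel of_nat_mult)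
    moreover have "int p * (t * (a - 1)) = m * a - m" by (simp add: t algebra_simps)
    ultimately show ?thesis by (simp add: cong_iff_dvd_diff)
  qed
  have eq: "gauss_sum D X (m * a) = gauss_sum D X m"
    unfolding gauss_sum_def
  proof (rule sum.cong[OF refl])
    fix b
    have "[m * a * b = m * b] (mod int D)" by (rule cong_scalar_right[OF \<open>[m * a = m] (mod int D)\<close>])
    from cis_cong[OF D this]
    show "of_int (X b) * cis (2 * pi * real_of_int (m * a * b) / real D) = of_int (X b) * cis (2 * pi * real_of_int (m * b) / real D)"
      by simp
  qed
  have "gauss_sum D X m = - gauss_sum D X m" using gauss_sum_mult[OF X D a(2), of m] eq a(3) by simp
  hence "2 * gauss_sum D X m = 0" by (metis add.right_inverse mult_2)
  thus ?thesis using X0 by simp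
qed

definition theta_char :: "nat \<Rightarrow> (int \<Rightarrow> int) \<Rightarrow> real \<Rightarrow> complex" where
  "theta_char D X y = (\<Sum>\<^sub>\<infinity>n. of_int (X n) * of_real (real_of_int n * exp (- pi * (real_of_int n)\<^sup>2 * y / real D)))"

lemma theta_char_summable:
  assumes X: "odd_primitive_char D X" and D: "D > 0" and y: "y > 0"
  shows "(\<lambda>n. norm (complex_of_int (X n) * of_real (real_of_int n * exp (- pi * (real_of_int n)\<^sup>2 * y / real D)))) summable_on UNIV"
proof (rule Infinite_Sum.abs_summable_on_comparison_test')
  let ?c = "pi * y / real D"
  show "(\<lambda>n::int. exp (1 / ?c) * exp (- real_of_int \<bar>n\<bar>)) summable_on UNIV"
    by (intro summable_on_cmult_right summable_exp_minus_int)
  fix n :: int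
  have "norm (complex_of_int (X n) * of_real (real_of_int n * exp (- pi * (real_of_int n)\<^sup>2 * y / real D)))
      = real_of_int \<bar>X n\<bar> * (\<bar>real_of_int n\<bar> * exp (- ?c * (real_of_int n)\<^sup>2))"
    unfolding norm_mult norm_of_int norm_of_real abs_mult by (simp add: mult_ac)
  also have "\<dots> \<le> 1 * (exp (1 / ?c) * exp (- \<bar>real_of_int n\<bar>))"
  proof (rule mult_mono)
    show "real_of_int \<bar>X n\<bar> \<le> 1" using opc_abs_le[OF X, of n] by linarith
    show "\<bar>real_of_int n\<bar> * exp (- ?c * (real_of_int n)\<^sup>2) \<le> exp (1 / ?c) * exp (- \<bar>real_of_int n\<bar>)"
      by (rule linear_gauss_bound) (use y D in simp)
  qed auto
  finally show "norm (complex_of_int (X n) * of_real (real_of_int n * exp (- pi * (real_of_int n)\<^sup>2 * y / real D)))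
     \<le> exp (1 / ?c) * exp (- real_of_int \<bar>n\<bar>)" by simp
qed

lemma residue_decomposition_bij:
  assumes D: "(D::nat) > 0"
  shows "bij_betw (\<lambda>(b, k). b + k * int D) ({0..<int D} \<times> UNIV) UNIV"
proof (rule bij_betwI[of _ _ _ "\<lambda>n. (n mod int D, n div int D)"])
  show "(\<lambda>(b, k). b + k * int D) \<in> {0..<int D} \<times> UNIV \<rightarrow> UNIV" by auto
  show "(\<lambda>n. (n mod int D, n div int D)) \<in> UNIV \<rightarrow> {0..<int D} \<times> UNIV" using D by auto
  show "\<And>x. x \<in> {0..<int D} \<times> UNIV \<Longrightarrow> ((case x of (b, k) \<Rightarrow> b + k * int D) mod int D, (case x of (b, k) \<Rightarrow> b + k * int D) div int D) = x"
    by auto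
  show "\<And>y. y \<in> UNIV \<Longrightarrow> (case (y mod int D, y div int D) of (b, k) \<Rightarrow> b + k * int D) = y" by simp
qed

text \<open>Sorting the summation index by its residue modulo \<open>D\<close> makes the character constant on each part,
  which is a periodised odd Gaussian.\<close>
lemma theta_char_residues:
  assumes X: "odd_primitive_char D X" and D: "D > 0" and y: "y > 0"
  shows "theta_char D X y = of_nat D * (\<Sum>b\<in>{0..<int D}. of_int (X b) *
           (\<Sum>\<^sub>\<infinity>k. odd_gauss (y * real D) (real_of_int b / real D + real_of_int k)))"
proof -
  let ?h = "\<lambda>n. complex_of_int (X n) * of_real (real_of_int n * exp (- pi * (real_of_int n)\<^sup>2 * y / real D))"
  have sm: "?h summable_on UNIV"
    by (rule Infinite_Sum.abs_summable_summable[OF theta_char_summable[OF X D y]])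
  have hb: "?h (b + k * int D) = of_nat D * (of_int (X b) * odd_gauss (y * real D) (real_of_int b / real D + real_of_int k))" for b k
  proof -
    have "[b + k * int D = b] (mod int D)" by (simp add: cong_def)
    hence 1: "X (b + k * int D) = X b" by (rule opc_cong[OF X])
    have 2: "real_of_int (b + k * int D) = real D * (real_of_int b / real D + real_of_int k)"
      using D by (simp add: field_simps)
    have 3: "- pi * (real D * v)\<^sup>2 * y / real D = - (pi * (y * real D)) * v\<^sup>2" for v
      using D by (simp add: power2_eq_square field_simps)
    show ?thesis unfolding 1 2 3 odd_gauss_def by (simp add: mult_ac)
  qed
  have "theta_char D X y = (\<Sum>\<^sub>\<infinity>(b, k)\<in>{0..<int D} \<times> UNIV. ?h (b + k * int D))"
    unfolding theta_char_def
    using infsum_reindex_bij_betw[OF residue_decomposition_bij[OF D], of ?h] by (simp add: case_prod_unfold)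
  also have "\<dots> = (\<Sum>\<^sub>\<infinity>b\<in>{0..<int D}. \<Sum>\<^sub>\<infinity>k. ?h (b + k * int D))"
  proof (rule infsum_Sigma'_banach[symmetric])
    have "(\<lambda>x. ?h ((\<lambda>(b, k). b + k * int D) x)) summable_on {0..<int D} \<times> UNIV"
      using sm summable_on_reindex_bij_betw[OF residue_decomposition_bij[OF D], of ?h] by blast
    thus "(\<lambda>(b, k). ?h (b + k * int D)) summable_on {0..<int D} \<times> UNIV" by (simp add: case_prod_unfold)
  qed
  also have "\<dots> = (\<Sum>b\<in>{0..<int D}. \<Sum>\<^sub>\<infinity>k. ?h (b + k * int D))" by simp
  also have "\<dots> = (\<Sum>b\<in>{0..<int D}. of_nat D * (of_int (X b) * (\<Sum>\<^sub>\<infinity>k. odd_gauss (y * real D) (real_of_int b / real D + real_of_int k))))"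
    unfolding hb by (simp only: infsum_cmult_right')
  finally show ?thesis by (simp only: sum_distrib_left)
qed

lemma infsum_of_finite_sum:
  fixes f :: "'a \<Rightarrow> 'b \<Rightarrow> complex"
  assumes "finite B" "\<And>b. b \<in> B \<Longrightarrow> f b summable_on A"
  shows "(\<Sum>\<^sub>\<infinity>n\<in>A. \<Sum>b\<in>B. f b n) = (\<Sum>b\<in>B. \<Sum>\<^sub>\<infinity>n\<in>A. f b n)"
proof -
  have "((\<lambda>n. \<Sum>b\<in>B. f b n) has_sum (\<Sum>b\<in>B. \<Sum>\<^sub>\<infinity>n\<in>A. f b n)) A"
    using assms
  proof (induction B)
    case (insert b B)
    thus ?case by (simp add: has_sum_add has_sum_infsum)
  qed simp
  thus ?thesis by (rule infsumI)
qed

text \<open>Poisson summation on each residue class produces the Gauss sum at \<open>n\<close> as the coefficient of the dual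
  Gaussian, and separability turns it into the character again. The constant \<open>W\<close> is the root number;
  its value is found later without evaluating the Gauss sum.\<close>
theorem theta_char_functional_equation:
  assumes X: "odd_primitive_char D X" and D: "D > 0"
  shows "\<exists>W. \<forall>y>0. theta_char D X y = W * of_real (1 / (y * sqrt y)) * theta_char D X (1 / y)"
proof (intro exI allI impI)
  fix y :: real assume y: "y > 0"
  let ?x = "y * real D"
  have x: "?x > 0" using y D by simp
  have ds: "(\<lambda>n. odd_gauss_dual ?x n * c n) summable_on UNIV" if "\<And>n. norm (c n) \<le> 1" for c
  proof (rule Infinite_Sum.abs_summable_summable, rule Infinite_Sum.abs_summable_on_comparison_test')
    show "(\<lambda>n. exp (1 / (pi / ?x)) / (?x * sqrt ?x) * exp (- real_of_int \<bar>n\<bar>)) summable_on UNIV"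
      by (intro summable_on_cmult_right summable_exp_minus_int)
    fix n
    have "norm (odd_gauss_dual ?x n * c n) \<le> norm (odd_gauss_dual ?x n) * 1"
      unfolding norm_mult by (intro mult_left_mono that) auto
    also have "\<dots> \<le> exp (1 / (pi / ?x)) / (?x * sqrt ?x) * exp (- real_of_int \<bar>n\<bar>)"
      using norm_odd_gauss_dual[OF x] by simp
    finally show "norm (odd_gauss_dual ?x n * c n) \<le> exp (1 / (pi / ?x)) / (?x * sqrt ?x) * exp (- real_of_int \<bar>n\<bar>)" .
  qed
  have "theta_char D X y = of_nat D * (\<Sum>b\<in>{0..<int D}. of_int (X b) *
           (\<Sum>\<^sub>\<infinity>n. odd_gauss_dual ?x n * cis (2 * pi * real_of_int n * (real_of_int b / real D))))"
    unfolding theta_char_residues[OF X D y] poisson_odd_gauss[OF x] ..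
  also have "(\<Sum>b\<in>{0..<int D}. of_int (X b) *
           (\<Sum>\<^sub>\<infinity>n. odd_gauss_dual ?x n * cis (2 * pi * real_of_int n * (real_of_int b / real D)))) =
      (\<Sum>b\<in>{0..<int D}. \<Sum>\<^sub>\<infinity>n. of_int (X b) * (odd_gauss_dual ?x n * cis (2 * pi * real_of_int n * (real_of_int b / real D))))"
    by (simp only: infsum_cmult_right')
  also have "\<dots> = (\<Sum>\<^sub>\<infinity>n. \<Sum>b\<in>{0..<int D}. of_int (X b) * (odd_gauss_dual ?x n * cis (2 * pi * real_of_int n * (real_of_int b / real D))))"
    by (rule infsum_of_finite_sum[symmetric]) (simp, intro summable_on_cmult_right ds, simp)
  also have "(\<lambda>n. \<Sum>b\<in>{0..<int D}. of_int (X b) * (odd_gauss_dual ?x n * cis (2 * pi * real_of_int n * (real_of_int b / real D))))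
      = (\<lambda>n. odd_gauss_dual ?x n * gauss_sum D X n)"
    unfolding gauss_sum_def sum_distrib_left by (rule ext, rule sum.cong) (simp_all add: mult_ac)
  also have "(\<lambda>n. odd_gauss_dual ?x n * gauss_sum D X n) = (\<lambda>n. (- \<i> * gauss_sum D X 1 * of_real (1 / (?x * sqrt ?x))) *
      (of_int (X n) * of_real (real_of_int n * exp (- pi * (real_of_int n)\<^sup>2 * (1 / y) / real D))))"
  proof (rule ext)
    fix n
    have "- (pi / ?x) * (real_of_int n)\<^sup>2 = - pi * (real_of_int n)\<^sup>2 * (1 / y) / real D"
      using y D by (simp add: field_simps)
    thus "odd_gauss_dual ?x n * gauss_sum D X n = (- \<i> * gauss_sum D X 1 * of_real (1 / (?x * sqrt ?x))) *
      (of_int (X n) * of_real (real_of_int n * exp (- pi * (real_of_int n)\<^sup>2 * (1 / y) / real D)))"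
      unfolding gauss_sum_separable[OF X D, of n] odd_gauss_dual_def by simp
  qed
  also have "(\<Sum>\<^sub>\<infinity>n. (- \<i> * gauss_sum D X 1 * of_real (1 / (?x * sqrt ?x))) *
      (of_int (X n) * of_real (real_of_int n * exp (- pi * (real_of_int n)\<^sup>2 * (1 / y) / real D))))
     = (- \<i> * gauss_sum D X 1 * of_real (1 / (?x * sqrt ?x))) * theta_char D X (1 / y)"
    unfolding theta_char_def by (rule infsum_cmult_right')
  finally show "theta_char D X y = (- \<i> * gauss_sum D X 1 / of_real (sqrt (real D))) * of_real (1 / (y * sqrt y)) * theta_char D X (1 / y)"
    using y D by (simp add: real_sqrt_mult field_simps)
qed

text \<open>The character and the linear factor are both odd, so \<open>n\<close> and \<open>- n\<close> contribute equally.\<close>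
lemma theta_char_eq_nat_sum:
  assumes X: "odd_primitive_char D X" and D: "D > 0" and y: "y > 0"
  shows "summable (\<lambda>n. norm (complex_of_int (X (int (Suc n))) * of_real (real (Suc n) * exp (- pi * (real (Suc n))\<^sup>2 * y / real D))))"
    and "theta_char D X y = 2 * (\<Sum>n. of_int (X (int (Suc n))) * of_real (real (Suc n) * exp (- pi * (real (Suc n))\<^sup>2 * y / real D)))"
proof -
  let ?h = "\<lambda>n::int. complex_of_int (X n) * of_real (real_of_int n * exp (- pi * (real_of_int n)\<^sup>2 * y / real D))"
  let ?k = "\<lambda>n. ?h (int (Suc n))"
  let ?P = "range (\<lambda>n. int (Suc n))" and ?N = "range (\<lambda>n. - int (Suc n))"
  have ns: "(\<lambda>n. norm (?h n)) summable_on UNIV" by (rule theta_char_summable[OF X D y])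
  have hm: "?h (- n) = ?h n" for n using opc_minus[OF X, of n] by simp
  have injP: "inj (\<lambda>n. int (Suc n))" and injN: "inj (\<lambda>n. - int (Suc n))" by (auto simp: inj_on_def)
  have "(\<lambda>n. norm (?h n)) summable_on ?P" by (rule summable_on_subset_banach[OF ns]) auto
  hence kn: "(\<lambda>n. norm (?k n)) summable_on UNIV"
    using summable_on_reindex[OF injP, of "\<lambda>n. norm (?h n)"] by (simp add: o_def)
  hence k: "?k summable_on UNIV" by (rule Infinite_Sum.abs_summable_summable)
  show "summable (\<lambda>n. norm (complex_of_int (X (int (Suc n))) * of_real (real (Suc n) * exp (- pi * (real (Suc n))\<^sup>2 * y / real D))))"
    using summable_on_imp_summable[OF kn] by simp
  have hs: "?h summable_on A" for A
    by (rule Infinite_Sum.abs_summable_summable, rule summable_on_subset_banach[OF ns]) auto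
  have sP: "infsum ?h ?P = infsum ?k UNIV" using infsum_reindex[OF injP, of ?h] by (simp add: o_def)
  have "?h \<circ> (\<lambda>n. - int (Suc n)) = ?k" unfolding o_def hm ..
  hence sN: "infsum ?h ?N = infsum ?k UNIV" using infsum_reindex[OF injN, of ?h] by simp
  have "UNIV = (?P \<union> ?N) \<union> {0}"
  proof -
    have "n \<in> (?P \<union> ?N) \<union> {0}" for n :: int
    proof (cases n rule: int_cases)
      case (nonneg m) thus ?thesis by (cases m) auto
    qed auto
    thus ?thesis by blast
  qed
  hence "theta_char D X y = infsum ?h ((?P \<union> ?N) \<union> {0})" by (simp add: theta_char_def)
  also have "\<dots> = infsum ?h (?P \<union> ?N) + infsum ?h {0}" by (rule infsum_Un_disjoint[OF hs hs]) auto
  also have "infsum ?h (?P \<union> ?N) = infsum ?h ?P + infsum ?h ?N" by (rule infsum_Un_disjoint[OF hs hs]) auto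
  finally have "theta_char D X y = infsum ?h ?P + infsum ?h ?N + infsum ?h {0}" .
  moreover have "infsum ?h {0} = 0" by simp
  ultimately have "theta_char D X y = 2 * infsum ?k UNIV" by (simp only: sP sN mult_2 add_0_right)
  also have "infsum ?k UNIV = (\<Sum>n. ?k n)"
    using has_sum_imp_sums[OF has_sum_infsum[OF k]] by (rule sums_unique)
  finally show "theta_char D X y = 2 * (\<Sum>n. of_int (X (int (Suc n))) * of_real (real (Suc n) * exp (- pi * (real (Suc n))\<^sup>2 * y / real D)))"
    by simp
qed

section \<open>The kernel\<close>

definition phi_term :: "(int \<Rightarrow> int) \<Rightarrow> nat \<Rightarrow> nat \<Rightarrow> real \<Rightarrow> real" where
  "phi_term X D n u = of_int (X (int (Suc n))) * real (Suc n) *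
     exp (3 * u / 2 - (real (Suc n))\<^sup>2 * pi * exp (2 * u) / real D)"

lemma phi_term_eq:
  "phi_term X D n u = exp (3 * u / 2) * (of_int (X (int (Suc n))) * (real (Suc n) * exp (- pi * (real (Suc n))\<^sup>2 * exp (2 * u) / real D)))"
proof -
  have "exp (3 * u / 2 - (real (Suc n))\<^sup>2 * pi * exp (2 * u) / real D) = exp (3 * u / 2) * exp (- pi * (real (Suc n))\<^sup>2 * exp (2 * u) / real D)"
    by (simp add: exp_add[symmetric] mult_ac)
  thus ?thesis by (simp add: phi_term_def mult_ac)
qed

text \<open>The character is extended from natural numbers to integers; everything analytic uses only these
  properties of \<open>chi D\<close>.\<close>
locale odd_char_setup =
  fixes D :: nat and X :: "int \<Rightarrow> int"
  assumes X: "odd_primitive_char D X" and D: "D > 0" and chi: "\<And>n. chi D n = X (int n)"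
begin

lemma phi_term_summable: "summable (\<lambda>n. \<bar>phi_term X D n u\<bar>)"
proof -
  have "(\<lambda>n. \<bar>phi_term X D n u\<bar>) = (\<lambda>n. exp (3 * u / 2) *
     norm (complex_of_int (X (int (Suc n))) * of_real (real (Suc n) * exp (- pi * (real (Suc n))\<^sup>2 * exp (2 * u) / real D))))"
    unfolding phi_term_eq norm_mult norm_of_int norm_of_real abs_mult by simp
  thus ?thesis using theta_char_eq_nat_sum(1)[OF X D, of "exp (2 * u)"] by (simp add: summable_mult)
qed

lemma Phi_sums: "(\<lambda>n. 4 * phi_term X D n u) sums Phi D u"
proof -
  have "Phi D u = 4 * (\<Sum>n. phi_term X D n u)" by (simp add: Phi_def phi_term_def chi)
  thus ?thesis using sums_mult[OF summable_sums[OF summable_rabs_cancel[OF phi_term_summable]], of 4] by simp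
qed

lemma Phi_theta: "complex_of_real (Phi D u) = 2 * of_real (exp (3 * u / 2)) * theta_char D X (exp (2 * u))"
proof -
  have sm: "summable (\<lambda>n. complex_of_int (X (int (Suc n))) * of_real (real (Suc n) * exp (- pi * (real (Suc n))\<^sup>2 * exp (2 * u) / real D)))"
    by (rule summable_norm_cancel[OF theta_char_eq_nat_sum(1)[OF X D]]) simp
  have "(\<lambda>n. complex_of_real (4 * phi_term X D n u)) sums of_real (Phi D u)"
    by (intro sums_of_real Phi_sums)
  moreover have "(\<lambda>n. complex_of_real (4 * phi_term X D n u)) = (\<lambda>n. (4 * of_real (exp (3 * u / 2))) *
      (complex_of_int (X (int (Suc n))) * of_real (real (Suc n) * exp (- pi * (real (Suc n))\<^sup>2 * exp (2 * u) / real D))))"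
    unfolding phi_term_eq by (rule ext) (simp only: of_real_mult of_real_of_int_eq of_real_numeral mult_ac)
  moreover have "\<dots> sums ((4 * of_real (exp (3 * u / 2))) * (theta_char D X (exp (2 * u)) / 2))"
  proof (rule sums_mult)
    have "theta_char D X (exp (2 * u)) / 2 = (\<Sum>n. complex_of_int (X (int (Suc n))) * of_real (real (Suc n) * exp (- pi * (real (Suc n))\<^sup>2 * exp (2 * u) / real D)))"
      unfolding theta_char_eq_nat_sum(2)[OF X D exp_gt_zero] by (rule nonzero_mult_div_cancel_left) simp
    thus "(\<lambda>n. complex_of_int (X (int (Suc n))) * of_real (real (Suc n) * exp (- pi * (real (Suc n))\<^sup>2 * exp (2 * u) / real D)))
      sums (theta_char D X (exp (2 * u)) / 2)" using summable_sums[OF sm] by (simp only:)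
  qed
  ultimately have "complex_of_real (Phi D u) = (4 * of_real (exp (3 * u / 2))) * (theta_char D X (exp (2 * u)) / 2)"
    by (metis sums_unique2)
  thus ?thesis by simp
qed

text \<open>With \<open>y = exp (2 u)\<close> the map \<open>y \<mapsto> 1 / y\<close> becomes \<open>u \<mapsto> - u\<close>, and the factor \<open>exp (3 u / 2)\<close> in
  the kernel balances the factor \<open>y\<^bsup>-3/2\<^esup>\<close> of the functional equation.\<close>
lemma Phi_reflection: "\<exists>W. \<forall>u. complex_of_real (Phi D (- u)) = W * of_real (Phi D u)"
proof -
  obtain W where W: "\<And>y. y > 0 \<Longrightarrow> theta_char D X y = W * of_real (1 / (y * sqrt y)) * theta_char D X (1 / y)"
    using theta_char_functional_equation[OF X D] by blast
  have "complex_of_real (Phi D (- u)) = W * of_real (Phi D u)" for u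
  proof -
    have th: "theta_char D X (exp (2 * - u)) = W * of_real (exp (3 * u)) * theta_char D X (exp (2 * u))"
    proof -
      have "sqrt (exp (2 * - u)) = exp (- u)" by (rule real_sqrt_unique) (simp_all add: exp_double[symmetric] power2_eq_square exp_add[symmetric])
      hence "1 / (exp (2 * - u) * sqrt (exp (2 * - u))) = exp (3 * u)"
        by (simp add: exp_add[symmetric] exp_minus[symmetric] inverse_eq_divide[symmetric])
      moreover have "1 / exp (2 * - u) = exp (2 * u)" by (simp add: exp_minus inverse_eq_divide)
      ultimately show ?thesis using W[of "exp (2 * - u)"] by simp
    qed
    have "complex_of_real (Phi D (- u)) = 2 * of_real (exp (3 * - u / 2)) * (W * of_real (exp (3 * u)) * theta_char D X (exp (2 * u)))"
      unfolding Phi_theta[of "- u"] th ..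
    also have "\<dots> = W * (2 * of_real (exp (3 * - u / 2) * exp (3 * u)) * theta_char D X (exp (2 * u)))" by (simp add: mult_ac)
    also have "exp (3 * - u / 2) * exp (3 * u) = exp (3 * u / 2)" by (simp add: exp_add[symmetric])
    finally show ?thesis unfolding Phi_theta .
  qed
  thus ?thesis by blast
qed

lemma Phi_measurable [measurable]: "Phi D \<in> borel_measurable borel"
proof -
  have "Phi D = (\<lambda>u. \<Sum>n. 4 * phi_term X D n u)" using Phi_sums by (auto simp: sums_iff)
  moreover have "(\<lambda>u. \<Sum>n. 4 * phi_term X D n u) \<in> borel_measurable borel"
    unfolding phi_term_def by measurable
  ultimately show ?thesis by simp
qed

text \<open>For \<open>a, b \<ge> 1\<close> one has \<open>a + b \<le> 2 a b\<close>. Applied to \<open>a = n\<^sup>2\<close> and \<open>b = exp (2 u)\<close>, this splits each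
  exponent into a part that makes the series converge and a part that gives the decay in \<open>u\<close>.\<close>
lemma Phi_bound: "\<exists>K c. c > 0 \<and> K \<ge> 0 \<and> (\<forall>u\<ge>0. \<bar>Phi D u\<bar> \<le> K * exp (3 * u / 2 - c * exp (2 * u)))"
proof -
  define c where "c = pi / (2 * real D)"
  have c: "c > 0" using D by (simp add: c_def)
  define g where "g n = real (Suc n) * exp (- c * (real (Suc n))\<^sup>2)" for n
  have sg: "summable g"
  proof (rule summable_comparison_test[OF _ summable_mult[OF summable_exp_minus_nat]], intro exI allI impI)
    fix n
    have "norm (g n) = \<bar>real (Suc n)\<bar> * exp (- c * (real (Suc n))\<^sup>2)" by (simp add: g_def abs_mult)
    also have "\<dots> \<le> exp (1 / c) * exp (- \<bar>real (Suc n)\<bar>)" by (rule linear_gauss_bound[OF c])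
    also have "\<dots> \<le> exp (1 / c) * exp (- real n)" by simp
    finally show "norm (g n) \<le> exp (1 / c) * exp (- real n)" .
  qed
  have g0: "g n \<ge> 0" for n by (simp add: g_def)
  have "\<bar>Phi D u\<bar> \<le> (4 * suminf g) * exp (3 * u / 2 - c * exp (2 * u))" if u: "u \<ge> 0" for u
  proof -
    have s4: "summable (\<lambda>n. \<bar>4 * phi_term X D n u\<bar>)"
      using summable_mult[OF phi_term_summable, of 4 u] by (simp only: abs_mult abs_numeral)
    have tb: "\<bar>4 * phi_term X D n u\<bar> \<le> (4 * exp (3 * u / 2 - c * exp (2 * u))) * g n" for n
    proof -
      let ?a = "(real (Suc n))\<^sup>2" and ?b = "exp (2 * u)"
      have "1 \<le> ?a" "1 \<le> ?b" using u by auto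
      hence "0 \<le> (?a - 1) * ?b + ?a * (?b - 1)" by (intro add_nonneg_nonneg mult_nonneg_nonneg) auto
      hence ab: "?a + ?b \<le> 2 * (?a * ?b)" by (simp add: algebra_simps)
      have "?a * pi * ?b / real D = c * (2 * (?a * ?b))" by (simp add: c_def)
      also have "\<dots> \<ge> c * (?a + ?b)" using ab c by (intro mult_left_mono) auto
      finally have "c * ?a + c * ?b \<le> ?a * pi * ?b / real D" by (simp only: distrib_left)
      hence e: "3 * u / 2 - ?a * pi * ?b / real D \<le> (3 * u / 2 - c * ?b) + - c * ?a" by linarith
      have "\<bar>4 * phi_term X D n u\<bar> = 4 * (\<bar>real_of_int (X (int (Suc n)))\<bar> * (real (Suc n) * exp (3 * u / 2 - ?a * pi * ?b / real D)))"
        by (simp add: phi_term_def abs_mult)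
      also have "\<dots> \<le> 4 * (1 * (real (Suc n) * exp ((3 * u / 2 - c * ?b) + - c * ?a)))"
      proof (intro mult_left_mono mult_mono)
        show "\<bar>real_of_int (X (int (Suc n)))\<bar> \<le> 1" using opc_abs_le[OF X, of "int (Suc n)"] by linarith
      qed (use e in auto)
      also have "\<dots> = (4 * exp (3 * u / 2 - c * ?b)) * g n" unfolding exp_add g_def by simp
      finally show ?thesis .
    qed
    have "\<bar>Phi D u\<bar> = \<bar>\<Sum>n. 4 * phi_term X D n u\<bar>" using Phi_sums by (simp add: sums_iff)
    also have "\<dots> \<le> (\<Sum>n. \<bar>4 * phi_term X D n u\<bar>)"
      by (rule summable_rabs[OF s4])
    also have "\<dots> \<le> (\<Sum>n. (4 * exp (3 * u / 2 - c * exp (2 * u))) * g n)"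
      by (rule suminf_le[OF tb s4 summable_mult[OF sg]])
    also have "\<dots> = (4 * exp (3 * u / 2 - c * exp (2 * u))) * suminf g" by (rule suminf_mult[OF sg])
    finally show ?thesis by (simp add: mult_ac)
  qed
  moreover have "4 * suminf g \<ge> 0" using suminf_nonneg[OF sg g0] by simp
  ultimately show ?thesis using c by blast
qed

lemma rapid_Phi: "rapid (Phi D)"
  unfolding rapid_def
proof (intro conjI allI Phi_measurable)
  fix r :: real
  obtain K c where c: "c > 0" "K \<ge> 0" and b: "\<And>u. u \<ge> 0 \<Longrightarrow> \<bar>Phi D u\<bar> \<le> K * exp (3 * u / 2 - c * exp (2 * u))"
    using Phi_bound by blast
  let ?q = "\<lambda>u. exp (r * u\<^sup>2 + u ^ 3 + (3 * u / 2 - c * exp (2 * u)) + u)"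
  have "((\<lambda>u. exp (\<bar>r\<bar> * u\<^sup>2 + u ^ 3 + (3 * u / 2 - c * exp (2 * u)) + u)) \<longlongrightarrow> 0) at_top"
    using c(1) by real_asymp
  hence "\<forall>\<^sub>F u in at_top. exp (\<bar>r\<bar> * u\<^sup>2 + u ^ 3 + (3 * u / 2 - c * exp (2 * u)) + u) < 1" by (rule order_tendstoD) simp
  then obtain u0 where u0: "\<And>u. u \<ge> u0 \<Longrightarrow> exp (\<bar>r\<bar> * u\<^sup>2 + u ^ 3 + (3 * u / 2 - c * exp (2 * u)) + u) < 1"
    unfolding eventually_at_top_linorder by blast
  have "bounded (?q ` {0..u0})"
    by (intro compact_imp_bounded compact_continuous_image continuous_intros compact_Icc) auto
  then obtain M0 where M0: "\<And>u. u \<in> {0..u0} \<Longrightarrow> norm (?q u) \<le> M0" unfolding bounded_iff by blast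
  define M where "M = max M0 1"
  have M: "?q u \<le> M" if "u \<ge> 0" for u
  proof (cases "u \<le> u0")
    case True thus ?thesis using M0[of u] that by (auto simp: M_def)
  next
    case False
    have "r * u\<^sup>2 \<le> \<bar>r\<bar> * u\<^sup>2" by (intro mult_right_mono) auto
    hence "?q u \<le> exp (\<bar>r\<bar> * u\<^sup>2 + u ^ 3 + (3 * u / 2 - c * exp (2 * u)) + u)" by simp
    also have "\<dots> < 1" using False by (intro u0) simp
    finally have "?q u \<le> 1" by (rule less_imp_le)
    thus ?thesis unfolding M_def by (rule order_trans) simp
  qed
  show "set_integrable lborel {0..} (\<lambda>u. exp (r * u\<^sup>2 + u ^ 3) * Phi D u)"
  proof (rule set_integrable_bound)
    have "integrable lborel (\<lambda>x. x ^ 0 * exp (- x) * indicator {0..} x :: real)"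
      using has_bochner_integral_I0i_power_exp_m'[of 0] by (rule integrable.intros)
    hence "set_integrable lborel {0..} (\<lambda>u::real. exp (- u))"
      unfolding set_integrable_def by (simp add: mult.commute)
    thus "set_integrable lborel {0..} (\<lambda>u. (K * M) * exp (- u))" by (rule set_integrable_mult_right)
    show "set_borel_measurable lborel {0..} (\<lambda>u. exp (r * u\<^sup>2 + u ^ 3) * Phi D u)"
      unfolding set_borel_measurable_def by measurable
    have "norm (exp (r * u\<^sup>2 + u ^ 3) * Phi D u) \<le> norm ((K * M) * exp (- u))" if u: "u \<ge> 0" for u
    proof -
      have "norm (exp (r * u\<^sup>2 + u ^ 3) * Phi D u) = exp (r * u\<^sup>2 + u ^ 3) * \<bar>Phi D u\<bar>" by (simp add: abs_mult)
      also have "\<dots> \<le> exp (r * u\<^sup>2 + u ^ 3) * (K * exp (3 * u / 2 - c * exp (2 * u)))"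
        by (intro mult_left_mono b u) simp
      also have "\<dots> = K * (exp (r * u\<^sup>2 + u ^ 3) * exp (3 * u / 2 - c * exp (2 * u)))" by (simp only: mult_ac)
      also have "exp (r * u\<^sup>2 + u ^ 3) * exp (3 * u / 2 - c * exp (2 * u)) = ?q u * exp (- u)"
        unfolding exp_add[symmetric] by (rule arg_cong[where f = exp]) simp
      also have "K * (?q u * exp (- u)) \<le> K * (M * exp (- u))" using M[OF u] c(2) by (intro mult_left_mono mult_right_mono) auto
      finally show ?thesis using c(2) by (simp add: M_def)
    qed
    thus "AE u in lborel. u \<in> {0..} \<longrightarrow> norm (exp (r * u\<^sup>2 + u ^ 3) * Phi D u) \<le> norm ((K * M) * exp (- u))"
      by (intro AE_I2) auto
  qed
qed

end

lemma neg_fund_disc_setup: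
  assumes "neg_fund_disc D" obtains X where "odd_char_setup D X"
  using chi_odd_primitive_char[OF assms] assms that unfolding odd_char_setup_def neg_fund_disc_def by blast

section \<open>The Mellin transform of the kernel\<close>

text \<open>Euler's integral after the substitution \<open>t = exp w\<close>, which matches the exponential variable of the
  kernel.\<close>
lemma Gamma_exp_integral:
  assumes z: "Re z > 0"
  shows "has_bochner_integral lborel (\<lambda>w. exp (z * of_real w - of_real (exp w))) (Gamma z)"
proof -
  let ?f = "\<lambda>t. complex_of_real t powr (z - 1) / of_real (exp t)"
  let ?g = "\<lambda>w. exp (z * of_real w - complex_of_real (exp w))"
  have "x \<in> range exp" if "x > 0" for x :: real using exp_ln[OF that] by (metis rangeI)
  hence img: "exp ` (UNIV :: real set) = {0<..}" by auto
  have "?f absolutely_integrable_on exp ` (UNIV :: real set) \<and> integral (exp ` (UNIV :: real set)) ?f = Gamma z"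
    unfolding img using absolutely_integrable_Gamma_integral'[OF z] integral_unique[OF Gamma_integral_complex'[OF z]] by simp
  hence "(\<lambda>x. \<bar>exp x\<bar> *\<^sub>R ?f (exp x)) absolutely_integrable_on UNIV \<and> integral UNIV (\<lambda>x. \<bar>exp x\<bar> *\<^sub>R ?f (exp x)) = Gamma z"
    by (subst has_absolute_integral_change_of_variables_real[where g = exp and h = exp])
       (auto intro!: DERIV_subset[OF DERIV_exp] simp: inj_on_def)
  moreover have "\<bar>exp x\<bar> *\<^sub>R ?f (exp x) = ?g x" for x
  proof -
    have "complex_of_real (exp x) powr (z - 1) = exp ((z - 1) * of_real x)"
      by (simp add: powr_def Ln_of_real)
    hence "\<bar>exp x\<bar> *\<^sub>R ?f (exp x) = exp (of_real x) * exp ((z - 1) * of_real x) / exp (of_real (exp x))"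
      by (simp add: scaleR_conv_of_real exp_of_real)
    also have "\<dots> = exp (of_real x + (z - 1) * of_real x - of_real (exp x))"
      by (simp only: exp_add exp_diff)
    also have "of_real x + (z - 1) * of_real x - of_real (exp x) = z * of_real x - of_real (exp x)"
      by (simp add: algebra_simps)
    finally show ?thesis .
  qed
  ultimately have ai: "?g absolutely_integrable_on UNIV" and iv: "integral UNIV ?g = Gamma z" by simp_all
  have m: "?g \<in> borel_measurable lborel" by measurable
  have "integrable (completion lborel) ?g" using ai by (simp add: set_integrable_def)
  hence i: "integrable lborel ?g" using integrable_completion[OF m] by simp
  have "integral\<^sup>L lborel ?g = integral UNIV ?g"
    using integral_lborel[OF i] by simp
  thus ?thesis using i iv by (simp add: has_bochner_integral_iff)
qed

lemma Gamma_exp_integral_scaled: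
  assumes z: "Re z > 0" and b: "b > 0"
  shows "has_bochner_integral lborel (\<lambda>u. exp (2 * z * of_real u - of_real (b * exp (2 * u)))) (Gamma z * exp (- z * of_real (ln b)) / 2)"
proof -
  let ?g = "\<lambda>w. exp (z * of_real w - complex_of_real (exp w))"
  note G = Gamma_exp_integral[OF z]
  have i: "integrable lborel ?g" and v: "integral\<^sup>L lborel ?g = Gamma z" using G by (auto simp: has_bochner_integral_iff)
  have eq: "exp (- z * of_real (ln b)) * ?g (ln b + 2 * u) = exp (2 * z * of_real u - of_real (b * exp (2 * u)))" for u
  proof -
    have "exp (ln b + 2 * u) = b * exp (2 * u)" using b by (simp add: exp_add)
    hence "?g (ln b + 2 * u) = exp (z * of_real (ln b + 2 * u) - of_real (b * exp (2 * u)))" by (simp only:)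
    hence "exp (- z * of_real (ln b)) * ?g (ln b + 2 * u) = exp (- z * of_real (ln b) + (z * of_real (ln b + 2 * u) - of_real (b * exp (2 * u))))"
      by (simp only: exp_add)
    also have "- z * of_real (ln b) + (z * of_real (ln b + 2 * u) - of_real (b * exp (2 * u))) = 2 * z * of_real u - complex_of_real (b * exp (2 * u))"
      by (simp add: algebra_simps)
    finally show ?thesis .
  qed
  have "integrable lborel (\<lambda>u. ?g (ln b + 2 * u))" by (rule lborel_integrable_real_affine[OF i]) simp
  hence i2: "integrable lborel (\<lambda>u. exp (- z * of_real (ln b)) * ?g (ln b + 2 * u))" by (rule integrable_mult_right)
  have "integral\<^sup>L lborel ?g = \<bar>2\<bar> *\<^sub>R (LINT u|lborel. ?g (ln b + 2 * u))" by (rule lborel_integral_real_affine) simp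
  hence "(LINT u|lborel. ?g (ln b + 2 * u)) = Gamma z / 2" unfolding v by (simp add: scaleR_conv_of_real)
  hence "(LINT u|lborel. exp (- z * of_real (ln b)) * ?g (ln b + 2 * u)) = exp (- z * of_real (ln b)) * (Gamma z / 2)"
    by (simp only: Bochner_Integration.integral_mult_right_zero)
  thus ?thesis using i2 unfolding eq by (simp add: has_bochner_integral_iff mult_ac)
qed

context odd_char_setup
begin

lemma mellin_coeff:
  "real (Suc n) * exp (- ((s + 1) / 2) * ln ((real (Suc n))\<^sup>2 * pi / real D)) = exp (- ((s + 1) / 2) * ln (pi / real D)) * real (Suc n) powr (- s)" for s :: real
proof -
  have "ln ((real (Suc n))\<^sup>2 * pi / real D) = 2 * ln (real (Suc n)) + ln (pi / real D)"
    using D by (simp add: ln_mult ln_div ln_realpow algebra_simps)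
  hence "exp (- ((s + 1) / 2) * ln ((real (Suc n))\<^sup>2 * pi / real D)) = exp (- ((s + 1) / 2) * ln (pi / real D)) * exp (- (s + 1) * ln (real (Suc n)))"
    by (simp add: exp_add[symmetric] algebra_simps add_divide_distrib)
  moreover have "real (Suc n) = exp (ln (real (Suc n)))" by simp
  ultimately have "real (Suc n) * exp (- ((s + 1) / 2) * ln ((real (Suc n))\<^sup>2 * pi / real D))
    = exp (- ((s + 1) / 2) * ln (pi / real D)) * (exp (ln (real (Suc n))) * exp (- (s + 1) * ln (real (Suc n))))" by simp
  also have "exp (ln (real (Suc n))) * exp (- (s + 1) * ln (real (Suc n))) = real (Suc n) powr (- s)"
  proof -
    have "exp (ln N) * exp (- (s + 1) * ln N) = N powr (- s)" if "N > 0" for N :: real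
      using that unfolding exp_add[symmetric] powr_def by (simp add: algebra_simps)
    thus ?thesis by simp
  qed
  finally show ?thesis .
qed

lemma mellin_coeff_complex:
  "of_nat (Suc n) * exp (- ((s + 1) / 2) * of_real (ln ((real (Suc n))\<^sup>2 * pi / real D))) = exp (- ((s + 1) / 2) * of_real (ln (pi / real D))) / of_nat (Suc n) powr s" for s :: complex
proof -
  have l: "ln ((real (Suc n))\<^sup>2 * pi / real D) = 2 * ln (real (Suc n)) + ln (pi / real D)"
    using D by (simp add: ln_mult ln_div ln_realpow algebra_simps)
  have "- ((s + 1) / 2) * of_real (ln ((real (Suc n))\<^sup>2 * pi / real D)) = - ((s + 1) / 2) * of_real (ln (pi / real D)) + (- (s + 1) * of_real (ln (real (Suc n))))"
    unfolding l by (simp add: field_simps)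
  hence e: "exp (- ((s + 1) / 2) * of_real (ln ((real (Suc n))\<^sup>2 * pi / real D))) = exp (- ((s + 1) / 2) * of_real (ln (pi / real D))) * exp (- (s + 1) * of_real (ln (real (Suc n))))"
    by (simp only: exp_add)
  have n: "(of_nat (Suc n) :: complex) = exp (of_real (ln (real (Suc n))))"
    by (simp only: exp_of_real) simp
  have p: "of_nat (Suc n) powr s = exp (s * of_real (ln (real (Suc n))))"
  proof -
    have "Ln (of_nat (Suc n)) = of_real (ln (real (Suc n)))" using Ln_of_real[of "real (Suc n)"] by simp
    thus ?thesis by (simp add: powr_def del: of_nat_Suc)
  qed
  have "of_nat (Suc n) * exp (- (s + 1) * of_real (ln (real (Suc n)))) = exp (of_real (ln (real (Suc n))) + - (s + 1) * of_real (ln (real (Suc n))))"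
    by (subst n) (simp only: exp_add)
  also have "of_real (ln (real (Suc n))) + - (s + 1) * of_real (ln (real (Suc n))) = - (s * complex_of_real (ln (real (Suc n))))"
    by (simp add: algebra_simps)
  finally have B: "of_nat (Suc n) * exp (- (s + 1) * of_real (ln (real (Suc n)))) = exp (- (s * complex_of_real (ln (real (Suc n)))))" .
  have "of_nat (Suc n) * exp (- ((s + 1) / 2) * of_real (ln ((real (Suc n))\<^sup>2 * pi / real D))) =
     exp (- ((s + 1) / 2) * of_real (ln (pi / real D))) * (of_nat (Suc n) * exp (- (s + 1) * of_real (ln (real (Suc n)))))"
    unfolding e by (rule mult.left_commute)
  also have "\<dots> = exp (- ((s + 1) / 2) * of_real (ln (pi / real D))) / of_nat (Suc n) powr s"
    unfolding B p by (simp only: exp_minus divide_inverse)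
  finally show ?thesis .
qed

lemma mellin_term:
  assumes s: "Re s > 0"
  shows "has_bochner_integral lborel (\<lambda>u. of_real (4 * phi_term X D n u) * exp ((s - 1/2) * of_real u))
     (2 * Gamma ((s + 1) / 2) * exp (- ((s + 1) / 2) * of_real (ln (pi / real D))) * (of_int (chi D (Suc n)) / of_nat (Suc n) powr s))"
proof -
  let ?b = "(real (Suc n))\<^sup>2 * pi / real D" and ?z = "(s + 1) / 2"
  have b: "?b > 0" using D by simp
  have z: "Re ?z > 0" using s by simp
  have "has_bochner_integral lborel (\<lambda>u. (4 * of_int (X (int (Suc n))) * of_nat (Suc n)) * exp (2 * ?z * of_real u - of_real (?b * exp (2 * u))))
     ((4 * of_int (X (int (Suc n))) * of_nat (Suc n)) * (Gamma ?z * exp (- ?z * of_real (ln ?b)) / 2))"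
    by (rule has_bochner_integral_mult_right) (rule Gamma_exp_integral_scaled[OF z b])
  moreover have "(4 * of_int (X (int (Suc n))) * of_nat (Suc n)) * exp (2 * ?z * of_real u - of_real (?b * exp (2 * u)))
     = of_real (4 * phi_term X D n u) * exp ((s - 1/2) * of_real u)" for u
  proof -
    have "2 * ?z * of_real u - complex_of_real (?b * exp (2 * u)) = of_real (3 * u / 2 - ?b * exp (2 * u)) + (s - 1/2) * of_real u"
      by (simp add: field_simps)
    hence "exp (2 * ?z * of_real u - complex_of_real (?b * exp (2 * u))) = of_real (exp (3 * u / 2 - ?b * exp (2 * u))) * exp ((s - 1/2) * of_real u)"
      by (simp only: exp_add exp_of_real)
    thus ?thesis unfolding phi_term_def by (simp add: mult_ac)
  qed
  moreover have "(4 * of_int (X (int (Suc n))) * of_nat (Suc n)) * (Gamma ?z * exp (- ?z * of_real (ln ?b)) / 2)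
     = 2 * Gamma ?z * exp (- ?z * of_real (ln (pi / real D))) * (of_int (chi D (Suc n)) / of_nat (Suc n) powr s)"
  proof -
    have "(4 * of_int (X (int (Suc n))) * of_nat (Suc n)) * (Gamma ?z * exp (- ?z * of_real (ln ?b)) / 2)
       = 2 * Gamma ?z * of_int (X (int (Suc n))) * (of_nat (Suc n) * exp (- ?z * of_real (ln ?b)))" by (simp only: mult_ac) simp
    thus ?thesis unfolding mellin_coeff_complex chi by simp
  qed
  ultimately show ?thesis by (simp only:)
qed

text \<open>The absolute integrals are bounded by multiples of the same integrals at the real part of \<open>s\<close>, which
  form a convergent p-series. This permits integrating the kernel term by term.\<close>
lemma mellin_term_norm_summable:
  assumes s: "Re s > 1"
  shows "summable (\<lambda>n. LINT u|lborel. norm (of_real (4 * phi_term X D n u) * exp ((s - 1/2) * of_real u)))"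
proof -
  define \<sigma> where "\<sigma> = Re s"
  let ?C = "2 * norm (Gamma ((of_real \<sigma> + 1) / 2 :: complex)) * exp (- ((\<sigma> + 1) / 2) * ln (pi / real D))"
  have le: "(LINT u|lborel. norm (of_real (4 * phi_term X D n u) * exp ((s - 1/2) * of_real u))) \<le> ?C * real (Suc n) powr (- \<sigma>)" for n
  proof -
    let ?b = "(real (Suc n))\<^sup>2 * pi / real D"
    let ?z = "(of_real \<sigma> + 1) / 2 :: complex"
    have b: "?b > 0" using D by simp
    have z: "Re ?z > 0" using s by (simp add: \<sigma>_def)
    let ?r = "\<lambda>u. exp ((\<sigma> + 1) * u - ?b * exp (2 * u))"
    have gz: "exp (2 * ?z * of_real u - of_real (?b * exp (2 * u))) = complex_of_real (?r u)" for u
    proof -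
      have "2 * ?z = of_real (\<sigma> + 1)" by simp
      thus ?thesis by (simp only: exp_of_real[symmetric] of_real_diff of_real_mult)
    qed
    have hb: "has_bochner_integral lborel (\<lambda>u. complex_of_real (?r u)) (Gamma ?z * exp (- ?z * of_real (ln ?b)) / 2)"
      using Gamma_exp_integral_scaled[OF z b] unfolding gz .
    have ir: "integrable lborel ?r" using hb by (simp add: has_bochner_integral_iff complex_of_real_integrable_eq)
    have "complex_of_real (LINT u|lborel. ?r u) = Gamma ?z * exp (- ?z * of_real (ln ?b)) / 2"
      using has_bochner_integral_integral_eq[OF hb] by (simp only: integral_complex_of_real)
    from arg_cong[OF this, of norm]
    have "\<bar>LINT u|lborel. ?r u\<bar> = norm (Gamma ?z * exp (- ?z * of_real (ln ?b)) / 2)" by (simp only: norm_of_real)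
    also have "\<dots> = norm (Gamma ?z) * norm (exp (- ?z * of_real (ln ?b))) / 2"
      by (simp only: norm_mult norm_divide norm_numeral)
    also have "norm (exp (- ?z * of_real (ln ?b))) = exp (- ((\<sigma> + 1) / 2) * ln ?b)"
    proof -
      have "- ?z * complex_of_real L = of_real (- ((\<sigma> + 1) / 2) * L)" for L by simp
      thus ?thesis by (simp only: norm_exp_eq_Re Re_complex_of_real)
    qed
    finally have v: "(LINT u|lborel. ?r u) \<le> norm (Gamma ?z) * exp (- ((\<sigma> + 1) / 2) * ln ?b) / 2" by linarith
    have pt: "norm (of_real (4 * phi_term X D n u) * exp ((s - 1/2) * of_real u)) \<le> 4 * real (Suc n) * ?r u" for u
    proof -
      have "norm (of_real (4 * phi_term X D n u) * exp ((s - 1/2) * of_real u)) =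
         \<bar>real_of_int (X (int (Suc n)))\<bar> * (4 * real (Suc n) * (exp (3 * u / 2 - ?b * exp (2 * u)) * exp ((\<sigma> - 1/2) * u)))"
        by (simp add: norm_mult phi_term_def abs_mult \<sigma>_def del: of_nat_Suc)
      also have "exp (3 * u / 2 - ?b * exp (2 * u)) * exp ((\<sigma> - 1/2) * u) = ?r u"
        unfolding exp_add[symmetric] by (rule arg_cong[where f = exp]) (simp add: algebra_simps)
      also have "\<bar>real_of_int (X (int (Suc n)))\<bar> * (4 * real (Suc n) * ?r u) \<le> 1 * (4 * real (Suc n) * ?r u)"
      proof (rule mult_right_mono)
        show "\<bar>real_of_int (X (int (Suc n)))\<bar> \<le> 1" using opc_abs_le[OF X, of "int (Suc n)"] by linarith
      qed simp
      finally show ?thesis by simp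
    qed
    have i: "integrable lborel (\<lambda>u. of_real (4 * phi_term X D n u) * exp ((s - 1/2) * of_real u))"
      using mellin_term[of s n] s by (simp add: has_bochner_integral_iff)
    have "(LINT u|lborel. norm (of_real (4 * phi_term X D n u) * exp ((s - 1/2) * of_real u))) \<le> (LINT u|lborel. 4 * real (Suc n) * ?r u)"
      by (rule integral_mono[OF integrable_norm[OF i] integrable_mult_right[OF ir] pt])
    also have "\<dots> = 4 * real (Suc n) * (LINT u|lborel. ?r u)" by (rule Bochner_Integration.integral_mult_right_zero)
    also have "\<dots> \<le> 4 * real (Suc n) * (norm (Gamma ?z) * exp (- ((\<sigma> + 1) / 2) * ln ?b) / 2)"
      by (rule mult_left_mono[OF v]) simp
    also have "\<dots> = 2 * norm (Gamma ?z) * (real (Suc n) * exp (- ((\<sigma> + 1) / 2) * ln ?b))" by simp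
    also have "\<dots> = ?C * real (Suc n) powr (- \<sigma>)" unfolding mellin_coeff by simp
    finally show ?thesis .
  qed
  have sm: "summable (\<lambda>n. ?C * real (Suc n) powr (- \<sigma>))"
  proof -
    have "summable (\<lambda>n. real n powr (- \<sigma>))" using s by (simp add: summable_real_powr_iff \<sigma>_def)
    thus ?thesis by (intro summable_mult) (subst summable_Suc_iff)
  qed
  show ?thesis
  proof (rule summable_comparison_test'[OF sm, of 0])
    fix n
    have "0 \<le> (LINT u|lborel. norm (of_real (4 * phi_term X D n u) * exp ((s - 1/2) * of_real u)))"
      by (rule Bochner_Integration.integral_nonneg) (rule norm_ge_zero)
    thus "norm (LINT u|lborel. norm (of_real (4 * phi_term X D n u) * exp ((s - 1/2) * of_real u))) \<le> ?C * real (Suc n) powr (- \<sigma>)"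
      using le[of n] by (simp only: real_norm_def abs_of_nonneg)
  qed
qed

text \<open>For \<open>Re s > 1\<close> the two-sided transform of the kernel is twice the completed \<open>L\<close>-function.\<close>
lemma mellin:
  assumes s: "Re s > 1"
  shows "integrable lborel (\<lambda>u. of_real (Phi D u) * exp ((s - 1/2) * of_real u))"
    and "(\<lambda>n. 2 * Gamma ((s + 1) / 2) * exp (- ((s + 1) / 2) * of_real (ln (pi / real D))) * (of_int (chi D (Suc n)) / of_nat (Suc n) powr s))
      sums (LINT u|lborel. of_real (Phi D u) * exp ((s - 1/2) * of_real u))"
proof -
  let ?f = "\<lambda>n u. of_real (4 * phi_term X D n u) * exp ((s - 1/2) * of_real u)"
  have hb: "has_bochner_integral lborel (?f n) (2 * Gamma ((s + 1) / 2) * exp (- ((s + 1) / 2) * of_real (ln (pi / real D))) * (of_int (chi D (Suc n)) / of_nat (Suc n) powr s))" for n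
    by (rule mellin_term) (use s in simp)
  have i: "integrable lborel (?f n)" for n using hb by (rule integrable.intros)
  have "summable (\<lambda>n. norm (?f n u))" for u
  proof -
    have "(\<lambda>n. norm (?f n u)) = (\<lambda>n. (4 * norm (exp ((s - 1/2) * of_real u))) * \<bar>phi_term X D n u\<bar>)"
      by (simp add: norm_mult abs_mult mult_ac)
    thus ?thesis by (simp only: summable_mult[OF phi_term_summable])
  qed
  hence ae: "AE u in lborel. summable (\<lambda>n. norm (?f n u))" by (intro AE_I2)
  have sf: "(\<lambda>u. \<Sum>n. ?f n u) = (\<lambda>u. of_real (Phi D u) * exp ((s - 1/2) * of_real u))"
  proof (rule ext)
    fix u
    have "(\<lambda>n. ?f n u) sums (of_real (Phi D u) * exp ((s - 1/2) * of_real u))"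
      by (intro sums_mult2 sums_of_real Phi_sums)
    thus "(\<Sum>n. ?f n u) = of_real (Phi D u) * exp ((s - 1/2) * of_real u)" by (rule sums_unique[symmetric])
  qed
  note S = i ae mellin_term_norm_summable[OF s]
  show "integrable lborel (\<lambda>u. of_real (Phi D u) * exp ((s - 1/2) * of_real u))"
    using integrable_suminf[OF S] unfolding sf .
  show "(\<lambda>n. 2 * Gamma ((s + 1) / 2) * exp (- ((s + 1) / 2) * of_real (ln (pi / real D))) * (of_int (chi D (Suc n)) / of_nat (Suc n) powr s))
      sums (LINT u|lborel. of_real (Phi D u) * exp ((s - 1/2) * of_real u))"
    using sums_integral[OF S] unfolding sf has_bochner_integral_integral_eq[OF hb] .
qed

end

section \<open>Analytic continuation of the L-function\<close>

definition exp_transform :: "(real \<Rightarrow> real) \<Rightarrow> complex \<Rightarrow> complex" where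
  "exp_transform \<phi> z = half_integral \<phi> (\<lambda>u. exp (z * of_real u))"

lemma exp_transform_holomorphic:
  assumes \<phi>: "rapid \<phi>" shows "exp_transform \<phi> holomorphic_on A"
proof -
  define c where "c k = half_integral \<phi> (\<lambda>u. of_real u ^ k / fact k)" for k
  have s: "(\<lambda>k. c k * z ^ k) sums exp_transform \<phi> z" for z
  proof -
    have "(\<lambda>k. half_integral \<phi> (\<lambda>u. (z * of_real u) ^ k / fact k)) sums half_integral \<phi> (\<lambda>u. exp (z * of_real u))"
    proof (rule half_integral_sums[OF \<phi>, where B = "exp (norm z powr (3/2))" and r = 0])
      fix u :: real and n :: nat assume u: "u \<ge> 0"
      have e: "(\<lambda>k. w ^ k / fact k) sums exp w" for w :: "'a::{real_normed_field,banach}"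
      proof -
        have "(\<lambda>k. w ^ k / fact k) = (\<lambda>k. w ^ k /\<^sub>R fact k)"
          by (rule ext) (simp add: scaleR_conv_of_real divide_inverse mult.commute)
        thus ?thesis using exp_converges[of w] by (simp only:)
      qed
      have "(\<Sum>k<n. norm ((z * of_real u) ^ k / fact k)) = (\<Sum>k<n. (u * norm z) ^ k / fact k)"
        using u by (simp add: norm_divide norm_power norm_mult mult.commute)
      also have "\<dots> \<le> exp (u * norm z)"
        using e[of "u * norm z"] sum_le_suminf[of "\<lambda>k. (u * norm z) ^ k / fact k" "{..<n}"] u by (simp add: sums_iff)
      also have "\<dots> \<le> exp (norm z powr (3/2)) * exp (0 * u\<^sup>2 + u ^ 3)"
        by (rule exp_linear_dominated) (use u in auto)
      finally show "(\<Sum>k<n. norm ((z * of_real u) ^ k / fact k)) \<le> exp (norm z powr (3/2)) * exp (0 * u\<^sup>2 + u ^ 3)" .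
      show "(\<lambda>k. (z * of_real u) ^ k / fact k) sums exp (z * of_real u)" by (rule e)
    qed auto
    moreover have "half_integral \<phi> (\<lambda>u. (z * of_real u) ^ k / fact k) = c k * z ^ k" for k
    proof -
      have "(\<lambda>u. (z * complex_of_real u) ^ k / fact k) = (\<lambda>u. z ^ k * (of_real u ^ k / fact k))"
        by (simp add: power_mult_distrib)
      thus ?thesis by (simp only: half_integral_cmult c_def mult.commute)
    qed
    ultimately show ?thesis by (simp add: exp_transform_def)
  qed
  have "exp_transform \<phi> field_differentiable (at z)" for z
  proof -
    have "((\<lambda>z. \<Sum>k. c k * z ^ k) has_field_derivative (\<Sum>k. diffs c k * z ^ k)) (at z)"
      by (rule termdiffs_strong_converges_everywhere) (use s in \<open>auto simp: sums_iff\<close>)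
    moreover have "(\<lambda>z. \<Sum>k. c k * z ^ k) = exp_transform \<phi>" using s by (auto simp: sums_iff)
    ultimately show ?thesis unfolding field_differentiable_def by metis
  qed
  thus ?thesis unfolding holomorphic_on_def by (blast intro: field_differentiable_at_within)
qed

lemma integral_split_at_zero:
  fixes f :: "real \<Rightarrow> complex"
  assumes f: "integrable lborel f"
  shows "(LINT u|lborel. f u) = (LINT u:{0..}|lborel. f u) + (LINT u:{0..}|lborel. f (- u))"
proof -
  have m [measurable]: "f \<in> borel_measurable lborel" using f by (rule borel_measurable_integrable)
  have m' [measurable]: "f \<in> borel_measurable borel" using m by simp
  have i1: "integrable lborel (\<lambda>u. indicat_real {0..} u *\<^sub>R f u)" by (rule integrable_mult_indicator[OF _ f]) simp
  have i2: "integrable lborel (\<lambda>u. indicat_real {..<0} u *\<^sub>R f u)" by (rule integrable_mult_indicator[OF _ f]) simp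
  have "(LINT u|lborel. f u) = (LINT u|lborel. indicat_real {0..} u *\<^sub>R f u + indicat_real {..<0} u *\<^sub>R f u)"
    by (rule Bochner_Integration.integral_cong) (auto simp: indicator_def)
  also have "\<dots> = (LINT u|lborel. indicat_real {0..} u *\<^sub>R f u) + (LINT u|lborel. indicat_real {..<0} u *\<^sub>R f u)"
    by (rule Bochner_Integration.integral_add[OF i1 i2])
  also have "(LINT u|lborel. indicat_real {..<0} u *\<^sub>R f u) = (LINT u|lborel. indicat_real {..<0} (- u) *\<^sub>R f (- u))"
    using lborel_integral_real_affine[of "-1" "\<lambda>u. indicat_real {..<0} u *\<^sub>R f u" 0] by simp
  also have "\<dots> = (LINT u|lborel. indicat_real {0..} u *\<^sub>R f (- u))"
  proof (rule integral_cong_AE)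
    show "AE u in lborel. indicat_real {..<0} (- u) *\<^sub>R f (- u) = indicat_real {0..} u *\<^sub>R f (- u)"
      using AE_lborel_singleton[of "0::real"] by eventually_elim (auto simp: indicator_def)
  qed measurable
  finally show ?thesis unfolding set_lebesgue_integral_def .
qed

context odd_char_setup
begin

text \<open>Folding the two-sided transform of the kernel to the half line with the reflection constant \<open>W\<close> gives an
  expression that is entire in \<open>s\<close>. The factor \<open>rGamma\<close> is used since it has no poles.\<close>
definition L_cont :: "complex \<Rightarrow> complex \<Rightarrow> complex" where
  "L_cont W s = rGamma ((s + 1) / 2) * exp ((s + 1) / 2 * of_real (ln (pi / real D))) *
     ((exp_transform (Phi D) (s - 1/2) + W * exp_transform (Phi D) (1/2 - s)) / 2)"

lemma L_cont_holomorphic: "L_cont W holomorphic_on UNIV"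
proof -
  have c: "(\<lambda>s. exp_transform (Phi D) (g s)) holomorphic_on UNIV" if "g holomorphic_on UNIV" for g
    using holomorphic_on_compose_gen[OF that exp_transform_holomorphic[OF rapid_Phi, of UNIV]] by (simp add: o_def)
  have "rGamma \<circ> (\<lambda>s::complex. (s + 1) / 2) holomorphic_on UNIV"
    by (rule holomorphic_on_compose_gen[OF _ holomorphic_rGamma]) (auto intro!: holomorphic_intros)
  hence r: "(\<lambda>s::complex. rGamma ((s + 1) / 2)) holomorphic_on UNIV" by (simp add: o_def)
  show ?thesis unfolding L_cont_def[abs_def] by (intro holomorphic_intros r c) auto
qed

lemma L_cont_series:
  assumes W: "\<And>u. complex_of_real (Phi D (- u)) = W * of_real (Phi D u)" and s: "Re s > 1"
  shows "(\<lambda>n. of_int (chi D (Suc n)) / of_nat (Suc n) powr s) sums L_cont W s"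
proof -
  let ?t = "\<lambda>n. of_int (chi D (Suc n)) / of_nat (Suc n) powr s :: complex"
  let ?z = "(s + 1) / 2" and ?l = "complex_of_real (ln (pi / real D))"
  let ?T = "exp_transform (Phi D) (s - 1/2) + W * exp_transform (Phi D) (1/2 - s)"
  have G: "Gamma ?z \<noteq> 0"
  proof -
    have "?z \<notin> \<int>\<^sub>\<le>\<^sub>0"
    proof
      assume "?z \<in> \<int>\<^sub>\<le>\<^sub>0"
      then obtain n where "?z = - of_nat n" by (rule nonpos_Ints_cases')
      hence "Re ?z = - real n" by simp
      thus False using s by simp
    qed
    thus ?thesis by (simp add: Gamma_eq_zero_iff)
  qed
  have "(LINT u|lborel. of_real (Phi D u) * exp ((s - 1/2) * of_real u)) = ?T"
  proof -
    have "(LINT u:{0..}|lborel. of_real (Phi D (- u)) * exp ((s - 1/2) * of_real (- u))) = W * exp_transform (Phi D) (1/2 - s)"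
    proof -
      have "(LINT u:{0..}|lborel. of_real (Phi D (- u)) * exp ((s - 1/2) * of_real (- u))) =
         (LINT u:{0..}|lborel. W * (of_real (Phi D u) * exp ((1/2 - s) * of_real u)))"
        unfolding W by (simp add: mult.assoc left_diff_distrib)
      also have "\<dots> = W * exp_transform (Phi D) (1/2 - s)"
        unfolding exp_transform_def half_integral_def by (rule set_integral_mult_right)
      finally show ?thesis .
    qed
    thus ?thesis using integral_split_at_zero[OF mellin(1)[OF s]]
      by (simp only: exp_transform_def[of _ "s - 1/2"] half_integral_def)
  qed
  with mellin(2)[OF s] have "(\<lambda>n. (2 * Gamma ?z * exp (- ?z * ?l)) * ?t n) sums ?T" by simp
  hence "(\<lambda>n. (rGamma ?z * exp (?z * ?l) / 2) * ((2 * Gamma ?z * exp (- ?z * ?l)) * ?t n)) sums ((rGamma ?z * exp (?z * ?l) / 2) * ?T)"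
    by (rule sums_mult)
  moreover have "(rGamma ?z * exp (?z * ?l) / 2) * ((2 * Gamma ?z * exp (- ?z * ?l)) * x) = x" for x
  proof -
    have "rGamma ?z * Gamma ?z = 1" using G by (simp add: rGamma_inverse_Gamma)
    moreover have "exp (?z * ?l) * exp (- ?z * ?l) = 1" by (simp add: exp_add[symmetric])
    moreover have "(rGamma ?z * exp (?z * ?l) / 2) * ((2 * Gamma ?z * exp (- ?z * ?l)) * x)
        = (rGamma ?z * Gamma ?z) * (exp (?z * ?l) * exp (- ?z * ?l)) * x" by (simp only: mult_ac) simp
    ultimately show ?thesis by (simp only: mult_1_left)
  qed
  ultimately have "?t sums ((rGamma ?z * exp (?z * ?l) / 2) * ?T)" by (simp only:)
  moreover have "(rGamma ?z * exp (?z * ?l) / 2) * ?T = L_cont W s" unfolding L_cont_def by simp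
  ultimately show ?thesis by (simp only:)
qed

lemma L_chi_eq_L_cont:
  assumes W: "\<And>u. complex_of_real (Phi D (- u)) = W * of_real (Phi D u)"
  shows "L_chi D = L_cont W"
  unfolding L_chi_def
proof (rule the_equality)
  show "L_cont W holomorphic_on UNIV \<and> (\<forall>s. 1 < Re s \<longrightarrow> (\<lambda>n. of_int (chi D (Suc n)) / of_nat (Suc n) powr s) sums L_cont W s)"
    using L_cont_holomorphic L_cont_series[OF W] by blast
  fix f assume f: "f holomorphic_on UNIV \<and> (\<forall>s. 1 < Re s \<longrightarrow> (\<lambda>n. of_int (chi D (Suc n)) / of_nat (Suc n) powr s) sums f s)"
  show "f = L_cont W"
  proof (rule ext)
    fix s
    show "f s = L_cont W s"
    proof (rule analytic_continuation_open[of "{s. Re s > 1}" UNIV f "L_cont W"])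
      have "2 \<in> {s. Re s > 1}" by simp
      thus "{s. Re s > 1} \<noteq> {}" by blast
      show "f z = L_cont W z" if "z \<in> {s. Re s > 1}" for z
        using f L_cont_series[OF W, of z] that sums_unique2 by blast
    qed (use f L_cont_holomorphic in \<open>auto simp: open_halfspace_Re_gt\<close>)
  qed
qed

lemma L_chi_series:
  assumes "Re s > 1" shows "(\<lambda>n. of_int (chi D (Suc n)) / of_nat (Suc n) powr s) sums L_chi D s"
proof -
  obtain W where "\<And>u. complex_of_real (Phi D (- u)) = W * of_real (Phi D u)" using Phi_reflection by blast
  thus ?thesis using L_chi_eq_L_cont L_cont_series[OF _ assms] by metis
qed

text \<open>Reflecting twice gives \<open>W\<^sup>2 = 1\<close>, and \<open>W = -1\<close> would force \<open>L (1/2) = 0\<close>.\<close>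
lemma Phi_even:
  assumes nz: "L_chi D (1/2) \<noteq> 0" shows "Phi D (- u) = Phi D u"
proof -
  obtain W where W: "\<And>u. complex_of_real (Phi D (- u)) = W * of_real (Phi D u)" using Phi_reflection by blast
  have ne: "(1 + W) * exp_transform (Phi D) 0 \<noteq> 0"
    using nz unfolding L_chi_eq_L_cont[OF W] L_cont_def by (simp add: distrib_right)
  have "\<exists>v. Phi D v \<noteq> 0"
  proof (rule ccontr)
    assume "\<not> ?thesis"
    hence "exp_transform (Phi D) 0 = 0" by (simp add: exp_transform_def half_integral_def)
    thus False using ne by simp
  qed
  then obtain v where v: "Phi D v \<noteq> 0" by blast
  have "complex_of_real (Phi D v) = W * (W * of_real (Phi D v))" using W[of "- v"] W[of v] by simp
  hence "W * W = 1" using v by (simp add: mult.assoc[symmetric])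
  hence "W = 1 \<or> W = -1" by (simp add: square_eq_1_iff)
  hence "W = 1" using ne by auto
  thus ?thesis using W[of u] by simp
qed

lemma L_chi_formula:
  assumes nz: "L_chi D (1/2) \<noteq> 0"
  shows "L_chi D s = rGamma ((s + 1) / 2) * exp ((s + 1) / 2 * of_real (ln (pi / real D))) * moment_series (Phi D) ((s - 1/2)\<^sup>2)"
proof -
  have W: "complex_of_real (Phi D (- u)) = 1 * of_real (Phi D u)" for u using Phi_even[OF nz, of u] by simp
  have i: "set_integrable lborel {0..} (\<lambda>u. complex_of_real (Phi D u) * exp (z * of_real u))" for z
  proof (rule rapid_integrable[OF rapid_Phi])
    show "dominated (\<lambda>u. exp (z * complex_of_real u)) (exp (norm z powr (3/2))) 0"
      unfolding dominated_def
    proof (intro allI impI)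
      fix u :: real assume u: "u \<ge> 0"
      have "norm (exp (z * complex_of_real u)) \<le> exp (u * norm z)"
        using norm_exp[of "z * complex_of_real u"] u by (simp add: norm_mult mult.commute)
      also have "\<dots> \<le> exp (norm z powr (3/2)) * exp (0 * u\<^sup>2 + u ^ 3)"
        by (rule exp_linear_dominated) (use u in auto)
      finally show "norm (exp (z * complex_of_real u)) \<le> exp (norm z powr (3/2)) * exp (0 * u\<^sup>2 + u ^ 3)" .
    qed
  qed measurable
  have "exp_transform (Phi D) z + exp_transform (Phi D) (- z) = half_integral (Phi D) (\<lambda>u. 2 * cosh (of_real u * z))" for z
  proof -
    have "exp_transform (Phi D) z + exp_transform (Phi D) (- z) = (LINT u:{0..}|lborel. complex_of_real (Phi D u) * exp (z * of_real u) + complex_of_real (Phi D u) * exp (- z * of_real u))"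
      unfolding exp_transform_def half_integral_def by (rule set_integral_add(2)[OF i i, symmetric])
    also have "\<dots> = half_integral (Phi D) (\<lambda>u. 2 * cosh (of_real u * z))"
    proof -
      have "2 * cosh (complex_of_real u * z) = exp (z * of_real u) + exp (- z * of_real u)" for u
        by (simp add: cosh_field_def mult.commute)
      thus ?thesis unfolding half_integral_def by (simp only: distrib_left)
    qed
    finally show ?thesis .
  qed
  hence "exp_transform (Phi D) z + exp_transform (Phi D) (- z) = 2 * moment_series (Phi D) (z\<^sup>2)" for z
    by (simp add: half_integral_cmult moment_series_square[OF rapid_Phi])
  from this[of "s - 1/2"] have "(exp_transform (Phi D) (s - 1/2) + 1 * exp_transform (Phi D) (1/2 - s)) / 2 = moment_series (Phi D) ((s - 1/2)\<^sup>2)"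
    by simp
  thus ?thesis unfolding L_chi_eq_L_cont[OF W] L_cont_def by (simp only:)
qed

text \<open>The terms with \<open>n \<ge> 2\<close> are at most \<open>1 / n\<^sup>2 \<le> 1 / (n - 1/2) - 1 / (n + 1/2)\<close>, which telescopes
  to \<open>2/3\<close>. A bound less than \<open>1\<close> is what excludes zeros.\<close>
lemma L_chi_real_bound:
  assumes s: "s \<ge> 2" shows "norm (L_chi D (of_real s) - 1) \<le> 2/3"
proof -
  let ?t = "\<lambda>n. of_int (chi D (Suc n)) / of_nat (Suc n) powr (of_real s) :: complex"
  have st: "?t sums L_chi D (of_real s)" by (rule L_chi_series) (use s in simp)
  have "?t 0 = 1" by (simp add: chi opc_one[OF X])
  hence st': "(\<lambda>n. ?t (Suc n)) sums (L_chi D (of_real s) - 1)" using st sums_Suc_iff[of ?t] by simp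
  have b: "norm (?t (Suc n)) \<le> 1 / (real n + 3/2) - 1 / (real (Suc n) + 3/2)" for n
  proof -
    let ?m = "real (Suc (Suc n))"
    have "norm (?t (Suc n)) = \<bar>real_of_int (chi D (Suc (Suc n)))\<bar> / ?m powr s"
      using norm_powr_real_powr'[of "complex_of_real s" "of_nat (Suc (Suc n))"]
      by (simp add: norm_divide del: of_nat_Suc)
    also have "\<dots> \<le> 1 / ?m powr 2"
    proof (rule frac_le)
      show "\<bar>real_of_int (chi D (Suc (Suc n)))\<bar> \<le> 1"
        using opc_abs_le[OF X, of "int (Suc (Suc n))"] chi[of "Suc (Suc n)"] by linarith
      show "?m powr 2 \<le> ?m powr s" using s by (intro powr_mono) auto
    qed auto
    also have "?m powr 2 = (real n + 2)\<^sup>2" by (simp add: powr_numeral)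
    also have "1 / (real n + 2)\<^sup>2 \<le> 1 / (real n + 3/2) - 1 / (real (Suc n) + 3/2)"
    proof -
      have "1 / (real n + 3/2) - 1 / (real (Suc n) + 3/2) = 1 / ((real n + 3/2) * (real n + 5/2))"
        by (simp add: field_simps)
      moreover have "(real n + 3/2) * (real n + 5/2) \<le> (real n + 2)\<^sup>2"
        by (simp add: power2_eq_square algebra_simps)
      ultimately show ?thesis by (simp add: frac_le)
    qed
    finally show ?thesis .
  qed
  have tel: "(\<lambda>n. 1 / (real n + 3/2) - 1 / (real (Suc n) + 3/2)) sums (1 / (real 0 + 3/2) - 0)"
  proof (rule telescope_sums')
    show "(\<lambda>n. 1 / (real n + 3/2)) \<longlonglongrightarrow> 0" by real_asymp
  qed
  have "norm (L_chi D (of_real s) - 1) = norm (\<Sum>n. ?t (Suc n))" using st' by (simp add: sums_iff)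
  also have "\<dots> \<le> (\<Sum>n. 1 / (real n + 3/2) - 1 / (real (Suc n) + 3/2))"
    by (rule norm_suminf_le[OF b]) (use tel in \<open>simp add: sums_iff\<close>)
  also have "\<dots> = 2/3" using tel by (simp add: sums_iff)
  finally show ?thesis .
qed

end

section \<open>Ordered enumeration of a discrete multiset of positive reals\<close>

text \<open>The defining property of the listing of ordinates, for an arbitrary multiplicity function in place of
  the one of an \<open>L\<close>-function.\<close>
definition enumerates :: "(real \<Rightarrow> nat) \<Rightarrow> (int \<Rightarrow> real) \<Rightarrow> bool" where
  "enumerates m \<gamma> \<longleftrightarrow>
     (\<forall>k. \<gamma> (- k) = - \<gamma> k) \<and> (\<forall>k\<ge>1. \<gamma> k > 0) \<and> mono_on {1..} \<gamma> \<and>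
     (\<forall>t>0. finite {k\<in>{1..}. \<gamma> k = t} \<and> card {k\<in>{1..}. \<gamma> k = t} = m t)"

lemma int_down_closed_eq_interval:
  fixes K :: "int set"
  assumes K: "finite K" "K \<subseteq> {1..}" and down: "\<And>j k. k \<in> K \<Longrightarrow> 1 \<le> j \<Longrightarrow> j \<le> k \<Longrightarrow> j \<in> K"
  shows "K = {1..int (card K)}"
proof (cases "K = {}")
  case False
  have MK: "Max K \<in> K" using K(1) False by (rule Max_in)
  have eq: "K = {1..Max K}"
  proof
    show "K \<subseteq> {1..Max K}" using K by auto
    show "{1..Max K} \<subseteq> K" using down[OF MK] by auto
  qed
  have "Max K \<ge> 1" using MK K(2) by auto
  moreover have "card K = nat (Max K)" by (subst eq) simp
  ultimately show ?thesis using eq by simp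
qed simp

locale multiplicity_function =
  fixes m :: "real \<Rightarrow> nat"
  assumes fin: "\<And>T. finite {t. 0 < t \<and> t \<le> T \<and> m t > 0}"
    and inf: "infinite {t. 0 < t \<and> m t > 0}"
begin

definition upto :: "real \<Rightarrow> real set" where "upto T = {t. 0 < t \<and> t \<le> T \<and> m t > 0}"
definition count :: "real \<Rightarrow> nat" where "count T = (\<Sum>t\<in>upto T. m t)"

lemma finite_upto: "finite (upto T)" using fin by (simp add: upto_def)

lemma count_mono: "S \<le> T \<Longrightarrow> count S \<le> count T"
  unfolding count_def by (rule sum_mono2[OF finite_upto]) (auto simp: upto_def)

lemma enumerates_positive_multiplicity:
  assumes "enumerates m \<gamma>" "k \<ge> 1" shows "m (\<gamma> k) > 0"
proof -
  have p: "\<gamma> k > 0" using assms by (auto simp: enumerates_def)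
  have "finite {j\<in>{1..}. \<gamma> j = \<gamma> k}" "card {j\<in>{1..}. \<gamma> j = \<gamma> k} = m (\<gamma> k)"
    using assms(1) p by (auto simp: enumerates_def)
  moreover have "k \<in> {j\<in>{1..}. \<gamma> j = \<gamma> k}" using assms(2) by simp
  ultimately show ?thesis by (metis card_gt_0_iff empty_iff)
qed

lemma enumerates_finite:
  assumes g: "enumerates m \<gamma>" shows "finite {k\<in>{1..}. \<gamma> k \<le> T}"
proof -
  have "{k\<in>{1..}. \<gamma> k \<le> T} \<subseteq> (\<Union>t\<in>upto T. {k\<in>{1..}. \<gamma> k = t})"
    using enumerates_positive_multiplicity[OF g] g by (auto simp: upto_def enumerates_def)
  moreover have "finite (\<Union>t\<in>upto T. {k\<in>{1..}. \<gamma> k = t})"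
    using g by (intro finite_UN_I finite_upto) (auto simp: enumerates_def upto_def)
  ultimately show ?thesis by (rule finite_subset)
qed

lemma sum_enumerates:
  fixes f :: "real \<Rightarrow> 'a :: comm_semiring_1"
  assumes g: "enumerates m \<gamma>"
  shows "(\<Sum>k\<in>{k\<in>{1..}. \<gamma> k \<le> T}. f (\<gamma> k)) = (\<Sum>t\<in>upto T. of_nat (m t) * f t)"
proof -
  let ?K = "{k\<in>{1..}. \<gamma> k \<le> T}"
  have "(\<Sum>k\<in>?K. f (\<gamma> k)) = (\<Sum>t\<in>upto T. \<Sum>k\<in>{k\<in>?K. \<gamma> k = t}. f (\<gamma> k))"
    by (rule sum.group[symmetric, OF enumerates_finite[OF g] finite_upto])
       (use enumerates_positive_multiplicity[OF g] g in \<open>auto simp: upto_def enumerates_def\<close>)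
  also have "\<dots> = (\<Sum>t\<in>upto T. of_nat (m t) * f t)"
  proof (rule sum.cong[OF refl])
    fix t assume t: "t \<in> upto T"
    have "{k\<in>?K. \<gamma> k = t} = {k\<in>{1..}. \<gamma> k = t}" using t by (auto simp: upto_def)
    moreover have "card {k\<in>{1..}. \<gamma> k = t} = m t" using g t by (auto simp: upto_def enumerates_def)
    ultimately show "(\<Sum>k\<in>{k\<in>?K. \<gamma> k = t}. f (\<gamma> k)) = of_nat (m t) * f t" by simp
  qed
  finally show ?thesis .
qed

text \<open>The indices \<open>k\<close> with \<open>\<gamma> k \<le> T\<close> form an initial segment, whose length is the number of points up to
  \<open>T\<close>. So the counting function determines the enumeration.\<close>
lemma enumerates_le_iff:
  assumes g: "enumerates m \<gamma>" and k: "k \<ge> 1"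
  shows "\<gamma> k \<le> T \<longleftrightarrow> k \<le> int (count T)"
proof -
  let ?K = "{k\<in>{1..}. \<gamma> k \<le> T}"
  have "card ?K = count T" using sum_enumerates[OF g, of "\<lambda>_. 1::nat" T] by (simp add: count_def)
  moreover have "?K = {1..int (card ?K)}"
  proof (rule int_down_closed_eq_interval[OF enumerates_finite[OF g]])
    fix j k assume "k \<in> ?K" "1 \<le> j" "j \<le> k"
    moreover have "mono_on {1..} \<gamma>" using g by (simp add: enumerates_def)
    hence "\<gamma> j \<le> \<gamma> k" by (rule mono_onD) (use calculation in auto)
    ultimately show "j \<in> ?K" by auto
  qed auto
  ultimately have "?K = {1..int (count T)}" by simp
  hence "k \<in> ?K \<longleftrightarrow> k \<in> {1..int (count T)}" by simp
  thus ?thesis using k by simp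
qed

lemma enumerates_unique:
  assumes "enumerates m \<gamma>" "enumerates m \<delta>" shows "\<gamma> = \<delta>"
proof (rule ext)
  have pos: "\<gamma> k = \<delta> k" if "k \<ge> 1" for k
    using enumerates_le_iff[OF assms(1) that] enumerates_le_iff[OF assms(2) that] by (metis antisym order_refl)
  fix k :: int
  have odd: "\<gamma> (- k) = - \<gamma> k" "\<delta> (- k) = - \<delta> k" for k using assms by (auto simp: enumerates_def)
  consider "k \<ge> 1" | "k = 0" | "- k \<ge> 1" by linarith
  thus "\<gamma> k = \<delta> k"
  proof cases
    case 2 thus ?thesis using odd[of 0] by simp
  next
    case 3 thus ?thesis using pos[OF 3] odd[of k] by simp
  qed (rule pos)
qed

lemma count_unbounded: "\<exists>t. 0 < t \<and> m t > 0 \<and> k \<le> count t"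
proof -
  obtain F where F: "F \<subseteq> {t. 0 < t \<and> m t > 0}" "finite F" "card F = Suc k"
    using infinite_arbitrarily_large[OF inf, of "Suc k"] by blast
  have ne: "F \<noteq> {}" using F by auto
  let ?T = "Max F"
  have sub: "F \<subseteq> upto ?T" using F by (auto simp: upto_def)
  have "k \<le> card F" using F by simp
  also have "\<dots> = (\<Sum>t\<in>F. 1)" by simp
  also have "\<dots> \<le> (\<Sum>t\<in>F. m t)" using F by (intro sum_mono) auto
  also have "\<dots> \<le> count ?T" unfolding count_def by (rule sum_mono2[OF finite_upto sub]) simp
  finally show ?thesis using Max_in[OF F(2) ne] F(1) by blast
qed

text \<open>The least point \<open>t\<close> with \<open>k \<le> count t\<close>. The minimum is taken over a finite set of points, up to some
  bound by which \<open>k\<close> points have occurred.\<close>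
definition nth_point :: "nat \<Rightarrow> real" where
  "nth_point k = Min (upto (SOME T. k \<le> count T) \<inter> {t. k \<le> count t})"

lemma nth_point_le_iff:
  assumes k: "k \<ge> 1" shows "nth_point k \<le> T \<longleftrightarrow> k \<le> count T"
    and "nth_point k > 0"
proof -
  define T0 where "T0 = (SOME T. k \<le> count T)"
  have T0: "k \<le> count T0" unfolding T0_def by (rule someI_ex) (use count_unbounded[of k] in blast)
  let ?A = "upto T0 \<inter> {t. k \<le> count t}"
  have top: "\<exists>t\<in>upto S. count t = count S" if "k \<le> count S" for S
  proof -
    have ne: "upto S \<noteq> {}" using that k by (auto simp: count_def)
    have M: "Max (upto S) \<in> upto S" by (rule Max_in[OF finite_upto ne])
    have "upto (Max (upto S)) = upto S" using M finite_upto[of S] by (auto simp: upto_def)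
    thus ?thesis using M by (metis count_def)
  qed
  have fA: "finite ?A" by (intro finite_Int disjI1 finite_upto)
  have neA: "?A \<noteq> {}" using top[OF T0] T0 by (metis IntI empty_iff mem_Collect_eq)
  have n: "nth_point k = Min ?A" by (simp add: nth_point_def T0_def)
  have inA: "nth_point k \<in> ?A" unfolding n by (rule Min_in[OF fA neA])
  show "nth_point k > 0" using inA by (auto simp: upto_def)
  show "nth_point k \<le> T \<longleftrightarrow> k \<le> count T"
  proof
    assume "nth_point k \<le> T"
    thus "k \<le> count T" using inA count_mono[of "nth_point k" T] by auto
  next
    assume T: "k \<le> count T"
    obtain t where t: "t \<in> upto T" "count t = count T" using top[OF T] by blast
    show "nth_point k \<le> T"
    proof (cases "t \<le> T0")
      case True
      hence "t \<in> ?A" using t T by (auto simp: upto_def)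
      hence "nth_point k \<le> t" unfolding n using fA by simp
      thus ?thesis using t by (auto simp: upto_def)
    next
      case False
      thus ?thesis using inA t by (auto simp: upto_def)
    qed
  qed
qed

text \<open>The fibre of \<open>t\<close> consists of the indices between the number of points below \<open>t\<close> and the number of
  points up to \<open>t\<close>.\<close>
lemma enumerates_exists: "\<exists>\<gamma>. enumerates m \<gamma>"
proof -
  define \<gamma> where "\<gamma> k = (if k \<ge> 1 then nth_point (nat k) else if k \<le> -1 then - nth_point (nat (- k)) else 0)" for k :: int
  have le: "\<gamma> k \<le> T \<longleftrightarrow> nat k \<le> count T" if "k \<ge> 1" for k T
    using nth_point_le_iff(1)[of "nat k" T] that by (simp add: \<gamma>_def)
  have pos: "\<gamma> k > 0" if "k \<ge> 1" for k
    using nth_point_le_iff(2)[of "nat k"] that by (simp add: \<gamma>_def)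
  have fib: "finite {k\<in>{1..}. \<gamma> k = t} \<and> card {k\<in>{1..}. \<gamma> k = t} = m t" if t: "t > 0" for t
  proof -
    define c where "c = (\<Sum>s\<in>upto t - {t}. m s)"
    have ct: "count t = c + m t"
    proof (cases "t \<in> upto t")
      case True thus ?thesis unfolding count_def c_def using sum.remove[OF finite_upto True, of m] by simp
    next
      case False
      hence "m t = 0" using t by (auto simp: upto_def)
      thus ?thesis using False by (simp add: count_def c_def)
    qed
    have lt: "\<gamma> k < t \<longleftrightarrow> nat k \<le> c" if k: "k \<ge> 1" for k
    proof
      assume l: "\<gamma> k < t"
      have "nat k \<le> count (\<gamma> k)" using le[OF k] by blast
      also have "\<dots> \<le> c" unfolding count_def c_def
        by (rule sum_mono2) (use l finite_upto in \<open>auto simp: upto_def\<close>)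
      finally show "nat k \<le> c" .
    next
      assume kc: "nat k \<le> c"
      have ne: "upto t - {t} \<noteq> {}"
      proof
        assume "upto t - {t} = {}"
        hence "c = 0" by (simp only: c_def sum.empty)
        thus False using kc k by simp
      qed
      have fi: "finite (upto t - {t})" using finite_upto by simp
      let ?M = "Max (upto t - {t})"
      have M: "?M \<in> upto t - {t}" by (rule Max_in[OF fi ne])
      have "upto t - {t} = upto ?M" using M fi by (auto simp: upto_def)
      hence "nat k \<le> count ?M" using kc by (simp add: c_def count_def)
      hence "\<gamma> k \<le> ?M" using le[OF k] by blast
      also have "?M < t" using M by (auto simp: upto_def)
      finally show "\<gamma> k < t" .
    qed
    have "{k\<in>{1..}. \<gamma> k = t} = {int c + 1..int (count t)}"
    proof (rule Set.set_eqI)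
      fix k :: int
      have "\<gamma> k = t \<longleftrightarrow> \<gamma> k \<le> t \<and> \<not> \<gamma> k < t" by auto
      hence "\<gamma> k = t \<longleftrightarrow> nat k \<le> count t \<and> c < nat k" if "k \<ge> 1" using le[OF that, of t] lt[OF that] by auto
      thus "k \<in> {k\<in>{1..}. \<gamma> k = t} \<longleftrightarrow> k \<in> {int c + 1..int (count t)}" by auto
    qed
    thus ?thesis using ct by simp
  qed
  have mono: "mono_on {1..} \<gamma>"
  proof (rule mono_onI)
    fix j k :: int assume jk: "j \<in> {1..}" "k \<in> {1..}" "j \<le> k"
    have "nat k \<le> count (\<gamma> k)" using le[of k "\<gamma> k"] jk by simp
    hence "nat j \<le> count (\<gamma> k)" using jk by simp
    thus "\<gamma> j \<le> \<gamma> k" using le[of j] jk by simp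
  qed
  have "\<gamma> (- k) = - \<gamma> k" for k by (simp add: \<gamma>_def)
  hence "enumerates m \<gamma>" unfolding enumerates_def using pos mono fib by blast
  thus ?thesis by blast
qed

end

section \<open>The zeros of the completed L-function\<close>

locale grh_setup = odd_char_setup +
  assumes nz_half: "L_chi D (1/2) \<noteq> 0"
    and grh: "\<And>s. nontrivial_zero D s \<Longrightarrow> Re s = 1/2"
begin

abbreviation E :: "complex \<Rightarrow> complex" where "E \<equiv> moment_series (Phi D)"

text \<open>The reciprocal of the archimedean factor \<open>(D/pi)\<^bsup>(s+1)/2\<^esup> \<Gamma>((s+1)/2)\<close>; its zeros are the trivial zeros
  of the \<open>L\<close>-function.\<close>
definition gamma_factor :: "complex \<Rightarrow> complex" where
  "gamma_factor s = rGamma ((s + 1) / 2) * exp ((s + 1) / 2 * of_real (ln (pi / real D)))"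

lemma L_chi_eq: "L_chi D s = gamma_factor s * E ((s - 1/2)\<^sup>2)"
  using L_chi_formula[OF nz_half] by (simp add: gamma_factor_def)

lemma gamma_factor_holomorphic: "gamma_factor holomorphic_on UNIV"
proof -
  have "rGamma \<circ> (\<lambda>s::complex. (s + 1) / 2) holomorphic_on UNIV"
    by (rule holomorphic_on_compose_gen[OF _ holomorphic_rGamma]) (auto intro!: holomorphic_intros)
  hence r: "(\<lambda>s::complex. rGamma ((s + 1) / 2)) holomorphic_on UNIV" by (simp add: o_def)
  show ?thesis unfolding gamma_factor_def[abs_def] by (intro holomorphic_intros r) auto
qed

lemma gamma_factor_zero:
  assumes "gamma_factor s = 0" shows "\<exists>k::nat. s = - of_nat (2 * k + 1)"
proof -
  have "(s + 1) / 2 \<in> \<int>\<^sub>\<le>\<^sub>0" using assms by (simp add: gamma_factor_def rGamma_eq_zero_iff)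
  then obtain n where n: "(s + 1) / 2 = - of_nat n" by (rule nonpos_Ints_cases')
  hence "s + 1 = - of_nat n * 2" by (simp add: field_simps)
  hence "s = - of_nat n * 2 - 1" by (rule eq_diff_eq[THEN iffD2])
  hence "s = - of_nat (2 * n + 1)" by simp
  thus ?thesis by blast
qed

text \<open>This is the functional equation \<open>\<Gamma>(z + 1) = z \<Gamma>(z)\<close>.\<close>
lemma gamma_factor_real_step:
  assumes s: "s \<ge> (2::real)"
  shows "norm (gamma_factor (of_real (s + 2))) * ((s + 1) / 2 * (real D / pi)) = norm (gamma_factor (of_real s))"
    and "norm (gamma_factor (of_real s)) > 0"
proof -
  let ?z = "(complex_of_real s + 1) / 2" and ?l = "complex_of_real (ln (pi / real D))"
  have r1: "rGamma (?z + 1) * ?z = rGamma ?z" using rGamma_plus1[of ?z] by (simp add: mult.commute)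
  have zs: "(complex_of_real (s + 2) + 1) / 2 = ?z + 1" by (simp add: field_simps)
  have es: "exp ((?z + 1) * ?l) = exp (?z * ?l) * of_real (pi / real D)"
  proof -
    have "exp ?l = of_real (pi / real D)" using D by (simp only: exp_of_real) simp
    thus ?thesis by (simp only: distrib_right exp_add mult_1_left)
  qed
  have "gamma_factor (of_real (s + 2)) * (?z * of_real (real D / pi)) = gamma_factor (of_real s) * (of_real (pi / real D) * of_real (real D / pi))"
    unfolding gamma_factor_def zs es r1[symmetric] by (simp only: mult_ac)
  moreover have "complex_of_real (pi / real D) * of_real (real D / pi) = 1" using D by simp
  ultimately have "gamma_factor (of_real (s + 2)) * (?z * of_real (real D / pi)) = gamma_factor (of_real s)" by (simp only: mult_1_right)
  from arg_cong[OF this, of norm]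
  have "norm (gamma_factor (of_real (s + 2))) * (norm ?z * \<bar>real D / pi\<bar>) = norm (gamma_factor (of_real s))"
    by (simp only: norm_mult norm_of_real)
  moreover have "\<bar>real D / pi\<bar> = real D / pi" by simp
  moreover have "norm ?z = (s + 1) / 2"
  proof -
    have "?z = of_real ((s + 1) / 2)" by simp
    hence "norm ?z = \<bar>(s + 1) / 2\<bar>" by (simp only: norm_of_real)
    thus ?thesis using s by simp
  qed
  ultimately show "norm (gamma_factor (of_real (s + 2))) * ((s + 1) / 2 * (real D / pi)) = norm (gamma_factor (of_real s))" by (simp only:)
  have "gamma_factor (of_real s) \<noteq> 0"
  proof
    assume "gamma_factor (of_real s) = 0"
    then obtain k where "complex_of_real s = - of_nat (2 * k + 1)" using gamma_factor_zero by blast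
    hence "Re (complex_of_real s) = Re (- of_nat (2 * k + 1))" by (simp only:)
    thus False using s by simp
  qed
  thus "norm (gamma_factor (of_real s)) > 0" by simp
qed

lemma L_chi_norm_bounds:
  assumes "s \<ge> 2" shows "norm (L_chi D (of_real s)) \<ge> 1/3" "norm (L_chi D (of_real s)) \<le> 5/3" "Re (L_chi D (of_real s)) > 0"
proof -
  note b = L_chi_real_bound[OF assms]
  show "norm (L_chi D (of_real s)) \<ge> 1/3"
    using b norm_triangle_ineq2[of 1 "1 - L_chi D (of_real s)"] by (simp add: norm_minus_commute)
  show "norm (L_chi D (of_real s)) \<le> 5/3"
    using b norm_triangle_ineq[of "L_chi D (of_real s) - 1" 1] by simp
  have "\<bar>Re (L_chi D (of_real s) - 1)\<bar> \<le> 2/3" using order_trans[OF abs_Re_le_cmod b] .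
  thus "Re (L_chi D (of_real s)) > 0" unfolding minus_complex.simps one_complex.simps abs_le_iff by simp
qed

text \<open>The points are \<open>(s - 1/2)\<^sup>2\<close> and \<open>(s + 2 - 1/2)\<^sup>2\<close>. Between \<open>s\<close> and \<open>s + 2\<close> the archimedean factor grows
  by \<open>(s + 1) D / (2 pi)\<close>, and the \<open>L\<close>-values lie between \<open>1/3\<close> and \<open>5/3\<close> in modulus, which costs at
  most a factor \<open>5\<close>.\<close>
lemma E_growth:
  assumes s: "s \<ge> (2::real)"
  shows "norm (E (of_real ((s + 3/2)\<^sup>2))) \<ge> (s + 1) * real D / (10 * pi) * norm (E (of_real ((s - 1/2)\<^sup>2)))"
    and "E (of_real ((s - 1/2)\<^sup>2)) \<noteq> 0"
proof -
  have L: "L_chi D (of_real s) = gamma_factor (of_real s) * E (of_real ((s - 1/2)\<^sup>2))" for s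
    using L_chi_eq[of "of_real s"] by simp
  let ?g = "norm (gamma_factor (of_real s))" and ?h = "norm (gamma_factor (of_real (s + 2)))"
  let ?a = "norm (E (of_real ((s - 1/2)\<^sup>2)))" and ?b = "norm (E (of_real ((s + 3/2)\<^sup>2)))"
  let ?q = "(s + 1) / 2 * (real D / pi)"
  have q: "?q > 0" using s D by simp
  have step: "?h * ?q = ?g" and gp: "?g > 0" using gamma_factor_real_step[OF s] by auto
  have hp: "?h > 0" by (rule gamma_factor_real_step(2)) (use s in simp)
  have 1: "?g * ?a \<le> 5/3" using L_chi_norm_bounds(2)[OF s] unfolding L[of s] by (simp only: norm_mult)
  have sh: "s + 2 - 1/2 = s + 3/2" by simp
  have "s + 2 \<ge> 2" using s by simp
  from L_chi_norm_bounds(1)[OF this] have 2: "1/3 \<le> ?h * ?b" unfolding L[of "s + 2"] sh norm_mult .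
  have "?h * (?q * ?a) = ?g * ?a" using step by (simp only: mult.assoc[symmetric])
  also have "\<dots> \<le> 5 * (?h * ?b)" using 1 2 by linarith
  finally have "?h * (?q * ?a) \<le> ?h * (5 * ?b)" by simp
  hence "?q * ?a \<le> 5 * ?b" using hp by (simp only: mult_le_cancel_left_pos)
  moreover have "A / 5 \<le> B" if "A \<le> 5 * B" for A B :: real using that by simp
  ultimately have "?q * ?a / 5 \<le> ?b" by blast
  moreover have "(s + 1) * real D / (10 * pi) * ?a = ?q * ?a / 5" by simp
  ultimately show "?b \<ge> (s + 1) * real D / (10 * pi) * ?a" by (simp only:)
  show "E (of_real ((s - 1/2)\<^sup>2)) \<noteq> 0"
  proof
    assume "E (of_real ((s - 1/2)\<^sup>2)) = 0"
    hence "L_chi D (of_real s) = 0" unfolding L by simp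
    thus False using L_chi_norm_bounds(1)[OF s] by simp
  qed
qed

lemma E_0: "E 0 \<noteq> 0"
  using nz_half unfolding L_chi_eq by auto

text \<open>A zero of the transform is a zero of \<open>L\<close> at \<open>s = 1/2 + \<i> x\<close>. If it is nontrivial, it lies on the
  critical line. At a trivial zero \<open>s\<close> the transform cannot vanish: it depends only on
  \<open>(s - 1/2)\<^sup>2\<close>, and \<open>1 - s \<ge> 2\<close> lies in the region of absolute convergence.\<close>
lemma real_zeros_Phi: "real_zeros (Phi D)"
  unfolding real_zeros_def
proof (intro allI impI)
  fix x assume "cos_transform (Phi D) x = 0"
  hence Ex: "E (- x\<^sup>2) = 0" by (simp add: cos_transform_eq[OF rapid_Phi])
  define s where "s = 1/2 + \<i> * x"
  have sq: "(s - 1/2)\<^sup>2 = - x\<^sup>2" by (simp add: s_def power_mult_distrib)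
  show "x \<in> \<real>"
  proof (cases "\<exists>k::nat. s = - of_nat (2 * k + 1)")
    case False
    have "L_chi D s = 0" unfolding L_chi_eq sq Ex by simp
    hence "Re s = 1/2" using grh False unfolding nontrivial_zero_def by blast
    thus ?thesis by (simp add: s_def complex_is_Real_iff)
  next
    case True
    then obtain k :: nat where k: "s = - of_nat (2 * k + 1)" by blast
    define r where "r = 2 * real k + 2"
    have "complex_of_real ((r - 1/2)\<^sup>2) = (s - 1/2)\<^sup>2"
      unfolding k r_def by (simp add: power2_eq_square algebra_simps)
    hence "E (of_real ((r - 1/2)\<^sup>2)) = 0" using Ex unfolding sq by simp
    moreover have "r \<ge> 2" by (simp add: r_def)
    ultimately show ?thesis using E_growth(2) by blast
  qed
qed

lemma LP_E: "LP_class E"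
  by (rule real_zeros_imp_LP_class[OF rapid_Phi real_zeros_Phi])

lemma E_pos: "Re (E (of_real (9/4))) > 0"
proof -
  have sq: "(complex_of_real 2 - 1/2)\<^sup>2 = of_real (9/4)" by (simp add: power2_eq_square)
  have L: "L_chi D (of_real 2) = gamma_factor (of_real 2) * E (of_real (9/4))"
    unfolding L_chi_eq[of "of_real 2"] sq ..
  have "gamma_factor (of_real 2) = of_real (rGamma (3/2) * exp (3/2 * ln (pi / real D)))"
  proof -
    have z: "(complex_of_real 2 + 1) / 2 = of_real (3/2)" by simp
    show ?thesis unfolding gamma_factor_def z by (simp only: rGamma_complex_of_real of_real_mult exp_of_real[symmetric])
  qed
  moreover have "rGamma (3/2::real) > 0" using Gamma_real_pos[of "3/2"] by (simp add: rGamma_inverse_Gamma)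
  moreover have "0 < rGamma (3/2) * exp (3/2 * ln (pi / real D))" using calculation(2) by (rule mult_pos_pos) simp
  ultimately obtain c where c: "gamma_factor (of_real 2) = of_real c" "c > 0" by blast
  have "Re (L_chi D (of_real 2)) > 0" by (rule L_chi_norm_bounds(3)) simp
  hence "c * Re (E (of_real (9/4))) > 0" unfolding L c(1) by simp
  thus ?thesis using c(2) by (simp add: zero_less_mult_iff)
qed

text \<open>On the critical line away from \<open>1/2\<close> the archimedean factor does not vanish and \<open>s \<mapsto> (s - 1/2)\<^sup>2\<close>
  is locally injective, so orders of zeros are preserved.\<close>
lemma critical_multiplicity_eq:
  assumes t: "t > 0"
  shows "critical_multiplicity D t = (if E (- of_real (t\<^sup>2)) = 0 then nat (zorder E (- of_real (t\<^sup>2))) else 0)"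
    and "critical_multiplicity D t > 0 \<longleftrightarrow> E (- of_real (t\<^sup>2)) = 0"
proof -
  let ?s = "Complex (1/2) t" and ?a = "- complex_of_real (t\<^sup>2)"
  have s: "?s = 1/2 + \<i> * of_real t" by (simp add: complex_eq_iff)
  have sq: "(?s - 1/2)\<^sup>2 = ?a" unfolding s by (simp add: power_mult_distrib)
  have g: "gamma_factor ?s \<noteq> 0"
  proof
    assume "gamma_factor ?s = 0"
    then obtain k where "?s = - of_nat (2 * k + 1)" using gamma_factor_zero by blast
    hence "Im ?s = Im (- of_nat (2 * k + 1))" by (simp only:)
    thus False using t by simp
  qed
  have L0: "L_chi D ?s = 0 \<longleftrightarrow> E ?a = 0" unfolding L_chi_eq sq using g by simp
  have z: "zorder (L_chi D) ?s = zorder E ?a \<and> zorder E ?a > 0" if E0: "E ?a = 0"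
  proof -
    have hol: "E holomorphic_on UNIV" by (rule LP_class_holo[OF LP_E])
    obtain n k where k: "n > 0" "k holomorphic_on UNIV" "k ?a \<noteq> 0" "\<And>w. E w = (w - ?a) ^ n * k w"
      using divide_out_zero[OF hol E0 E_0] by blast
    have zE: "zorder E ?a = int n"
      by (rule zorder_eqI[OF open_UNIV UNIV_I k(2,3)]) (simp add: k(4))
    define h where "h w = gamma_factor w * (w - 1/2 + \<i> * of_real t) ^ n * k ((w - 1/2)\<^sup>2)" for w
    have hk: "(\<lambda>w. k ((w - 1/2)\<^sup>2)) holomorphic_on UNIV"
    proof -
      have "(\<lambda>w::complex. (w - 1/2)\<^sup>2) holomorphic_on UNIV" by (intro holomorphic_intros)
      from holomorphic_on_compose_gen[OF this k(2)] show ?thesis by (simp add: o_def)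
    qed
    have "zorder (L_chi D) ?s = int n"
    proof (rule zorder_eqI[OF open_UNIV UNIV_I])
      show "h holomorphic_on UNIV" unfolding h_def[abs_def]
        by (intro holomorphic_intros gamma_factor_holomorphic hk)
      have "?s - 1/2 + \<i> * of_real t = 2 * \<i> * of_real t" unfolding s by simp
      thus "h ?s \<noteq> 0" unfolding h_def sq using g k(3) t by simp
      show "L_chi D w = h w * (w - ?s) powi int n" for w
      proof -
        have "(w - 1/2)\<^sup>2 - ?a = (w - 1/2 + \<i> * of_real t) * (w - ?s)"
          unfolding s by (simp add: power2_eq_square algebra_simps)
        thus ?thesis unfolding L_chi_eq k(4) h_def by (simp add: power_mult_distrib)
      qed
    qed
    thus ?thesis using zE k(1) by simp
  qed
  show "critical_multiplicity D t = (if E ?a = 0 then nat (zorder E ?a) else 0)"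
    using z L0 by (auto simp: critical_multiplicity_def)
  thus "critical_multiplicity D t > 0 \<longleftrightarrow> E ?a = 0" using z by auto
qed

lemma zeros_bij:
  "bij_betw (\<lambda>t. - complex_of_real (t\<^sup>2)) {t. 0 < t \<and> t \<le> sqrt R \<and> critical_multiplicity D t > 0} {a. E a = 0 \<and> norm a \<le> R}"
proof (rule bij_betw_imageI)
  let ?Z = "{t. 0 < t \<and> t \<le> sqrt R \<and> critical_multiplicity D t > 0}"
  show "inj_on (\<lambda>t. - complex_of_real (t\<^sup>2)) ?Z"
  proof (rule inj_onI)
    fix x y assume "x \<in> ?Z" "y \<in> ?Z" and e: "- complex_of_real (x\<^sup>2) = - of_real (y\<^sup>2)"
    hence "0 < x" "0 < y" by auto
    moreover have "x\<^sup>2 = y\<^sup>2" using e by (simp only: neg_equal_iff_equal of_real_eq_iff)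
    ultimately show "x = y" by (simp add: power2_eq_iff_nonneg)
  qed
  show "(\<lambda>t. - complex_of_real (t\<^sup>2)) ` ?Z = {a. E a = 0 \<and> norm a \<le> R}"
  proof
    show "(\<lambda>t. - complex_of_real (t\<^sup>2)) ` ?Z \<subseteq> {a. E a = 0 \<and> norm a \<le> R}"
    proof
      fix a assume "a \<in> (\<lambda>t. - complex_of_real (t\<^sup>2)) ` ?Z"
      then obtain t where t: "a = - complex_of_real (t\<^sup>2)" "0 < t" "t \<le> sqrt R" "critical_multiplicity D t > 0" by blast
      have "norm a = t\<^sup>2" unfolding t(1) norm_minus_cancel norm_of_real by simp
      also have "\<dots> \<le> R"
      proof -
        have "R > 0" using t(2,3) by (metis less_le_trans real_sqrt_gt_0_iff)
        thus ?thesis using power_mono[OF t(3), of 2] t(2) by simp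
      qed
      finally show "a \<in> {a. E a = 0 \<and> norm a \<le> R}" using t critical_multiplicity_eq(2)[OF t(2)] by simp
    qed
    show "{a. E a = 0 \<and> norm a \<le> R} \<subseteq> (\<lambda>t. - complex_of_real (t\<^sup>2)) ` ?Z"
    proof
      fix a assume "a \<in> {a. E a = 0 \<and> norm a \<le> R}"
      hence a: "E a = 0" "norm a \<le> R" by auto
      have "a \<in> \<real>\<^sub>\<le>\<^sub>0" by (rule LP_class_zero[OF LP_E a(1)])
      then obtain x where x: "a = of_real x" "x \<le> 0" by (rule nonpos_Reals_cases)
      have "x \<noteq> 0" using a(1) E_0 x(1) by auto
      define t where "t = sqrt (- x)"
      have t: "t > 0" "t\<^sup>2 = - x" using x(2) \<open>x \<noteq> 0\<close> by (auto simp: t_def)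
      have at: "a = - complex_of_real (t\<^sup>2)" unfolding t(2) x(1) by simp
      have "- x \<le> R" using a(2) x by simp
      hence "t \<le> sqrt R" by (simp add: t_def)
      moreover have "critical_multiplicity D t > 0" using critical_multiplicity_eq(2)[OF t(1)] a(1) at by simp
      ultimately show "a \<in> (\<lambda>t. - complex_of_real (t\<^sup>2)) ` ?Z" using at t(1) by blast
    qed
  qed
qed

lemma zero_ordinate:
  assumes "E a = 0"
  obtains t where "a = - complex_of_real (t\<^sup>2)" "t > 0" "critical_multiplicity D t > 0"
proof -
  have "a \<in> {b. E b = 0 \<and> norm b \<le> norm a}" using assms by simp
  hence "a \<in> (\<lambda>t. - complex_of_real (t\<^sup>2)) ` {t. 0 < t \<and> t \<le> sqrt (norm a) \<and> critical_multiplicity D t > 0}"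
    by (simp only: bij_betw_imp_surj_on[OF zeros_bij[of "norm a"]])
  then obtain t where "a = - complex_of_real (t\<^sup>2)" "t \<in> {t. 0 < t \<and> t \<le> sqrt (norm a) \<and> critical_multiplicity D t > 0}"
    by (rule imageE)
  thus thesis using that by simp
qed

text \<open>On the real axis the cosine is bounded by \<open>1\<close>.\<close>
lemma cos_transform_bounded: "\<exists>M. \<forall>x::real. norm (E (- of_real (x\<^sup>2))) \<le> M"
proof (intro exI allI)
  fix x :: real
  have "dominated (\<lambda>u. cos (of_real u * complex_of_real x)) 1 0"
    unfolding dominated_def
  proof (intro allI impI)
    fix u :: real assume u: "u \<ge> 0"
    have "cos (of_real u * complex_of_real x) = of_real (cos (u * x))" by (simp add: cos_of_real[symmetric])
    hence "norm (cos (of_real u * complex_of_real x)) \<le> 1" by (simp only: norm_of_real abs_cos_le_one)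
    also have "\<dots> \<le> 1 * exp (0 * u\<^sup>2 + u ^ 3)" using u by simp
    finally show "norm (cos (of_real u * complex_of_real x)) \<le> 1 * exp (0 * u\<^sup>2 + u ^ 3)" .
  qed
  from half_integral_norm_bound[OF rapid_Phi _ this]
  have "norm (cos_transform (Phi D) (of_real x)) \<le> 1 * (LINT u:{0..}|lborel. \<bar>Phi D u\<bar> * exp (0 * u\<^sup>2 + u ^ 3))"
    unfolding cos_transform_def by simp
  thus "norm (E (- of_real (x\<^sup>2))) \<le> 1 * (LINT u:{0..}|lborel. \<bar>Phi D u\<bar> * exp (0 * u\<^sup>2 + u ^ 3))"
    by (simp add: cos_transform_eq[OF rapid_Phi])
qed

lemma E_nonconstant: "\<exists>w. E w \<noteq> E 0"
proof (rule ccontr)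
  assume "\<not> ?thesis"
  hence c: "E w = E 0" for w by blast
  define s where "s = 2 + 10 * pi / real D"
  have s: "s \<ge> 2" using D by (simp add: s_def)
  have "(s + 1) * real D > 10 * pi" using D by (simp add: s_def field_simps add_pos_pos)
  hence "(s + 1) * real D / (10 * pi) > 1" by simp
  hence "(s + 1) * real D / (10 * pi) * norm (E 0) > 1 * norm (E 0)" using E_0 by (intro mult_strict_right_mono) auto
  thus False using E_growth(1)[OF s] c by (metis mult_1 not_le)
qed

text \<open>With finitely many zeros \<open>E\<close> would be a polynomial by the product formula, and not constant; but it
  is bounded on the negative axis.\<close>
lemma infinitely_many_zeros: "infinite {a. E a = 0}"
proof
  assume fin: "finite {a. E a = 0}"
  let ?Z = "{a. E a = 0}"
  have Z0: "?Z \<noteq> {}"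
  proof
    assume "?Z = {}"
    hence "E z \<noteq> 0" for z by blast
    hence "E z = E 0" for z by (rule LP_class_no_zeros_constant[OF LP_E])
    thus False using E_nonconstant by blast
  qed
  then obtain a0 where a0: "E a0 = 0" by blast
  have "\<exists>B. \<forall>a\<in>?Z. norm a \<le> B" using finite_imp_bounded[OF fin] unfolding bounded_iff .
  then obtain B where B: "\<And>a. a \<in> ?Z \<Longrightarrow> norm a \<le> B" by blast
  have zp: "zero_product E (real n) z = (\<Prod>a\<in>?Z. (1 - z / a) ^ nat (zorder E a))" if "real n \<ge> B" for n z
  proof -
    have "{a. E a = 0 \<and> norm a \<le> real n} = ?Z" using B that by force
    thus ?thesis by (simp add: zero_product_def)
  qed
  have Eprod: "E z = E 0 * (\<Prod>a\<in>?Z. (1 - z / a) ^ nat (zorder E a))" for z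
  proof (rule LIMSEQ_unique[OF LP_class_hadamard_pointwise[OF LP_E E_0]])
    have "\<forall>\<^sub>F n in sequentially. E 0 * (\<Prod>a\<in>?Z. (1 - z / a) ^ nat (zorder E a)) = E 0 * zero_product E (real n) z"
      using eventually_ge_at_top[of "nat \<lceil>B\<rceil>"]
    proof eventually_elim
      case (elim n)
      hence "real n \<ge> B" by linarith
      thus ?case by (simp only: zp)
    qed
    thus "(\<lambda>n. E 0 * zero_product E (real n) z) \<longlonglongrightarrow> E 0 * (\<Prod>a\<in>?Z. (1 - z / a) ^ nat (zorder E a))"
      by (rule Lim_transform_eventually[OF tendsto_const])
  qed
  obtain M where M: "\<And>x::real. norm (E (- of_real (x\<^sup>2))) \<le> M" using cos_transform_bounded by blast
  have zpos: "nat (zorder E a) > 0" if a: "E a = 0" for a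
  proof -
    obtain t where t: "a = - complex_of_real (t\<^sup>2)" "t > 0" "critical_multiplicity D t > 0"
      by (rule zero_ordinate[OF a])
    thus ?thesis using critical_multiplicity_eq(1)[OF t(2)] a by simp
  qed
  have a0n: "a0 \<noteq> 0" using a0 E_0 by auto
  \<comment> \<open>At \<open>- y\<close> every factor has modulus at least \<open>1\<close>, and the factor of \<open>a0\<close> alone exceeds the bound.\<close>
  define y where "y = 3 * \<bar>B\<bar> + (\<bar>M\<bar> / norm (E 0) + 2) * norm a0"
  have y0: "y \<ge> 0" by (simp add: y_def)
  define z where "z = - complex_of_real ((sqrt y)\<^sup>2)"
  have nzz: "norm z = y" unfolding z_def using y0 by simp
  have big: "norm (1 - z / a) \<ge> y / norm a - 1" for a
    using norm_triangle_ineq2[of "z / a" 1] nzz by (simp add: norm_divide norm_minus_commute)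
  have f1: "1 \<le> norm ((1 - z / a) ^ nat (zorder E a))" if a: "a \<in> ?Z" for a
  proof -
    have an: "a \<noteq> 0" using a E_0 by auto
    have "3 * norm a \<le> y"
    proof -
      have "norm a \<le> \<bar>B\<bar>" using B[OF a] by linarith
      moreover have "0 \<le> (\<bar>M\<bar> / norm (E 0) + 2) * norm a0" by simp
      ultimately show ?thesis unfolding y_def by linarith
    qed
    hence "3 \<le> y / norm a" using an by (simp add: field_simps)
    hence "1 \<le> norm (1 - z / a)" using big[of a] by linarith
    thus ?thesis unfolding norm_power by (rule one_le_power)
  qed
  have f2: "norm ((1 - z / a0) ^ nat (zorder E a0)) \<ge> \<bar>M\<bar> / norm (E 0) + 1"
  proof -
    have "(\<bar>M\<bar> / norm (E 0) + 2) * norm a0 \<le> y" by (simp add: y_def)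
    hence "\<bar>M\<bar> / norm (E 0) + 2 \<le> y / norm a0" using a0n by (simp add: pos_le_divide_eq)
    hence l: "\<bar>M\<bar> / norm (E 0) + 1 \<le> norm (1 - z / a0)" using big[of a0] by linarith
    have "0 \<le> \<bar>M\<bar> / norm (E 0)" by simp
    hence "1 \<le> norm (1 - z / a0)" using l by linarith
    hence "norm (1 - z / a0) ^ 1 \<le> norm (1 - z / a0) ^ nat (zorder E a0)"
      using zpos[OF a0] by (intro power_increasing) auto
    thus ?thesis using l unfolding norm_power by simp
  qed
  have "norm (\<Prod>a\<in>?Z. (1 - z / a) ^ nat (zorder E a)) = norm ((1 - z / a0) ^ nat (zorder E a0)) * norm (\<Prod>a\<in>?Z - {a0}. (1 - z / a) ^ nat (zorder E a))"
    using prod.remove[OF fin, of a0 "\<lambda>a. (1 - z / a) ^ nat (zorder E a)"] a0 by (simp add: norm_mult)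
  also have "\<dots> \<ge> (\<bar>M\<bar> / norm (E 0) + 1) * 1"
  proof (rule mult_mono[OF f2])
    show "1 \<le> norm (\<Prod>a\<in>?Z - {a0}. (1 - z / a) ^ nat (zorder E a))"
      unfolding prod_norm[symmetric] by (intro prod_ge_1 f1) auto
  qed auto
  finally have "norm (\<Prod>a\<in>?Z. (1 - z / a) ^ nat (zorder E a)) > \<bar>M\<bar> / norm (E 0)" by simp
  hence "norm (E 0) * norm (\<Prod>a\<in>?Z. (1 - z / a) ^ nat (zorder E a)) > \<bar>M\<bar>" using E_0 by (simp add: field_simps)
  hence "norm (E z) > \<bar>M\<bar>" unfolding Eprod[of z] norm_mult .
  thus False using M[of "sqrt y"] unfolding z_def[symmetric] by linarith
qed

sublocale multiplicity_function "critical_multiplicity D"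
proof
  fix T :: real
  show "finite {t. 0 < t \<and> t \<le> T \<and> critical_multiplicity D t > 0}"
  proof (cases "T \<ge> 0")
    case True
    hence "sqrt (T\<^sup>2) = T" by simp
    thus ?thesis using bij_betw_finite[OF zeros_bij[of "T\<^sup>2"]] finite_zeros_cball[OF LP_class_holo[OF LP_E] E_0, of "T\<^sup>2"] by simp
  next
    case False
    hence "{t. 0 < t \<and> t \<le> T \<and> critical_multiplicity D t > 0} = {}" by auto
    thus ?thesis by (simp only: finite.emptyI)
  qed
next
  show "infinite {t. 0 < t \<and> critical_multiplicity D t > 0}"
  proof
    assume "finite {t. 0 < t \<and> critical_multiplicity D t > 0}"
    moreover have "{a. E a = 0} \<subseteq> (\<lambda>t. - complex_of_real (t\<^sup>2)) ` {t. 0 < t \<and> critical_multiplicity D t > 0}"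
    proof
      fix a assume "a \<in> {a. E a = 0}"
      hence "E a = 0" by simp
      then obtain t where "a = - complex_of_real (t\<^sup>2)" "t > 0" "critical_multiplicity D t > 0"
        by (rule zero_ordinate)
      thus "a \<in> (\<lambda>t. - complex_of_real (t\<^sup>2)) ` {t. 0 < t \<and> critical_multiplicity D t > 0}" by simp
    qed
    ultimately show False using infinitely_many_zeros finite_surj by blast
  qed
qed

lemma enumerates_ordinate: "enumerates (critical_multiplicity D) (ordinate D)"
proof -
  have "ordinate D = (THE \<gamma>. enumerates (critical_multiplicity D) \<gamma>)"
    unfolding ordinate_def ordinate_enumeration_def enumerates_def ..
  thus ?thesis using theI'[of "enumerates (critical_multiplicity D)"] enumerates_exists enumerates_unique by metis
qed

text \<open>The zeros of \<open>E\<close> are the numbers \<open>- t\<^sup>2\<close> with \<open>t\<close> an ordinate, and multiplicities agree.\<close>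
lemma zero_sum_ordinates:
  "zero_sum E j R = of_real (\<Sum>k\<in>{k\<in>{1..}. ordinate D k \<le> sqrt R}. (1 / (ordinate D k)\<^sup>2) ^ j)"
proof -
  have fin: "finite {a. E a = 0 \<and> norm a \<le> R}" by (rule finite_zeros_cball[OF LP_class_holo[OF LP_E] E_0])
  have "zero_sum E j R = (\<Sum>a\<in>{a. E a = 0 \<and> norm a \<le> R}. \<Sum>i<nat (zorder E a). (- 1 / a) ^ j)"
    unfolding zero_sum_def zero_index_def using fin by (subst sum.Sigma) (auto simp: case_prod_unfold)
  also have "\<dots> = (\<Sum>a\<in>{a. E a = 0 \<and> norm a \<le> R}. of_nat (nat (zorder E a)) * (- 1 / a) ^ j)" by simp
  also have "\<dots> = (\<Sum>t\<in>upto (sqrt R). of_nat (nat (zorder E (- of_real (t\<^sup>2)))) * (- 1 / (- of_real (t\<^sup>2))) ^ j)"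
    unfolding upto_def by (rule sum.reindex_bij_betw[OF zeros_bij, symmetric])
  also have "\<dots> = (\<Sum>t\<in>upto (sqrt R). complex_of_real (of_nat (critical_multiplicity D t) * (1 / t\<^sup>2) ^ j))"
  proof (rule sum.cong[OF refl])
    fix t assume "t \<in> upto (sqrt R)"
    hence t: "t > 0" "critical_multiplicity D t > 0" by (auto simp: upto_def)
    hence "nat (zorder E (- of_real (t\<^sup>2))) = critical_multiplicity D t" using critical_multiplicity_eq[OF t(1)] by simp
    thus "of_nat (nat (zorder E (- of_real (t\<^sup>2)))) * (- 1 / (- of_real (t\<^sup>2))) ^ j = complex_of_real (of_nat (critical_multiplicity D t) * (1 / t\<^sup>2) ^ j)"
      by simp
  qed
  also have "\<dots> = of_real (\<Sum>t\<in>upto (sqrt R). of_nat (critical_multiplicity D t) * (1 / t\<^sup>2) ^ j)" by simp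
  also have "(\<Sum>t\<in>upto (sqrt R). of_nat (critical_multiplicity D t) * (1 / t\<^sup>2) ^ j) = (\<Sum>k\<in>{k\<in>{1..}. ordinate D k \<le> sqrt R}. (1 / (ordinate D k)\<^sup>2) ^ j)"
    by (rule sum_enumerates[OF enumerates_ordinate, symmetric])
  finally show ?thesis .
qed

end

section \<open>From the gap hypothesis to a lower bound for the threshold\<close>

text \<open>With \<open>p = b - a\<close> and \<open>q = a + b\<close> one has \<open>1 / p\<^sup>2 + 1 / q\<^sup>2 \<ge> 2 / (p q)\<close> and
  \<open>p q = b\<^sup>2 - a\<^sup>2 \<le> b\<^sup>2\<close>. For \<open>a = b\<close> the right side is infinite.\<close>
lemma inverse_square_pair_bound:
  fixes a b :: real
  assumes a: "0 < a" "a \<le> b"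
  shows "ennreal (2 / b\<^sup>2) \<le> 1 / ennreal ((- a - b)\<^sup>2) + 1 / ennreal ((a - b)\<^sup>2)"
proof (cases "a = b")
  case False
  define p q where "p = b - a" and "q = a + b"
  have pq: "p > 0" "q > 0" using a False by (auto simp: p_def q_def)
  have sq: "(- a - b)\<^sup>2 = q\<^sup>2" "(a - b)\<^sup>2 = p\<^sup>2"
    by (simp_all add: p_def q_def power2_eq_square algebra_simps)
  have "p * q \<le> b\<^sup>2" by (simp add: p_def q_def power2_eq_square algebra_simps)
  hence "2 / b\<^sup>2 \<le> 2 / (p * q)" using pq a by (intro divide_left_mono) auto
  also have "\<dots> = 1 / q\<^sup>2 + 1 / p\<^sup>2 - (1 / q - 1 / p)\<^sup>2"
    using pq by (simp add: power2_diff power_one_over)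
  also have "\<dots> \<le> 1 / q\<^sup>2 + 1 / p\<^sup>2" by simp
  finally have "ennreal (2 / b\<^sup>2) \<le> ennreal (1 / q\<^sup>2 + 1 / p\<^sup>2)" by (rule ennreal_leI)
  also have "\<dots> = ennreal (1 / q\<^sup>2) + ennreal (1 / p\<^sup>2)" by (rule ennreal_plus) auto
  also have "ennreal (1 / q\<^sup>2) = 1 / ennreal (q\<^sup>2)" using divide_ennreal[of 1 "q\<^sup>2"] pq by simp
  also have "ennreal (1 / p\<^sup>2) = 1 / ennreal (p\<^sup>2)" using divide_ennreal[of 1 "p\<^sup>2"] pq by simp
  finally show ?thesis unfolding sq .
qed simp

context grh_setup begin

lemma ordinate_props:
  "ordinate D (- k) = - ordinate D k" "k \<ge> 1 \<Longrightarrow> ordinate D k > 0"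
  "1 \<le> j \<Longrightarrow> j \<le> k \<Longrightarrow> ordinate D j \<le> ordinate D k"
  using enumerates_ordinate mono_onD[of "{1..}" "ordinate D" j k] unfolding enumerates_def by auto

text \<open>The indices \<open>k\<close> and \<open>- k\<close> give equal terms, each at least \<open>2 / \<gamma>\<^sub>k\<^sup>2\<close>.\<close>
lemma g0_ge_inverse_square_sum:
  "ennreal (4 * (\<Sum>k\<in>{2..N}. 1 / (ordinate D k)\<^sup>2)) \<le> g0 D"
proof -
  define f where "f j = 1 / ennreal ((ordinate D (-1) - ordinate D j)\<^sup>2) + 1 / ennreal ((ordinate D 1 - ordinate D j)\<^sup>2)" for j
  have fk: "ennreal (2 / (ordinate D k)\<^sup>2) \<le> f k" if "k \<in> {2..N}" for k
    unfolding f_def ordinate_props(1)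
    by (rule inverse_square_pair_bound) (use that ordinate_props(2,3) in auto)
  have fm: "f (- k) = f k" for k
  proof -
    have "(- ordinate D 1 - - ordinate D k)\<^sup>2 = (ordinate D 1 - ordinate D k)\<^sup>2"
      "(ordinate D 1 - - ordinate D k)\<^sup>2 = (- ordinate D 1 - ordinate D k)\<^sup>2"
      by (simp_all add: power2_eq_square algebra_simps)
    thus ?thesis unfolding f_def ordinate_props(1) by (simp only: add.commute)
  qed
  have "ennreal (4 * (\<Sum>k\<in>{2..N}. 1 / (ordinate D k)\<^sup>2)) = ennreal (\<Sum>k\<in>{2..N}. 2 / (ordinate D k)\<^sup>2 + 2 / (ordinate D k)\<^sup>2)"
    by (simp add: sum_distrib_left)
  also have "\<dots> = (\<Sum>k\<in>{2..N}. ennreal (2 / (ordinate D k)\<^sup>2 + 2 / (ordinate D k)\<^sup>2))" by (simp add: sum_ennreal)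
  also have "\<dots> = (\<Sum>k\<in>{2..N}. ennreal (2 / (ordinate D k)\<^sup>2) + ennreal (2 / (ordinate D k)\<^sup>2))"
    by (intro sum.cong refl ennreal_plus) auto
  also have "\<dots> \<le> (\<Sum>k\<in>{2..N}. f k + f (- k))"
    unfolding fm by (intro sum_mono add_mono fk)
  also have "\<dots> = (\<Sum>k\<in>{2..N}. f k) + (\<Sum>k\<in>uminus ` {2..N}. f k)"
  proof -
    have "inj_on uminus {2..N}" by (simp add: inj_on_def)
    thus ?thesis by (simp only: sum.distrib sum.reindex o_def)
  qed
  also have "\<dots> = sum f ({2..N} \<union> uminus ` {2..N})"
    by (rule sum.union_disjoint[symmetric]) auto
  also have "\<dots> \<le> infsum f (UNIV - {-1, 0, 1})"
    by (subst nonneg_infsum_complete) (auto intro!: SUP_upper)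
  finally show ?thesis unfolding g0_def f_def .
qed

definition ordinate_set :: "nat \<Rightarrow> int set" where
  "ordinate_set n = {k\<in>{1..}. ordinate D k \<le> sqrt (real n)}"

definition power_sum :: "nat \<Rightarrow> nat \<Rightarrow> real" where
  "power_sum j n = (\<Sum>k\<in>ordinate_set n. (1 / (ordinate D k)\<^sup>2) ^ j)"

text \<open>The hypothesis bounds the tail \<open>\<Sum>k\<ge>2. 1 / \<gamma>\<^sub>k\<^sup>2\<close> by \<open>1 / (20 \<gamma>\<^sub>1\<^sup>2)\<close>. So the first power sum is at most
  \<open>21/20\<close> of its first term, the second one is at least the square of that term, and
  \<open>5 (21/20)\<^sup>2 \<le> 6\<close>.\<close>
lemma power_sum_inequality:
  assumes hyp: "5 * ennreal ((ordinate D 1)\<^sup>2) * g0 D < 1" and n: "ordinate D 1 \<le> sqrt (real n)"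
  shows "6 * ((power_sum 1 n)\<^sup>2 - power_sum 2 n) \<le> (power_sum 1 n)\<^sup>2"
proof -
  define N where "N = int (count (sqrt (real n)))"
  have eq: "ordinate_set n = {1..N}"
    unfolding N_def ordinate_set_def using enumerates_le_iff[OF enumerates_ordinate] by auto
  have "1 \<in> ordinate_set n" using n by (simp add: ordinate_set_def)
  hence "N \<ge> 1" unfolding eq by simp
  hence split: "ordinate_set n = insert 1 {2..N}" unfolding eq by auto
  let ?q = "1 / (ordinate D 1)\<^sup>2" and ?T = "\<Sum>k\<in>{2..N}. 1 / (ordinate D k)\<^sup>2"
  have o1: "ordinate D 1 > 0" by (rule ordinate_props(2)) simp
  have T0: "?T \<ge> 0" by (intro sum_nonneg) auto
  have p1: "power_sum 1 n = ?q + ?T" unfolding power_sum_def split by simp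
  have p2: "power_sum 2 n \<ge> ?q\<^sup>2" unfolding power_sum_def split by (simp add: sum_nonneg)
  have "ennreal (20 * (ordinate D 1)\<^sup>2 * ?T) = 5 * ennreal ((ordinate D 1)\<^sup>2) * ennreal (4 * ?T)"
  proof -
    have "5 * ennreal ((ordinate D 1)\<^sup>2) * ennreal (4 * ?T) = ennreal 5 * ennreal ((ordinate D 1)\<^sup>2) * ennreal (4 * ?T)"
      by simp
    also have "\<dots> = ennreal (5 * (ordinate D 1)\<^sup>2 * (4 * ?T))" 
      using T0 by (simp only: ennreal_mult[of "5 * (ordinate D 1)\<^sup>2"] ennreal_mult[of 5] mult_nonneg_nonneg zero_le_power2 zero_le_numeral)
    also have "5 * (ordinate D 1)\<^sup>2 * (4 * ?T) = 20 * (ordinate D 1)\<^sup>2 * ?T" by simp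
    finally show ?thesis by (rule sym)
  qed
  also have "\<dots> \<le> 5 * ennreal ((ordinate D 1)\<^sup>2) * g0 D" by (intro mult_left_mono g0_ge_inverse_square_sum) simp
  also have "\<dots> < 1" by (rule hyp)
  finally have "20 * (ordinate D 1)\<^sup>2 * ?T < 1"
    by (simp only: ennreal_1[symmetric]) (use ennreal_less_iff in simp)
  hence "20 * ?T \<le> ?q" using o1 by (simp add: field_simps)
  hence "20 * power_sum 1 n \<le> 21 * ?q" using p1 by linarith
  moreover have "0 \<le> 20 * power_sum 1 n" using T0 unfolding p1 by simp
  ultimately have "(20 * power_sum 1 n)\<^sup>2 \<le> (21 * ?q)\<^sup>2" by (rule power_mono)
  hence "400 * (power_sum 1 n)\<^sup>2 \<le> 441 * ?q\<^sup>2" by (simp only: power_mult_distrib) simp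
  moreover have "6 * (x - y) \<le> x" if "400 * x \<le> 441 * z" "z \<le> y" "0 \<le> z" for x y z :: real
  proof -
    have "400 * x \<le> 441 * y" "0 \<le> y" using that by auto
    thus ?thesis by (simp add: field_simps)
  qed
  ultimately show ?thesis using p2 zero_le_power2 by blast
qed

abbreviation m :: "nat \<Rightarrow> real" where "m \<equiv> moment (Phi D)"

lemma E_derivs:
  "E 0 = of_real (m 0)" "deriv E 0 = of_real (m 1 / 2)" "(deriv ^^ 2) E 0 = of_real (m 2 / 12)"
  using higher_deriv_moment_series[OF rapid_Phi, of 0] higher_deriv_moment_series[OF rapid_Phi, of 1]
    higher_deriv_moment_series[OF rapid_Phi, of 2]
  by (simp_all add: fact_numeral)

lemma m0_pos: "m 0 > 0"
proof -
  have "moment (gauss_weight 0 (Phi D)) 0 \<ge> 0"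
    by (rule moments_nonneg_backward[OF rapid_Phi, of 0 "9/4"]) (use real_zeros_Phi E_pos in simp_all)
  moreover have "m 0 \<noteq> 0" using E_0 E_derivs(1) by simp
  ultimately show ?thesis by simp
qed

text \<open>The inequality between partial power sums passes to the limit, where these sums become quotients of
  moments.\<close>
lemma turan_inequality:
  assumes hyp: "5 * ennreal ((ordinate D 1)\<^sup>2) * g0 D < 1"
  shows "2 * m 0 * m 2 \<le> (m 1)\<^sup>2"
proof -
  have zs: "zero_sum E j (real n) = of_real (power_sum j n)" for j n
    unfolding zero_sum_ordinates power_sum_def ordinate_set_def ..
  have l1: "power_sum 1 \<longlonglongrightarrow> m 1 / (2 * m 0)"
    using coeff1_limit[OF LP_E E_0] unfolding zs E_derivs of_real_divide[symmetric] tendsto_of_real_iff by simp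
  have "(\<lambda>n. complex_of_real ((power_sum 1 n)\<^sup>2 - power_sum 2 n)) \<longlonglongrightarrow> of_real (m 2 / 12 / m 0)"
    using coeff2_limit[OF LP_E E_0] unfolding zs E_derivs by simp
  hence l2: "(\<lambda>n. (power_sum 1 n)\<^sup>2 - power_sum 2 n) \<longlonglongrightarrow> m 2 / 12 / m 0" unfolding tendsto_of_real_iff .
  have "6 * (m 2 / 12 / m 0) \<le> (m 1 / (2 * m 0))\<^sup>2"
  proof (rule tendsto_le[OF sequentially_bot tendsto_power[OF l1] tendsto_mult[OF tendsto_const l2]])
    have "filterlim (\<lambda>n. sqrt (real n)) at_top sequentially"
      by (rule filterlim_compose[OF sqrt_at_top filterlim_real_sequentially])
    hence "\<forall>\<^sub>F n in sequentially. ordinate D 1 \<le> sqrt (real n)" by (simp add: filterlim_at_top)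
    thus "\<forall>\<^sub>F n in sequentially. 6 * ((power_sum 1 n)\<^sup>2 - power_sum 2 n) \<le> (power_sum 1 n)\<^sup>2"
      by eventually_elim (rule power_sum_inequality[OF hyp])
  qed
  thus ?thesis using m0_pos by (simp add: field_simps power2_eq_square)
qed

text \<open>The value of \<open>E\<close> grows by at least \<open>3 D / (10 pi)\<close> from \<open>9/4\<close> to \<open>49/4\<close>, the points belonging to
  \<open>s = 2\<close> and \<open>s = 4\<close>, and by at most the exponential of \<open>10\<close> times the logarithmic derivative at
  \<open>0\<close>, which is \<open>m 1 / (2 m 0)\<close>.\<close>
lemma moment_ratio_bound:
  "ln (3 * real D / (10 * pi)) \<le> 5 * m 1 / m 0"
proof -
  have s: "((2::real) - 1/2)\<^sup>2 = 9/4" "((2::real) + 3/2)\<^sup>2 = 49/4" by (simp_all add: power2_eq_square)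
  have E: "norm (E (of_real (9/4))) > 0" "3 * real D / (10 * pi) * norm (E (of_real (9/4))) \<le> norm (E (of_real (49/4)))"
    using E_growth[of 2] unfolding s by simp_all
  have "norm (E (of_real (49/4))) \<le> norm (E (of_real (9/4))) * exp ((49/4 - 9/4) * Re (deriv E 0 / E 0))"
    by (rule LP_class_growth_on_pos_axis[OF LP_E E_0]) auto
  also have "(49/4 - 9/4) * Re (deriv E 0 / E 0) = 5 * m 1 / m 0"
    unfolding E_derivs of_real_divide[symmetric] Re_complex_of_real using m0_pos by (simp add: field_simps)
  finally have "3 * real D / (10 * pi) * norm (E (of_real (9/4))) \<le> exp (5 * m 1 / m 0) * norm (E (of_real (9/4)))"
    using E(2) by (simp only: mult.commute[of _ "exp _"])
  hence "3 * real D / (10 * pi) \<le> exp (5 * m 1 / m 0)" using E(1) by (simp only: mult_le_cancel_right_pos)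
  moreover have "3 * real D / (10 * pi) > 0" using D by simp
  ultimately have "ln (3 * real D / (10 * pi)) \<le> ln (exp (5 * m 1 / m 0))" by (simp only: ln_mono)
  thus ?thesis by simp
qed

text \<open>The threshold is at least \<open>- 2 m 0 / m 1\<close>, and the ratio of moments is controlled by \<open>D\<close>.\<close>
theorem Lambda_lower_bound:
  assumes hyp: "5 * ennreal ((ordinate D 1)\<^sup>2) * g0 D < 1" and c: "ln (3 * real D / (10 * pi)) > 0"
  shows "Lambda D \<ge> - (10 / ln (3 * real D / (10 * pi)))"
proof -
  let ?c = "ln (3 * real D / (10 * pi))"
  have "0 < 5 * m 1 / m 0" using moment_ratio_bound c by linarith
  hence m1: "m 1 > 0" using m0_pos by (simp add: zero_less_divide_iff)
  have "?c * m 0 \<le> 5 * m 1" using moment_ratio_bound m0_pos by (simp add: pos_le_divide_eq)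
  hence r: "2 * m 0 / m 1 \<le> 10 / ?c" using m1 c by (simp add: field_simps)
  obtain l where l: "\<And>t. real_zeros (gauss_weight t (Phi D)) \<longleftrightarrow> l \<le> t" "l \<ge> - (2 * m 0 / m 1)"
    using deformation_threshold[OF rapid_Phi real_zeros_Phi _ _ turan_inequality[OF hyp] m1, of "9/4"] E_pos by auto
  have "(\<forall>x. Xi D t x = 0 \<longrightarrow> x \<in> \<real>) \<longleftrightarrow> real_zeros (gauss_weight t (Phi D))" for t
    unfolding real_zeros_def Xi_def cos_transform_def half_integral_def ..
  hence th: "\<forall>t. (\<forall>x. Xi D t x = 0 \<longrightarrow> x \<in> \<real>) \<longleftrightarrow> t \<ge> l" by (simp only: l(1)) simp
  have "Lambda D = l" unfolding Lambda_def
  proof (rule the_equality)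
    show "\<forall>t. (\<forall>x. Xi D t x = 0 \<longrightarrow> x \<in> \<real>) \<longleftrightarrow> t \<ge> l" by (rule th)
  next
    fix l' assume "\<forall>t. (\<forall>x. Xi D t x = 0 \<longrightarrow> x \<in> \<real>) \<longleftrightarrow> t \<ge> l'"
    hence "t \<ge> l' \<longleftrightarrow> t \<ge> l" for t using th by blast
    from this[of l] this[of l'] show "l' = l" by simp
  qed
  thus ?thesis using l(2) r by linarith
qed

end

theorem theorem2:
  assumes "GRH_plus"
    and "infinite {D. neg_fund_disc D \<and> 5 * ennreal ((ordinate D 1)\<^sup>2) * g0 D < 1}"
  shows "0 \<le> Lambda_Kr"
proof (rule ereal_le_epsilon2)
  fix \<epsilon> :: real assume e: "0 < \<epsilon>"
  \<comment> \<open>The size of \<open>D\<close> at which the lower bound for \<open>Lambda D\<close> reaches \<open>- \<epsilon>\<close>.\<close>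
  define M where "M = exp (10 / \<epsilon>) * (10 * pi) / 3"
  obtain D where D_large: "D \<ge> nat \<lceil>M\<rceil>" "neg_fund_disc D" "5 * ennreal ((ordinate D 1)\<^sup>2) * g0 D < 1"
    using assms(2) unfolding infinite_nat_iff_unbounded_le by blast
  obtain X where "odd_char_setup D X" using neg_fund_disc_setup[OF D_large(2)] .
  then interpret odd_char_setup D X .
  interpret grh_setup D X
    by unfold_locales (use assms(1) D_large(2) in \<open>auto simp: GRH_plus_def\<close>)
  have "real D \<ge> M" using D_large(1) by linarith
  hence "exp (10 / \<epsilon>) \<le> 3 * real D / (10 * pi)" by (simp add: M_def field_simps)
  hence "ln (exp (10 / \<epsilon>)) \<le> ln (3 * real D / (10 * pi))" by (rule ln_mono[OF _ exp_gt_zero])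
  hence c: "10 / \<epsilon> \<le> ln (3 * real D / (10 * pi))" by simp
  have c0: "10 / \<epsilon> > 0" using e by simp
  have "x \<le> \<epsilon> * y \<Longrightarrow> 0 < y \<Longrightarrow> x / y \<le> \<epsilon>" for x y :: real by (simp add: pos_divide_le_eq)
  moreover have "10 \<le> \<epsilon> * ln (3 * real D / (10 * pi))" using c e by (simp add: pos_divide_le_eq mult.commute)
  moreover have "0 < ln (3 * real D / (10 * pi))" using c c0 by linarith
  ultimately have "10 / ln (3 * real D / (10 * pi)) \<le> \<epsilon>" by blast
  moreover have "Lambda D \<ge> - (10 / ln (3 * real D / (10 * pi)))"
    by (rule Lambda_lower_bound[OF D_large(3)]) (use c c0 in linarith)
  ultimately have "0 \<le> Lambda D + \<epsilon>" by linarith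
  hence "0 \<le> ereal (Lambda D) + ereal \<epsilon>" by simp
  also have "\<dots> \<le> Lambda_Kr + ereal \<epsilon>"
    unfolding Lambda_Kr_def by (intro add_right_mono SUP_upper) (use D_large(2) in simp)
  finally show "0 \<le> Lambda_Kr + ereal \<epsilon>" .
qed

end
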